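(* Let $n\ge 3$ and let $G=(V,E)$ be the complete undirected graph on $n$ nodes with edge costs $c(e)\in\{1,2\}$ for all $e\in E$. Let $x$ be a fractional 2-matching (F2M) that is 2-connected and canonical. Then there exists a tour (Hamiltonian cycle) in $G$ of cost at most $\frac{10}{9}\sum_{e\in E}c(e)x(e)$.
   Context: A fractional 2-matching (F2M) is an extreme point of the polytope $\{x\in\mathbb{R}^E: \sum_{e\in\delta(i)}x(e)=2\ \forall i\in V,\ 0\le x(e)\le 1\ \forall e\in E\}$, where $\delta(S)$ is the set of edges with exactly one endpoint in $S$ and $\delta(i)=\delta(\{i\})$. Its cost is $\sum_{e}c(e)x(e)$. It is well known that every such extreme point is half-integral and each connected component of its support graph is either a cycle (on at least three nodes) of edges with $x(e)=1$, or consists of node-disjoint odd cycles of edges with $x(e)=\frac12$ ("cycle edges"; their nodes are "cycle nodes") connected by paths of edges with $x(e)=1$ ("1-paths") whose endpoints are cycle nodes. The F2M $x$ is 2-connected if $\sum_{e\in\delta(S)}x(e)\ge 2$ for every nonempty proper subset $S\subset V$. The F2M $x$ is canonical if there is no 1-path consisting of a single edge of cost 1 whose two endpoints lie in different odd cycles of cycle edges and such that the four cycle edges incident to its endpoints all have cost 1. *)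

theory Defs
  imports "HOL-Analysis.Analysis"
begin

text \<open>The complete graph on the nodes of a finite type; an edge is a two-element set of nodes.\<close>

definition edges :: "'v::finite set set" where
  "edges = {e. card e = 2}"

definition cut :: "'v::finite set \<Rightarrow> 'v set set" where
  "cut S = {e \<in> edges. card (e \<inter> S) = 1}"

text \<open>
  \<open>\<real>\<^sup>E\<close> is represented as the coordinate subspace of \<open>real ^ ('v set)\<close> consisting of the vectors
  that vanish at all sets that are not edges (last conjunct).
\<close>

definition f2m_polytope :: "(real ^ ('v::finite set)) set" where
  "f2m_polytope =
     {x. (\<forall>i. (\<Sum>e\<in>cut {i}. x $ e) = 2) \<and>
         (\<forall>e\<in>edges. 0 \<le> x $ e \<and> x $ e \<le> 1) \<and>
         (\<forall>e. e \<notin> edges \<longrightarrow> x $ e = 0)}"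

definition F2M :: "real ^ ('v::finite set) \<Rightarrow> bool" where
  "F2M x \<longleftrightarrow> x extreme_point_of f2m_polytope"

definition two_connected :: "real ^ ('v::finite set) \<Rightarrow> bool" where
  "two_connected x \<longleftrightarrow> (\<forall>S. S \<noteq> {} \<and> S \<noteq> UNIV \<longrightarrow> (\<Sum>e\<in>cut S. x $ e) \<ge> 2)"

definition closed_walk_edges :: "'v list \<Rightarrow> 'v set set" where
  "closed_walk_edges vs = {{vs ! i, vs ! (Suc i mod length vs)} | i. i < length vs}"

text \<open>
  A cycle is identified with its edge set, so that different rotations and orientations of a node
  sequence describe the same cycle. Its node set is the union of its edges.
\<close>

definition is_cycle :: "'v set set \<Rightarrow> bool" where
  "is_cycle C \<longleftrightarrow> (\<exists>vs. distinct vs \<and> length vs \<ge> 3 \<and> C = closed_walk_edges vs)"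

definition tour :: "'v::finite set set \<Rightarrow> bool" where
  "tour T \<longleftrightarrow> is_cycle T \<and> \<Union>T = UNIV"

definition cycle_edge :: "real ^ ('v::finite set) \<Rightarrow> 'v set \<Rightarrow> bool" where
  "cycle_edge x e \<longleftrightarrow> e \<in> edges \<and> x $ e = 1 / 2"

definition cycle_node :: "real ^ ('v::finite set) \<Rightarrow> 'v \<Rightarrow> bool" where
  "cycle_node x v \<longleftrightarrow> (\<exists>e. cycle_edge x e \<and> v \<in> e)"

definition odd_half_cycle :: "real ^ ('v::finite set) \<Rightarrow> 'v set set \<Rightarrow> bool" where
  "odd_half_cycle x C \<longleftrightarrow> is_cycle C \<and> odd (card C) \<and> (\<forall>e\<in>C. cycle_edge x e)"

text \<open>
  No inner node of such a path can be a cycle node, because of the degree constraints.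
\<close>

definition one_path :: "real ^ ('v::finite set) \<Rightarrow> 'v list \<Rightarrow> bool" where
  "one_path x vs \<longleftrightarrow>
     length vs \<ge> 2 \<and> distinct vs \<and>
     (\<forall>i. Suc i < length vs \<longrightarrow> x $ {vs ! i, vs ! Suc i} = 1) \<and>
     cycle_node x (hd vs) \<and> cycle_node x (last vs)"

text \<open>
  For an F2M every cycle node lies on exactly two cycle edges, and the two odd cycles are
  node-disjoint; so the last conjunct concerns exactly four edges.
\<close>

definition canonical :: "('v::finite set \<Rightarrow> real) \<Rightarrow> real ^ ('v set) \<Rightarrow> bool" where
  "canonical c x \<longleftrightarrow>
     \<not> (\<exists>u v. one_path x [u, v] \<and> c {u, v} = 1 \<and>
          (\<exists>C D. odd_half_cycle x C \<and> odd_half_cycle x D \<and> C \<noteq> D \<and> u \<in> \<Union>C \<and> v \<in> \<Union>D) \<and>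
          (\<forall>e. cycle_edge x e \<and> (u \<in> e \<or> v \<in> e) \<longrightarrow> c e = 1))"

end

theory Submission
  imports Defs "HOL-Library.Multiset"
begin

text \<open>
  Let \<open>w u v\<close> be the value of the edge \<open>{u, v}\<close> and call \<open>u\<close>, \<open>v\<close> adjacent if \<open>w u v > 0\<close> and the
  edge has cost 1. Extremeness gives every node two edges of weight 1, or one edge of weight 1 and two of
  weight 1/2, and forbids 4-cycles of weight 1/2.

  Partition the \<open>n\<close> nodes into closed and open node sequences along adjacent nodes, with as few pieces as
  possible, then as many closed pieces as possible, then as many edges of weight 1 inside the open pieces as
  possible. Stringing \<open>m\<close> pieces together gives a tour of cost at most \<open>n + m\<close>, while the cost of the
  fractional solution is \<open>n + \<Phi>/10\<close>, where \<open>\<Phi>\<close> is the sum over all nodes of 5 times the weight of the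
  incident edges of cost 2. So it suffices that \<open>9 * m \<le> n + \<Phi>\<close>, unless one closed piece covers everything,
  when it is a tour of cost \<open>n\<close>.

  This inequality is proved by charging. An inner node of an open piece is claimed by \<open>f\<close> if it is adjacent
  to \<open>f\<close> outside the piece's sequence, where \<open>f\<close> is an end of an open piece or lies on a closed piece. By
  optimality, ends and closed pieces are adjacent only to their own piece and to claimed nodes, so every
  missing edge at an end pays for a claimed node or contributes to \<open>\<Phi>\<close>. In an open piece the claimed nodes are
  separated by unclaimed ones except at edges joining two claimed nodes. Exchange arguments determine who can
  claim consecutive nodes; each such edge is paid for by an edge joining two unclaimed nodes, by a gap
  between two claims of the same closed piece, or by a triangle at an end. The gaps are paid for by the closed
  pieces, using 2-connectivity for pieces of at most five nodes.
\<close>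

section \<open>Half-integral weights and covers by paths and cycles\<close>

text \<open>The constants fit together as follows. For a tour of cost at most n + m, the bound 10/9
  (n + \<Phi>/10) amounts to 9m \<le> n + \<Phi>; the factor 5 in \<open>phi\<close> becomes 10
  because an edge of cost 2 is met at both of its nodes. If claimed and unclaimed nodes alternated
  strictly on an open piece, its length would be 1 plus twice its number of claimed nodes. So each
  claimed node brings two units to its claimer, each end of a longer piece collects at least 4 for
  its missing edges, and 9 = 1 + 4 + 4. The tie-breaks make this work. Maximising edges of weight 1
  forces a missing edge of weight 1 at an end to have cost 2, so that it is worth 5; this matters
  when it is the only missing edge. Preferring closed pieces makes chords from an end into its own
  piece restrictive: the loop closed by such a chord can be split off as a closed piece. The
  obstacle is that alternation can fail. Two consecutive claimed nodes lose one unit, which this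
  budget does not cover, so every such pair must be matched injectively with something that gains a
  unit.\<close>

locale half_graph =
  fixes w :: "'v::finite \<Rightarrow> 'v \<Rightarrow> real" and k :: "'v \<Rightarrow> 'v \<Rightarrow> bool"
  assumes w_sym: "w u v = w v u"
    and w_irrefl: "w u u = 0"
    and w_values: "w u v = 0 \<or> w u v = 1/2 \<or> w u v = 1"
    and w_sum: "(\<Sum>v\<in>UNIV. w u v) = 2"
    and half_degree: "card {v. w u v = 1/2} = 0 \<or> card {v. w u v = 1/2} = 2"
    and w_cut: "S \<noteq> {} \<Longrightarrow> S \<noteq> UNIV \<Longrightarrow> (\<Sum>u\<in>S. \<Sum>v\<in>-S. w u v) \<ge> 2"
    and no_half_quad: "w a b = 1/2 \<Longrightarrow> w b c = 1/2 \<Longrightarrow> w c d = 1/2 \<Longrightarrow> w d a = 1/2 \<Longrightarrow> a = c \<or> b = d"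
    and k_sym: "k u v \<longleftrightarrow> k v u"
begin

definition adj :: "'v \<Rightarrow> 'v \<Rightarrow> bool" where
  "adj u v \<longleftrightarrow> w u v > 0 \<and> \<not> k u v"

lemma adj_sym: "adj u v \<longleftrightarrow> adj v u"
  unfolding adj_def using w_sym k_sym by metis

lemma adj_irrefl [simp]: "\<not> adj u u"
  unfolding adj_def by (simp add: w_irrefl)

lemma w_nonneg: "w u v \<ge> 0"
  using w_values[of u v] by auto

lemma w_le_1: "w u v \<le> 1"
  using w_values[of u v] by auto

lemma w_sum_split: "2 = real (card {v. w u v = 1}) + real (card {v. w u v = 1/2}) / 2"
proof -
  have "w u v = (if w u v = 1 then 1 else 0) + (if w u v = 1/2 then 1/2 else 0)" for v
    using w_values[of u v] by auto
  then have "(\<Sum>v\<in>UNIV. w u v)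
      = (\<Sum>v\<in>UNIV. (if w u v = 1 then 1 else 0) + (if w u v = 1/2 then 1/2 else 0))"
    by (metis (no_types, lifting) sum.cong)
  also have "\<dots> = real (card {v. w u v = 1}) + real (card {v. w u v = 1/2}) / 2"
    by (simp add: sum.distrib sum.If_cases)
  finally show ?thesis using w_sum[of u] by simp
qed

lemma node_types:
  "(card {v. w u v = 1} = 2 \<and> {v. w u v = 1/2} = {})
   \<or> (card {v. w u v = 1} = 1 \<and> card {v. w u v = 1/2} = 2)"
  using w_sum_split[of u] half_degree[of u] by auto

definition nbs :: "'v \<Rightarrow> 'v set" where
  "nbs u = {v. w u v > 0}"

lemma nbs_split: "nbs u = {v. w u v = 1} \<union> {v. w u v = 1/2}"
  unfolding nbs_def using w_values[of u] by force

lemma adj_nbs: "adj u v \<Longrightarrow> v \<in> nbs u"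
  unfolding adj_def nbs_def by simp

lemma card_nbs: "card (nbs u) = card {v. w u v = 1} + card {v. w u v = 1/2}"
  unfolding nbs_split by (rule card_Un_disjoint) auto

lemma card_nbs_le: "card (nbs u) \<le> 3"
  using node_types[of u] card_nbs[of u] by auto

lemma card_nbs_ge: "card (nbs u) \<ge> 2"
  using node_types[of u] card_nbs[of u] by auto

text \<open>This is how the bound of three neighbours is applied: once two neighbours are taken by a
  piece, at most one is left.\<close>

lemma nbs_third:
  assumes "a \<in> nbs u" "b \<in> nbs u" "c \<in> nbs u" "d \<in> nbs u" "a \<noteq> b" "c \<noteq> a" "c \<noteq> b" "d \<noteq> a" "d \<noteq> b"
  shows "c = d"
proof (rule ccontr)
  assume "c \<noteq> d"
  then have "card {a, b, c, d} = 4" using assms by auto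
  moreover have "card {a, b, c, d} \<le> card (nbs u)" using assms by (intro card_mono) auto
  ultimately show False using card_nbs_le[of u] by simp
qed

text \<open>By \<open>node_types\<close>, a node with three neighbours has only one edge of weight
  1.\<close>

lemma three_nbs:
  assumes "a \<in> nbs u" "b \<in> nbs u" "c \<in> nbs u" "a \<noteq> b" "a \<noteq> c" "b \<noteq> c" "w u a = 1"
  shows "w u b = 1/2" "w u c = 1/2"
proof -
  have "card {a, b, c} = 3" using assms by auto
  moreover have "card {a, b, c} \<le> card (nbs u)" using assms by (intro card_mono) auto
  ultimately have "card {v. w u v = 1} = 1" using node_types[of u] card_nbs[of u] by auto
  then obtain z where "{v. w u v = 1} = {z}" by (auto simp: card_1_singleton_iff)
  then have "v = z" if "w u v = 1" for v using that by auto
  then have "w u b \<noteq> 1" "w u c \<noteq> 1" using assms by metis+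
  moreover have "w u b > 0" "w u c > 0" using assms by (auto simp: nbs_def)
  ultimately show "w u b = 1/2" "w u c = 1/2" using w_values[of u b] w_values[of u c] by auto
qed

lemma ex_one: "\<exists>v. w u v = 1"
proof -
  have "card {v. w u v = 1} > 0" using node_types[of u] by auto
  then show ?thesis by (auto simp: card_gt_0_iff)
qed

lemma succ_flip [simp]: "successively (\<lambda>x y. adj y x) xs = successively adj xs"
  by (simp add: adj_sym)

lemma succ_rev [simp]: "successively adj (rev xs) = successively adj xs"
  by (simp add: successively_rev adj_sym)

text \<open>A piece is a closed or open node sequence along adjacent nodes. Distinctness is not part of
  validity: it follows for the pieces of a cover because their node multisets add up to the node set.\<close>

definition valid :: "bool \<times> 'v list \<Rightarrow> bool" where
  "valid p \<longleftrightarrow> snd p \<noteq> [] \<and> successively adj (snd p) \<and>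
     (fst p \<longrightarrow> length (snd p) \<ge> 3 \<and> adj (last (snd p)) (hd (snd p)))"

definition nodes :: "(bool \<times> 'v list) multiset \<Rightarrow> 'v multiset" where
  "nodes Q = (\<Sum>p\<in>#Q. mset (snd p))"

definition cover :: "(bool \<times> 'v list) multiset \<Rightarrow> bool" where
  "cover Q \<longleftrightarrow> (\<forall>p\<in>#Q. valid p) \<and> nodes Q = mset_set UNIV"

definition closeds :: "(bool \<times> 'v list) multiset \<Rightarrow> nat" where
  "closeds Q = size (filter_mset fst Q)"

fun ones :: "'v list \<Rightarrow> nat" where
  "ones (x # y # zs) = (if w x y = 1 then 1 else 0) + ones (y # zs)"
| "ones _ = 0"

definition path_ones :: "(bool \<times> 'v list) multiset \<Rightarrow> nat" where
  "path_ones Q = (\<Sum>p\<in>#filter_mset (\<lambda>p. \<not> fst p) Q. ones (snd p))"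

definition better :: "(bool \<times> 'v list) multiset \<Rightarrow> (bool \<times> 'v list) multiset \<Rightarrow> bool" where
  "better Q' Q \<longleftrightarrow> size Q' < size Q \<or> size Q' = size Q \<and>
     (closeds Q' > closeds Q \<or> closeds Q' = closeds Q \<and> path_ones Q' > path_ones Q)"

definition optimal :: "(bool \<times> 'v list) multiset \<Rightarrow> bool" where
  "optimal Q \<longleftrightarrow> cover Q \<and> (\<forall>Q'. cover Q' \<longrightarrow> \<not> better Q' Q)"

lemma nodes_simps [simp]:
  "nodes {#} = {#}" "nodes (add_mset p Q) = mset (snd p) + nodes Q" "nodes (Q + Q') = nodes Q + nodes Q'"
  by (auto simp: nodes_def)

lemma closeds_simps [simp]:
  "closeds {#} = 0" "closeds (add_mset p Q) = (if fst p then 1 else 0) + closeds Q"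
  "closeds (Q + Q') = closeds Q + closeds Q'"
  by (auto simp: closeds_def)

lemma path_ones_simps [simp]:
  "path_ones {#} = 0"
  "path_ones (add_mset p Q) = (if fst p then 0 else ones (snd p)) + path_ones Q"
  "path_ones (Q + Q') = path_ones Q + path_ones Q'"
  by (auto simp: path_ones_def)

text \<open>All three criteria are additive over pieces, so it is enough to compare the parts that
  an exchange changes.\<close>

lemma better_add: "better (Q' + R) (Q + R) \<longleftrightarrow> better Q' Q"
  by (simp add: better_def)

lemma ones_le: "xs \<noteq> [] \<Longrightarrow> ones xs < length xs"
  by (induction xs rule: ones.induct) auto

lemma ones_append: "xs \<noteq> [] \<Longrightarrow> ys \<noteq> [] \<Longrightarrow>
  ones (xs @ ys) = ones xs + ones ys + (if w (last xs) (hd ys) = 1 then 1 else 0)"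
proof (induction xs rule: ones.induct)
  case (1 x y zs)
  then show ?case by simp
next
  case ("2_1")
  then show ?case by simp
next
  case ("2_2" v)
  then show ?case by (cases ys) auto
qed

lemma ones_rev: "ones (rev xs) = ones xs"
proof (induction xs)
  case (Cons a xs)
  then show ?case
    by (cases "xs = []") (simp_all add: ones_append last_rev w_sym, cases xs, simp_all add: w_sym)
qed simp

lemma nodes_size: "size (nodes Q) = (\<Sum>p\<in>#Q. length (snd p))"
  by (induction Q) auto

lemma cover_length: "cover Q \<Longrightarrow> (\<Sum>p\<in>#Q. length (snd p)) = CARD('v)"
  using nodes_size[of Q] by (simp add: cover_def)

lemma sum_len_bounds:
  assumes "\<forall>p\<in>#Q. valid p"
  shows "size Q \<le> (\<Sum>p\<in>#Q. length (snd p))" "path_ones Q \<le> (\<Sum>p\<in>#Q. length (snd p))"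
    "closeds Q \<le> (\<Sum>p\<in>#Q. length (snd p))"
  using assms
proof (induction Q)
  case (add p Q)
  {
    case 1
    then show ?case using add by (cases "snd p") (auto simp: valid_def)
  next
    case 2
    have "ones (snd p) \<le> length (snd p)" using 2 ones_le[of "snd p"] by (auto simp: valid_def)
    then show ?case using add 2 by auto
  next
    case 3
    then show ?case using add by (cases "snd p") (auto simp: valid_def)
  }
qed auto

text \<open>The counts to be maximised are bounded by the number of nodes, so their distances from
  that bound can be minimised in a lexicographic well-founded order. The cover by single nodes gives
  a starting point.\<close>

lemma ex_optimal: "\<exists>Q. optimal Q"
proof -
  define B where "B = CARD('v)"
  define m where "m Q = (size Q, (B - closeds Q, B - path_ones Q))" for Q
  define r where "r = less_than <*lex*> (less_than <*lex*> less_than)"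
  have "cover (image_mset (\<lambda>v. (False, [v])) (mset_set UNIV))"
    unfolding cover_def by (auto simp: valid_def nodes_def image_mset.compositionality comp_def)
  then have "image_mset (\<lambda>v. (False, [v])) (mset_set UNIV) \<in> Collect cover" by simp
  moreover have "wf (inv_image r m)" unfolding r_def by (intro wf_inv_image wf_lex_prod) auto
  ultimately obtain Q where Q: "Q \<in> Collect cover" "\<And>Q'. (Q', Q) \<in> inv_image r m \<Longrightarrow> Q' \<notin> Collect cover"
    using wfE_min[of "inv_image r m" _ "Collect cover"] by metis
  have "\<not> better Q' Q" if c: "cover Q'" for Q'
  proof
    assume b: "better Q' Q"
    have "closeds Q' \<le> B" "path_ones Q' \<le> B" "closeds Q \<le> B" "path_ones Q \<le> B"
      using sum_len_bounds[of Q'] sum_len_bounds[of Q] cover_length[OF c] cover_length[of Q] Q(1) c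
      by (auto simp: B_def cover_def)
    then have "(Q', Q) \<in> inv_image r m" using b
      unfolding better_def r_def m_def by auto
    then show False using Q(2) c by auto
  qed
  then show ?thesis using Q(1) unfolding optimal_def by auto
qed

end

section \<open>Replacing pieces of an optimal cover\<close>

locale optimal_cover = half_graph +
  fixes Q :: "(bool \<times> 'a list) multiset"
  assumes opt: "optimal Q"
begin

lemma cover_Q: "cover Q"
  using opt by (simp add: optimal_def)

lemma exchange:
  assumes "old \<subseteq># Q" "\<forall>p\<in>#new. valid p" "nodes new = nodes old"
  shows "\<not> better new old"
proof
  assume b: "better new old"
  obtain R where R: "Q = old + R" using assms(1) by (metis subset_mset.add_diff_inverse)
  have "cover (new + R)" using cover_Q assms R by (auto simp: cover_def)
  then have "\<not> better (new + R) Q" using opt by (simp add: optimal_def)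
  then show False using b by (simp add: R better_add)
qed

lemma piece_valid: "p \<in># Q \<Longrightarrow> valid p"
  using cover_Q by (auto simp: cover_def)

lemma piece_nodes: "p \<in># Q \<Longrightarrow> mset (snd p) \<subseteq># mset_set UNIV"
proof -
  assume "p \<in># Q"
  then have "nodes Q = mset (snd p) + nodes (Q - {#p#})" by (metis insert_DiffM nodes_simps(2))
  then show ?thesis using cover_Q by (metis cover_def mset_subset_eq_add_left)
qed

lemma piece_distinct: "p \<in># Q \<Longrightarrow> distinct (snd p)"
proof -
  assume "p \<in># Q"
  then have "count (mset (snd p)) a \<le> 1" for a
    using piece_nodes[of p] by (metis count_mset_set(1) finite UNIV_I mset_subset_eq_count)
  then show ?thesis
    by (metis count_mset_0_iff distinct_count_atmost_1 le_antisym less_one not_le)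
qed

lemma pieces_disjoint:
  assumes "p \<in># Q" "q \<in># Q" "p \<noteq> q"
  shows "set (snd p) \<inter> set (snd q) = {}"
proof (rule ccontr)
  assume "set (snd p) \<inter> set (snd q) \<noteq> {}"
  then obtain a where a: "a \<in># mset (snd p)" "a \<in># mset (snd q)" by auto
  have "Q = add_mset p (add_mset q (Q - {#p#} - {#q#}))"
    using assms by (metis insert_DiffM insert_noteq_member)
  then have "nodes Q = mset (snd p) + (mset (snd q) + nodes (Q - {#p#} - {#q#}))"
    by (metis nodes_simps(2))
  moreover have "count (nodes Q) a \<le> 1" using cover_Q by (simp add: cover_def)
  moreover have "count (mset (snd p)) a \<ge> 1" "count (mset (snd q)) a \<ge> 1"
    using a by (auto simp: Suc_le_eq)
  ultimately show False by simp
qed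

lemma covered: "\<exists>p\<in>#Q. a \<in> set (snd p)"
proof -
  have "a \<in># nodes Q" using cover_Q by (simp add: cover_def)
  then show ?thesis by (auto simp: nodes_def)
qed

text \<open>The exchange arguments only depend on the nodes of a piece and on its number of edges of weight 1,
  so pieces may be reversed or rotated freely.\<close>

definition inQ :: "bool \<times> 'a list \<Rightarrow> bool" where
  "inQ p \<longleftrightarrow> (\<exists>q\<in>#Q. fst q = fst p \<and> mset (snd q) = mset (snd p) \<and> (\<not> fst p \<longrightarrow> ones (snd q) = ones (snd p)))"

text \<open>The piece of \<open>Q\<close> behind a list that may be reversed or rotated. Several
  lists can be exchanged together only if these pieces are distinct; otherwise one piece of
  \<open>Q\<close> would be removed twice.\<close>

definition rep :: "bool \<times> 'a list \<Rightarrow> bool \<times> 'a list" where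
  "rep p = (SOME q. q \<in># Q \<and> fst q = fst p \<and> mset (snd q) = mset (snd p) \<and>
     (\<not> fst p \<longrightarrow> ones (snd q) = ones (snd p)))"

lemma rep: "inQ p \<Longrightarrow> rep p \<in># Q \<and> fst (rep p) = fst p \<and> mset (snd (rep p)) = mset (snd p) \<and>
    (\<not> fst p \<longrightarrow> ones (snd (rep p)) = ones (snd p))"
  unfolding inQ_def rep_def by (rule someI_ex) blast

lemma inQ_distinct: "inQ p \<Longrightarrow> distinct (snd p)"
  using rep[of p] piece_distinct mset_eq_imp_distinct_iff by blast

lemma exchange_list:
  assumes "\<forall>p\<in>set ps. inQ p" "distinct (map rep ps)" "\<forall>p\<in>#new. valid p"
    "nodes new = nodes (mset ps)"
  shows "\<not> better new (mset ps)"
proof -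
  let ?old = "mset (map rep ps)"
  have sub: "?old \<subseteq># Q"
    using assms(1,2) rep by (intro mset_subset_eqI) (auto simp: distinct_count_atmost_1 count_eq_zero_iff not_in_iff Suc_le_eq)
  have eq: "nodes (mset (map rep ps)) = nodes (mset ps) \<and> size (mset (map rep ps)) = size (mset ps) \<and>
     closeds (mset (map rep ps)) = closeds (mset ps) \<and> path_ones (mset (map rep ps)) = path_ones (mset ps)"
    using assms(1) by (induction ps) (auto simp: rep)
  have "\<not> better new ?old" using exchange[OF sub assms(3)] assms(4) eq by simp
  then show ?thesis using eq by (simp add: better_def)
qed

lemma rep_neI:
  assumes "inQ p" "inQ q" "a \<in> set (snd p)" "a \<notin> set (snd q)"
  shows "rep p \<noteq> rep q"
  using assms rep by (metis mset_eq_setD)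

lemma exchange_one:
  assumes "inQ p" "\<forall>p\<in>#new. valid p" "nodes new = mset (snd p)"
  shows "\<not> better new {#p#}"
  using exchange_list[of "[p]" new] assms by simp

lemma exchange_two:
  assumes "inQ p" "inQ q" "rep p \<noteq> rep q" "\<forall>p\<in>#new. valid p" "nodes new = mset (snd p) + mset (snd q)"
  shows "\<not> better new {#p, q#}"
  using exchange_list[of "[p, q]" new] assms by simp

lemma exchange_three:
  assumes "inQ p" "inQ q" "inQ r" "rep p \<noteq> rep q" "rep p \<noteq> rep r" "rep q \<noteq> rep r"
    "\<forall>p\<in>#new. valid p" "nodes new = mset (snd p) + mset (snd q) + mset (snd r)"
  shows "\<not> better new {#p, q, r#}"
  using exchange_list[of "[p, q, r]" new] assms by (simp add: add.assoc)

end

section \<open>Exchange arguments\<close>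

lemma mset_rotate: "mset (rotate n xs) = mset xs"
  by (metis append_take_drop_id mset_append rotate_drop_take union_commute)

context optimal_cover
begin

section \<open>Pieces up to reversal and rotation\<close>

definition pathin :: "'a list \<Rightarrow> bool" where
  "pathin xs \<longleftrightarrow> (False, xs) \<in># Q \<or> (False, rev xs) \<in># Q"

definition cycin :: "'a list \<Rightarrow> bool" where
  "cycin zs \<longleftrightarrow> (\<exists>ys n. (True, ys) \<in># Q \<and> (zs = rotate n ys \<or> zs = rev (rotate n ys)))"

text \<open>Since \<open>pathin\<close> is closed under reversal, \<open>last\<close> reaches both
  ends of an open piece.\<close>

definition is_end :: "'a \<Rightarrow> bool" where
  "is_end f \<longleftrightarrow> (\<exists>xs. pathin xs \<and> last xs = f)"

definition is_closed :: "'a \<Rightarrow> bool" where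
  "is_closed a \<longleftrightarrow> (\<exists>zs. cycin zs \<and> a \<in> set zs)"

lemma pathin_rev: "pathin xs \<Longrightarrow> pathin (rev xs)"
  by (auto simp: pathin_def)

lemma pathin_inQ: "pathin xs \<Longrightarrow> inQ (False, xs)"
  unfolding pathin_def inQ_def by (elim disjE) (force simp: ones_rev)+

lemma pathin_valid: "pathin xs \<Longrightarrow> xs \<noteq> [] \<and> successively adj xs"
  unfolding pathin_def using piece_valid[of "(False, xs)"] piece_valid[of "(False, rev xs)"]
  by (auto simp: valid_def)

lemma pathin_distinct: "pathin xs \<Longrightarrow> distinct xs"
  using pathin_inQ inQ_distinct by force

lemma cycin_rev: "cycin zs \<Longrightarrow> cycin (rev zs)"
  unfolding cycin_def by (metis rev_rev_ident)

lemma cycin_inQ: "cycin xs \<Longrightarrow> inQ (True, xs)"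
  unfolding cycin_def inQ_def by (force simp: mset_rotate)

lemma valid_rotate1: "valid (True, xs) \<Longrightarrow> valid (True, rotate1 xs)"
  by (cases xs) (auto simp: valid_def successively_append_iff successively_Cons last_append split: if_splits)

lemma valid_rotate: "valid (True, xs) \<Longrightarrow> valid (True, rotate n xs)"
  by (induction n) (auto intro: valid_rotate1)

lemma valid_rev: "valid (b, xs) \<Longrightarrow> valid (b, rev xs)"
  by (auto simp: valid_def hd_rev last_rev adj_sym)

lemma cycin_valid: "cycin xs \<Longrightarrow> valid (True, xs)"
  unfolding cycin_def using piece_valid valid_rotate valid_rev by blast

lemma cycin_distinct: "cycin xs \<Longrightarrow> distinct xs"
  using cycin_inQ inQ_distinct by force

lemma cycin_rotate: "cycin zs \<Longrightarrow> cycin (rotate m zs)"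
proof -
  assume "cycin zs"
  then obtain ys n where yn: "(True, ys) \<in># Q" "zs = rotate n ys \<or> zs = rev (rotate n ys)"
    by (auto simp: cycin_def)
  then consider "rotate m zs = rotate (m + n) ys" | "rotate m zs = rev (rotate (length ys - m mod length ys) (rotate n ys))"
    using rotate_rev[of m "rotate n ys"] by (auto simp: rotate_rotate)
  then show ?thesis using yn(1) by cases (auto simp: cycin_def rotate_rotate)
qed

lemma rotate_to_hd: "g \<in> set xs \<Longrightarrow> \<exists>n. hd (rotate n xs) = g"
proof -
  assume "g \<in> set xs"
  then obtain i where "i < length xs" "xs ! i = g" by (auto simp: in_set_conv_nth)
  then have "hd (rotate i xs) = g" by (subst hd_rotate_conv_nth) auto
  then show ?thesis by blast
qed

lemma cycin_hd: "cycin zs \<Longrightarrow> a \<in> set zs \<Longrightarrow> \<exists>ys. cycin ys \<and> hd ys = a \<and> set ys = set zs"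
  using rotate_to_hd[of a zs] cycin_rotate by (metis set_rotate)

lemma cycin_last: "cycin zs \<Longrightarrow> a \<in> set zs \<Longrightarrow> \<exists>ys. cycin ys \<and> last ys = a \<and> set ys = set zs"
  using cycin_hd[of zs a] cycin_rev by (metis last_rev set_rev)

lemma valid_hd:
  assumes "valid (True, zs)" "a \<in> set zs"
  obtains ys where "valid (True, ys)" "hd ys = a" "mset ys = mset zs"
  using rotate_to_hd[of a zs] valid_rotate[OF assms(1)] assms(2) by (metis mset_rotate)

lemma path_path:
  assumes "pathin xs" "pathin ys" "set xs \<inter> set ys \<noteq> {}"
  shows "ys = xs \<or> ys = rev xs"
proof -
  obtain xs' ys' where q: "(False, xs') \<in># Q" "(False, ys') \<in># Q" "xs = xs' \<or> xs = rev xs'"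
      "ys = ys' \<or> ys = rev ys'"
    using assms unfolding pathin_def by (metis rev_rev_ident)
  then have "xs' = ys'" using pieces_disjoint[OF q(1,2)] assms(3) by auto
  then show ?thesis using q by auto
qed

lemma path_cyc:
  assumes "pathin xs" "cycin ys"
  shows "set xs \<inter> set ys = {}"
proof -
  obtain xs' ys' where q: "(False, xs') \<in># Q" "(True, ys') \<in># Q" "set xs = set xs'" "set ys = set ys'"
    using assms unfolding pathin_def cycin_def by (metis set_rev set_rotate)
  then show ?thesis using pieces_disjoint[OF q(1,2)] by auto
qed

lemma cyc_cyc:
  assumes "cycin xs" "cycin ys"
  shows "set xs \<inter> set ys = {} \<or> set xs = set ys"
proof -
  obtain xs' ys' where q: "(True, xs') \<in># Q" "(True, ys') \<in># Q" "set xs = set xs'" "set ys = set ys'"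
    using assms unfolding cycin_def by (metis set_rev set_rotate)
  then show ?thesis using pieces_disjoint[OF q(1,2)] by auto
qed

lemma node_cases:
  obtains xs where "pathin xs" "a \<in> set xs" | zs where "cycin zs" "a \<in> set zs"
proof -
  obtain b xs where "(b, xs) \<in># Q" "a \<in> set xs" using covered[of a] by auto
  moreover have "cycin xs" if "(True, xs) \<in># Q"
    unfolding cycin_def using that rotate0 by (metis id_apply)
  ultimately show ?thesis using that(1)[of xs] that(2)[of xs]
    by (cases b) (auto simp: pathin_def)
qed

lemma end_hd: "pathin xs \<Longrightarrow> is_end (hd xs)"
  unfolding is_end_def using pathin_rev last_rev by blast

lemma end_last: "pathin xs \<Longrightarrow> is_end (last xs)"
  unfolding is_end_def by blast

text \<open>Paths that share a node agree up to reversal, so an end not on \<open>R\<close> comes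
  with a disjoint path that can be attached by it. Most exchange arguments below split into these
  cases.\<close>

lemma end_cases:
  assumes "is_end f" "pathin R"
  obtains "f = hd R" | "f = last R" | F where "pathin F" "last F = f" "set F \<inter> set R = {}"
proof -
  obtain F where F: "pathin F" "last F = f" using assms by (auto simp: is_end_def)
  show ?thesis
  proof (cases "set R \<inter> set F = {}")
    case True then show ?thesis using F that(3)[of F] by blast
  next
    case False
    then show ?thesis using path_path[OF assms(2) F(1)] F(2) that(1,2) pathin_valid[OF assms(2)]
      by (metis last_rev)
  qed
qed

lemma end_not_closed: "is_end f \<Longrightarrow> \<not> is_closed f"
  unfolding is_end_def is_closed_def using path_cyc pathin_valid by (metis disjoint_iff last_in_set)

lemma rep_disj: "inQ p \<Longrightarrow> inQ q \<Longrightarrow> snd p \<noteq> [] \<Longrightarrow> set (snd p) \<inter> set (snd q) = {} \<Longrightarrow> rep p \<noteq> rep q"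
  using rep_neI[of p q "hd (snd p)"] by (metis disjoint_iff hd_in_set)

section \<open>Exchanges that optimality rules out\<close>

lemma no_merge2:
  assumes "inQ p" "inQ q" "set (snd p) \<inter> set (snd q) = {}" "snd p \<noteq> []" "valid r"
    "mset (snd r) = mset (snd p) + mset (snd q)"
  shows False
  using exchange_two[of p q "{#r#}"] assms rep_disj[of p q] by (auto simp: better_def)

lemma no_merge3:
  assumes "inQ p" "inQ q" "inQ r" "set (snd p) \<inter> set (snd q) = {}" "set (snd p) \<inter> set (snd r) = {}"
    "set (snd q) \<inter> set (snd r) = {}" "snd p \<noteq> []" "snd q \<noteq> []" "valid s" "valid t"
    "mset (snd s) + mset (snd t) = mset (snd p) + mset (snd q) + mset (snd r)"
  shows False
  using exchange_three[of p q r "{#s, t#}"] assms rep_disj[of p q] rep_disj[of p r] rep_disj[of q r]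
  by (auto simp: better_def)

lemma no_close1:
  assumes "inQ (False, xs)" "valid (True, ys)" "mset ys = mset xs"
  shows False
  using exchange_one[of "(False, xs)" "{#(True, ys)#}"] assms by (auto simp: better_def)

lemma no_close2:
  assumes "inQ (False, xs)" "inQ (False, ys)" "set xs \<inter> set ys = {}" "xs \<noteq> []" "valid (True, s)" "valid (False, t)"
    "mset s + mset t = mset xs + mset ys"
  shows False
  using exchange_two[of "(False, xs)" "(False, ys)" "{#(True, s), (False, t)#}"] assms rep_disj[of "(False, xs)" "(False, ys)"]
  by (auto simp: better_def)

lemma no_ones1:
  assumes "inQ (False, xs)" "valid (False, ys)" "mset ys = mset xs"
  shows "ones ys \<le> ones xs"
  using exchange_one[of "(False, xs)" "{#(False, ys)#}"] assms by (auto simp: better_def)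

lemma no_ones2:
  assumes "inQ (False, xs)" "inQ (False, ys)" "set xs \<inter> set ys = {}" "xs \<noteq> []" "valid (False, s)" "valid (False, t)"
    "mset s + mset t = mset xs + mset ys"
  shows "ones s + ones t \<le> ones xs + ones ys"
  using exchange_two[of "(False, xs)" "(False, ys)" "{#(False, s), (False, t)#}"] assms rep_disj[of "(False, xs)" "(False, ys)"]
  by (auto simp: better_def)

lemmas valid_simps = valid_def successively_append_iff successively_Cons hd_append last_rev hd_rev adj_sym

lemma ends_nonadj:
  assumes "pathin F" "pathin G" "set F \<inter> set G = {}"
  shows "\<not> adj (last F) (last G)"
proof
  assume a: "adj (last F) (last G)"
  have "valid (False, F @ rev G)"
    using a pathin_valid[OF assms(1)] pathin_valid[OF assms(2)] by (simp add: valid_simps)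
  then show False
    using no_merge2[of "(False, F)" "(False, G)" "(False, F @ rev G)"] assms pathin_inQ pathin_valid by auto
qed

lemma same_ends_nonadj:
  assumes "pathin F" "length F \<ge> 3"
  shows "\<not> adj (last F) (hd F)"
  using no_close1[of F F] assms pathin_inQ pathin_valid by (auto simp: valid_def)

text \<open>A closed piece can be opened at any of its nodes and appended to the end, which saves a
  piece.\<close>

lemma end_closed_nonadj:
  assumes "is_end f" "is_closed a"
  shows "\<not> adj f a"
proof
  assume "adj f a"
  obtain F where F: "pathin F" "last F = f" using assms by (auto simp: is_end_def)
  obtain Z where Z: "cycin Z" "hd Z = a" using assms cycin_hd by (meson is_closed_def)
  have "valid (False, F @ Z)"
    using \<open>adj f a\<close> pathin_valid[OF F(1)] cycin_valid[OF Z(1)] F Z by (simp add: valid_simps)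
  then show False
    using no_merge2[of "(False, F)" "(True, Z)" "(False, F @ Z)"] F Z pathin_inQ cycin_inQ pathin_valid path_cyc by auto
qed

lemma closed_closed_nonadj:
  assumes "cycin Y" "cycin Z" "set Y \<inter> set Z = {}" "a \<in> set Y" "b \<in> set Z"
  shows "\<not> adj a b"
proof
  assume "adj a b"
  obtain Y' where Y: "cycin Y'" "last Y' = a" "set Y' = set Y" using assms cycin_last by meson
  obtain Z' where Z: "cycin Z'" "hd Z' = b" "set Z' = set Z" using assms cycin_hd by meson
  have "valid (False, Y' @ Z')"
    using \<open>adj a b\<close> cycin_valid[OF Y(1)] cycin_valid[OF Z(1)] Y Z by (simp add: valid_simps)
  then show False
    using no_merge2[of "(True, Y')" "(True, Z')" "(False, Y' @ Z')"] Y Z cycin_inQ assms cycin_valid[OF Y(1)]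
    by (auto simp: valid_def)
qed

lemma path_split3:
  assumes "pathin G" "g \<in> set G" "g \<noteq> hd G" "g \<noteq> last G"
  obtains A c d B where "G = A @ [c, g, d] @ B"
proof -
  obtain A B where "G = A @ g # B" using assms(2) by (meson split_list)
  moreover have "A \<noteq> []" "B \<noteq> []" using assms calculation by auto
  ultimately show ?thesis using that by (cases B; cases A rule: rev_cases) auto
qed

lemma path_triple:
  assumes "pathin (A @ [c, g, d] @ B)"
  shows "adj c g" "adj g d" "c \<noteq> d" "c \<noteq> g" "g \<noteq> d"
  using pathin_valid[OF assms] pathin_distinct[OF assms] by (auto simp: valid_simps)

text \<open>This is where the third criterion enters. If the edge were off the path,
  \<open>g\<close> would be an inner node with three neighbours, so its edges on its piece would
  have weight 1/2. Rerouting trades one of them for the edge of weight 1.\<close>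

lemma end_one_used:
  assumes F: "pathin F" and fg: "adj (last F) g" "w (last F) g = 1"
  shows "\<exists>F'. F = F' @ [g, last F]"
proof -
  let ?f = "last F"
  have gf: "g \<noteq> ?f" using fg adj_irrefl by metis
  have "\<not> is_closed g" using end_closed_nonadj fg end_last[OF F] by metis
  then obtain G where G: "pathin G" "g \<in> set G" using node_cases[of g] is_closed_def by metis
  show ?thesis
  proof (cases "set F \<inter> set G = {}")
    case True
    have "g \<noteq> last G" using ends_nonadj[OF F G(1) True] fg by metis
    moreover have "g \<noteq> hd G"
      using ends_nonadj[OF F pathin_rev[OF G(1)]] True fg pathin_valid[OF G(1)] by (metis last_rev set_rev)
    ultimately obtain A c d B where GG: "G = A @ [c, g, d] @ B" using path_split3[OF G(1,2)] by metis
    note t = path_triple[OF G(1)[unfolded GG]]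
    have "?f \<notin> set G" using True pathin_valid[OF F] last_in_set[of F] by blast
    then have "?f \<noteq> c" "?f \<noteq> d" unfolding GG by auto
    moreover have "?f \<in> nbs g" "c \<in> nbs g" "d \<in> nbs g" using fg t adj_sym adj_nbs by blast+
    ultimately have "w g c = 1/2"
      using three_nbs(1)[of ?f g c d] fg(2) t(3) w_sym by metis
    then have wc: "w c g \<noteq> 1" using w_sym[of c g] by simp
    \<comment> \<open>Cut \<open>G\<close> before \<open>g\<close> and hand everything from
      \<open>g\<close> on to \<open>F\<close>.\<close>
    have v: "valid (False, A @ [c])" "valid (False, F @ [g, d] @ B)"
      using pathin_valid[OF G(1)] pathin_valid[OF F] fg unfolding GG by (auto simp: valid_simps)
    have "ones (A @ [c]) + ones (F @ [g, d] @ B) \<le> ones F + ones G"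
      using no_ones2[of F G "A @ [c]" "F @ [g, d] @ B"] v True F G(1) pathin_inQ pathin_valid unfolding GG by auto
    moreover have "ones G = ones (A @ [c]) + ones ([g, d] @ B)"
      unfolding GG using ones_append[of "A @ [c]" "[g, d] @ B"] wc by simp
    moreover have "ones (F @ [g, d] @ B) = ones F + ones ([g, d] @ B) + 1"
      using ones_append[of F "[g, d] @ B"] pathin_valid[OF F] fg by simp
    ultimately show ?thesis by simp
  next
    case False
    then have "set G = set F" using path_path[OF F G(1)] by auto
    then obtain A B where FF: "F = A @ g # B" using G(2) by (metis split_list)
    have "B \<noteq> []" using gf FF by auto
    show ?thesis
    proof (cases "length B = 1")
      case True then show ?thesis using FF by (cases B) auto
    next
      case lB: False
      then obtain d B' where B: "B = d # B'" "B' \<noteq> []" using \<open>B \<noteq> []\<close> by (cases B) auto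
      have l: "last F = last B'" using FF B by simp
      show ?thesis
      proof (cases "A = []")
        case True
        then have "length F \<ge> 3" "hd F = g" using FF B by (cases B'; simp)+
        then show ?thesis using same_ends_nonadj[OF F] fg by simp
      next
        case A: False
        then obtain A' c where A': "A = A' @ [c]" by (metis rev_exhaust)
        have dd: "distinct F" using pathin_distinct[OF F] .
        have "pathin (A' @ [c, g, d] @ B')" using F FF B A' by simp
        note t = path_triple[OF this]
        have "last F \<in> set B'" using l B(2) by simp
        then have "last F \<noteq> c" "last F \<noteq> d" using dd unfolding FF B A' by auto
        moreover have "last F \<in> nbs g" "c \<in> nbs g" "d \<in> nbs g" using fg t adj_sym adj_nbs by blast+
        ultimately have "w g d = 1/2"
          using three_nbs(2)[of "last F" g c d] fg(2) t(3) w_sym by metis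
        \<comment> \<open>Reversing the part after \<open>g\<close> replaces the edge from
          \<open>g\<close> to \<open>d\<close> by the edge from \<open>g\<close> to the end.\<close>
        have v: "valid (False, A @ [g] @ rev B)"
          using pathin_valid[OF F] fg l B unfolding FF B by (auto simp: valid_simps)
        have "ones (A @ [g] @ rev B) \<le> ones F"
          using no_ones1[OF pathin_inQ[OF F] v] unfolding FF by simp
        moreover have "ones F = ones (A @ [g]) + ones B"
          using ones_append[of "A @ [g]" B] \<open>w g d = 1/2\<close> unfolding FF B by simp
        moreover have "ones (A @ [g] @ rev B) = ones (A @ [g]) + ones B + 1"
          using ones_append[of "A @ [g]" "rev B"] fg l B ones_rev[of B] by (simp add: hd_rev w_sym)
        ultimately show ?thesis by simp
      qed
    qed
  qed
qed

text \<open>Cutting between \<open>A\<close> and \<open>B\<close> gives two ends that can be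
  attached to \<open>f\<close> and \<open>g\<close>. All positions of \<open>f\<close> and
  \<open>g\<close> but one yield fewer pieces, or equally many with one more closed. In the
  exceptional position both parts become loops, and one piece turns into two. The length assumptions
  make the loops long enough to be closed pieces.\<close>

lemma two_ends:
  assumes "pathin (A @ B)" "A \<noteq> []" "B \<noteq> []" and len: "length (A @ B) \<ge> 3"
    and "is_end f" "is_end g" "f \<noteq> g" "adj (last A) f" "adj (hd B) g"
    and "f = hd A \<Longrightarrow> length A \<ge> 3" "g = last B \<Longrightarrow> length B \<ge> 3"
  shows "f = hd A \<and> g = last B"
proof -
  let ?R = "A @ B"
  note R = assms(1) and ne = assms(2,3)
  note vR = pathin_valid[OF R]
  have hl: "hd ?R = hd A" "last ?R = last B" using ne by auto
  have nin: "inQ (False, ?R)" using pathin_inQ[OF R] .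
  show ?thesis
  proof (cases rule: end_cases[OF assms(5) R])
    case 1
    then have f: "f = hd A" using hl by simp
    have cA: "valid (True, A)" using assms(8,10) f vR ne by (auto simp: valid_simps)
    show ?thesis
    proof (cases rule: end_cases[OF assms(6) R])
      case 1 then show ?thesis using f hl assms(7) by simp
    next
      case 2 then show ?thesis using f hl by simp
    next
      case (3 G)
      have "valid (False, G @ B)" using 3 vR ne assms(9) pathin_valid[OF 3(1)] by (auto simp: valid_simps)
      then show ?thesis
        using no_close2[of ?R G A "G @ B"] R 3 cA pathin_inQ ne by auto
    qed
  next
    case 2
    then have f: "f = last B" using hl by simp
    show ?thesis
    proof (cases rule: end_cases[OF assms(6) R])
      case 1
      then have "valid (True, A @ rev B)" using f hl vR ne assms(8,9) len
        by (auto simp: valid_simps)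
      then show ?thesis using no_close1[of ?R "A @ rev B"] R pathin_inQ by auto
    next
      case 2 then show ?thesis using f hl assms(7) by simp
    next
      case (3 G)
      have "valid (False, A @ rev B @ rev G)"
        using 3 vR ne assms(8,9) f pathin_valid[OF 3(1)] by (auto simp: valid_simps)
      then show ?thesis
        using no_merge2[of "(False, ?R)" "(False, G)" "(False, A @ rev B @ rev G)"] R 3 pathin_inQ ne by auto
    qed
  next
    case (3 F)
    note vF = pathin_valid[OF 3(1)]
    show ?thesis
    proof (cases rule: end_cases[OF assms(6) R])
      case 1
      then have "valid (False, F @ rev A @ B)" using 3 vF vR ne hl assms(8,9) by (auto simp: valid_simps)
      then show ?thesis
        using no_merge2[of "(False, ?R)" "(False, F)" "(False, F @ rev A @ B)"] R 3 pathin_inQ ne by auto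
    next
      case 2
      then have g: "g = last B" using hl by simp
      have cB: "valid (True, B)" using assms(9,11) g vR ne by (auto simp: valid_simps)
      have "valid (False, F @ rev A)" using 3 vF vR ne assms(8) by (auto simp: valid_simps)
      then show ?thesis
        using no_close2[of ?R F B "F @ rev A"] R 3 cB pathin_inQ ne by auto
    next
      case (3 G)
      note F3 = \<open>pathin F\<close> \<open>last F = f\<close> \<open>set F \<inter> set ?R = {}\<close>
      note vG = pathin_valid[OF 3(1)]
      show ?thesis
      proof (cases "set F \<inter> set G = {}")
        case True
        have "valid (False, A @ rev F)" "valid (False, G @ B)"
          using 3 F3 vF vG vR ne assms(8,9) by (auto simp: valid_simps)
        then show ?thesis
          using no_merge3[of "(False, ?R)" "(False, F)" "(False, G)" "(False, A @ rev F)" "(False, G @ B)"]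
            R 3 F3 True pathin_inQ ne vF by auto
      next
        case False
        \<comment> \<open>Here \<open>f\<close> and \<open>g\<close> are the two ends of one path,
          which fits between \<open>A\<close> and \<open>B\<close> as a whole.\<close>
        then have "G = rev F" using path_path[OF F3(1) 3(1)] assms(7) F3 3 by auto
        then have "valid (False, A @ rev F @ B)"
          using 3 F3 vF vG vR ne assms(8,9) by (auto simp: valid_simps)
        then show ?thesis
          using no_merge2[of "(False, ?R)" "(False, F)" "(False, A @ rev F @ B)"] R F3 pathin_inQ ne by auto
      qed
    qed
  qed
qed

text \<open>As in \<open>two_ends\<close>, with \<open>Z\<close> opened and attached to
  \<open>A\<close>, while \<open>B\<close> goes to \<open>f\<close>. If \<open>f\<close> is the far
  end of \<open>B\<close>, then \<open>B\<close> merely becomes a loop and the numbers of pieces and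
  of closed pieces stay the same, so this case survives.\<close>

lemma closed_end:
  assumes "pathin (A @ B)" "A \<noteq> []" "B \<noteq> []" "cycin Z"
    and "is_end f" "adj (last A) (hd Z)" "adj (hd B) f"
  shows "f = last B"
proof -
  let ?R = "A @ B"
  note R = assms(1) and ne = assms(2,3)
  note vR = pathin_valid[OF R] and vZ = cycin_valid[OF assms(4)]
  have hl: "hd ?R = hd A" "last ?R = last B" using ne by auto
  have Zd: "set ?R \<inter> set Z = {}" using path_cyc[OF R assms(4)] .
  show ?thesis
  proof (cases rule: end_cases[OF assms(5) R])
    case 1
    then have "valid (False, rev Z @ rev A @ B)" using vR vZ ne hl assms(6,7) by (auto simp: valid_simps)
    then show ?thesis
      using no_merge2[of "(False, ?R)" "(True, Z)" "(False, rev Z @ rev A @ B)"] R Zd pathin_inQ cycin_inQ assms(4) ne by auto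
  next
    case 2
    then show ?thesis using hl by simp
  next
    case (3 F)
    note vF = pathin_valid[OF 3(1)]
    have "valid (False, A @ Z)" "valid (False, F @ B)"
      using 3 vF vR vZ ne assms(6,7) by (auto simp: valid_simps)
    then show ?thesis
      using no_merge3[of "(False, ?R)" "(True, Z)" "(False, F)" "(False, A @ Z)" "(False, F @ B)"]
        R 3 Zd path_cyc[OF 3(1) assms(4)] pathin_inQ cycin_inQ assms(4) ne vZ by (auto simp: valid_def)
  qed
qed

lemma closed_closed:
  assumes "pathin (A @ B)" "A \<noteq> []" "B \<noteq> []" "cycin Z" "cycin Y"
    and "adj (last A) (hd Z)" "adj (hd B) (hd Y)"
  shows "set Z = set Y"
proof (rule ccontr)
  let ?R = "A @ B"
  note R = assms(1) and ne = assms(2,3)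
  note vR = pathin_valid[OF R] and vZ = cycin_valid[OF assms(4)] and vY = cycin_valid[OF assms(5)]
  assume "set Z \<noteq> set Y"
  then have d: "set Z \<inter> set Y = {}" using cyc_cyc assms by blast
  have "valid (False, A @ Z)" "valid (False, rev Y @ B)"
    using vR vZ vY ne assms(6,7) by (auto simp: valid_simps)
  then show False
    using no_merge3[of "(False, ?R)" "(True, Z)" "(True, Y)" "(False, A @ Z)" "(False, rev Y @ B)"]
      R d path_cyc[OF R assms(4)] path_cyc[OF R assms(5)] pathin_inQ cycin_inQ assms(4,5) ne vZ
    by (auto simp: valid_def)
qed

text \<open>Otherwise all of \<open>Z\<close> could be inserted between \<open>A\<close> and
  \<open>B\<close>. Hence consecutive claims come from non-neighbours on a closed piece, as recorded
  in \<open>gaps\<close>.\<close>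

lemma closed_closed_gap:
  assumes "pathin (A @ B)" "A \<noteq> []" "B \<noteq> []" "cycin Z" "adj (last A) (hd Z)"
  shows "\<not> adj (hd B) (last Z)"
proof
  let ?R = "A @ B"
  note R = assms(1) and ne = assms(2,3)
  note vR = pathin_valid[OF R] and vZ = cycin_valid[OF assms(4)]
  assume "adj (hd B) (last Z)"
  then have "valid (False, A @ Z @ B)" using vR vZ ne assms(5) by (auto simp: valid_simps)
  then show False
    using no_merge2[of "(False, ?R)" "(True, Z)" "(False, A @ Z @ B)"]
      R path_cyc[OF R assms(4)] pathin_inQ cycin_inQ assms(4) ne by auto
qed

section \<open>Loops at one or both ends of a path\<close>

context
  fixes A B Z
  assumes R: "pathin (A @ B)" and A: "A \<noteq> []" and Z: "cycin Z" "adj (last A) (hd Z)"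
    and B: "adj (hd B) (last B)" "length B \<ge> 3"
begin

lemma loop_closed: "valid (True, B)"
  using pathin_valid[OF R] B by (auto simp: valid_simps)

text \<open>Trading \<open>A @ B\<close> and \<open>Z\<close> for \<open>A @ Z\<close> and the
  closed piece \<open>B\<close> preserves the numbers of pieces and of closed pieces. After the
  trade \<open>B\<close> can be opened at any node, so it is as isolated from ends as any closed
  piece.\<close>

lemma loop_no_end:
  assumes "is_end f" "f \<noteq> last B" "g \<in> set B"
  shows "\<not> adj f g"
proof
  assume fg: "adj f g"
  note vR = pathin_valid[OF R] and vZ = cycin_valid[OF Z(1)]
  have Bne: "B \<noteq> []" using B by auto
  obtain B' where B': "valid (True, B')" "hd B' = g" "mset B' = mset B"
    using valid_hd[OF loop_closed assms(3)] by metis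
  have Zd: "set (A @ B) \<inter> set Z = {}" using path_cyc[OF R Z(1)] .
  have AZ: "valid (False, A @ Z)" using vR vZ A Z(2) by (auto simp: valid_simps)
  show False
  proof (cases rule: end_cases[OF assms(1) R])
    case 1
    then have "valid (False, rev B' @ A @ Z)" using AZ B' fg A by (auto simp: valid_simps)
    then show False
      using no_merge2[of "(False, A @ B)" "(True, Z)" "(False, rev B' @ A @ Z)"]
        R Zd pathin_inQ cycin_inQ Z(1) A B'(3) by auto
  next
    case 2 then show False using assms(2) Bne by simp
  next
    case (3 F)
    have "valid (False, F @ B')" using B' 3 fg pathin_valid[OF 3(1)] by (auto simp: valid_simps)
    then show False
      using no_merge3[of "(False, A @ B)" "(True, Z)" "(False, F)" "(False, A @ Z)" "(False, F @ B')"]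
        R 3 Zd AZ path_cyc[OF 3(1) Z(1)] pathin_inQ cycin_inQ Z(1) A vZ B'(3) by (auto simp: valid_def)
  qed
qed

lemma loop_no_closed:
  assumes "cycin Y" "set Y \<noteq> set Z" "a \<in> set Y" "g \<in> set B"
  shows "\<not> adj a g"
proof
  assume ag: "adj a g"
  obtain Y' where Y': "cycin Y'" "last Y' = a" "set Y' = set Y" using cycin_last assms by meson
  note vR = pathin_valid[OF R] and vZ = cycin_valid[OF Z(1)] and vY = cycin_valid[OF Y'(1)]
  obtain B' where B': "valid (True, B')" "hd B' = g" "mset B' = mset B"
    using valid_hd[OF loop_closed assms(4)] by metis
  have AZ: "valid (False, A @ Z)" "valid (False, Y' @ B')"
    using vR vZ vY A Z(2) B' Y' ag by (auto simp: valid_simps)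
  have "set Z \<inter> set Y' = {}" using cyc_cyc[OF Z(1) Y'(1)] assms Y' by auto
  then show False
    using no_merge3[of "(False, A @ B)" "(True, Z)" "(True, Y')" "(False, A @ Z)" "(False, Y' @ B')"]
      R AZ path_cyc[OF R Z(1)] path_cyc[OF R Y'(1)] Y' pathin_inQ cycin_inQ Z(1) A vZ B'(3)
    by (auto simp: valid_def)
qed

text \<open>After \<open>Z\<close> is attached to \<open>A\<close> by \<open>hd Z\<close>, its other
  extremity is \<open>last Z\<close>, and the opened loop could follow there.\<close>

lemma loop_no_neighbour:
  assumes "g \<in> set B"
  shows "\<not> adj (last Z) g"
proof
  assume ag: "adj (last Z) g"
  note vR = pathin_valid[OF R] and vZ = cycin_valid[OF Z(1)]
  obtain B' where B': "valid (True, B')" "hd B' = g" "mset B' = mset B"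
    using valid_hd[OF loop_closed assms] by metis
  have "valid (False, A @ Z @ B')" using vR vZ A Z(2) B' ag by (auto simp: valid_simps)
  then show False
    using no_merge2[of "(False, A @ B)" "(True, Z)" "(False, A @ Z @ B')"]
      R path_cyc[OF R Z(1)] pathin_inQ cycin_inQ Z(1) A B'(3) by auto
qed

end

context
  fixes A B
  assumes R: "pathin (A @ B)"
    and A: "adj (last A) (hd A)" "length A \<ge> 3"
    and B: "adj (hd B) (last B)" "length B \<ge> 3"
begin

lemma loops_closed: "valid (True, A)" "valid (True, B)"
  using pathin_valid[OF R] A B by (auto simp: valid_simps)

text \<open>Splitting the path into its two loops costs one piece and gains two closed ones.
  Attaching one loop to \<open>F\<close> repays the piece and still leaves one more closed
  piece.\<close>

lemma two_loops_no_foreign: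
  assumes F: "pathin F" "set F \<inter> set (A @ B) = {}" and g: "g \<in> set (A @ B)"
  shows "\<not> adj (last F) g"
proof
  assume fg: "adj (last F) g"
  note vF = pathin_valid[OF F(1)]
  have ne: "A \<noteq> []" "B \<noteq> []" using A B by auto
  consider "g \<in> set A" | "g \<in> set B" using g by auto
  then show False
  proof cases
    case 1
    then obtain A' where A': "valid (True, A')" "hd A' = g" "mset A' = mset A"
      using valid_hd[OF loops_closed(1)] by metis
    have "valid (False, F @ A')" using vF A' fg by (auto simp: valid_simps)
    then show False using no_close2[of "A @ B" F B "F @ A'"] R F A' loops_closed pathin_inQ ne by auto
  next
    case 2
    then obtain B' where B': "valid (True, B')" "hd B' = g" "mset B' = mset B"
      using valid_hd[OF loops_closed(2)] by metis
    have "valid (False, F @ B')" using vF B' fg by (auto simp: valid_simps)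
    then show False using no_close2[of "A @ B" F A "F @ B'"] R F B' loops_closed pathin_inQ ne by auto
  qed
qed

lemma two_loops_closed:
  assumes Z: "cycin Z" "cycin Y" "set Z \<noteq> set Y" and g: "g \<in> set A" "h \<in> set B"
    and ah: "a \<in> set Z" "b \<in> set Y" "adj a g"
  shows "\<not> adj b h"
proof
  assume bh: "adj b h"
  have ne: "A \<noteq> []" "B \<noteq> []" using A B by auto
  obtain Z' where Z': "cycin Z'" "last Z' = a" "set Z' = set Z" using cycin_last Z ah by meson
  obtain Y' where Y': "cycin Y'" "last Y' = b" "set Y' = set Y" using cycin_last Z ah by meson
  obtain A' where A': "valid (True, A')" "hd A' = g" "mset A' = mset A"
    using valid_hd[OF loops_closed(1) g(1)] by metis
  obtain B' where B': "valid (True, B')" "hd B' = h" "mset B' = mset B"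
    using valid_hd[OF loops_closed(2) g(2)] by metis
  note vZ = cycin_valid[OF Z'(1)] and vY = cycin_valid[OF Y'(1)]
  have "valid (False, Z' @ A')" "valid (False, Y' @ B')"
    using vZ vY A' B' Z' Y' ah bh by (auto simp: valid_simps)
  moreover have "set Z' \<inter> set Y' = {}" using cyc_cyc[OF Z'(1) Y'(1)] Z Z' Y' by auto
  ultimately show False
    using no_merge3[of "(False, A @ B)" "(True, Z')" "(True, Y')" "(False, Z' @ A')" "(False, Y' @ B')"]
      R path_cyc[OF R Z'(1)] path_cyc[OF R Y'(1)] Y' Z' pathin_inQ cycin_inQ ne vZ A' B'
    by (auto simp: valid_def)
qed

lemma two_loops_gap:
  assumes Z: "cycin Z" and g: "g \<in> set A" "h \<in> set B" and "adj (hd Z) g"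
  shows "\<not> adj (last Z) h"
proof
  assume bh: "adj (last Z) h"
  have ne: "A \<noteq> []" "B \<noteq> []" using A B by auto
  obtain A' where A': "valid (True, A')" "hd A' = g" "mset A' = mset A"
    using valid_hd[OF loops_closed(1) g(1)] by metis
  obtain B' where B': "valid (True, B')" "hd B' = h" "mset B' = mset B"
    using valid_hd[OF loops_closed(2) g(2)] by metis
  note vZ = cycin_valid[OF Z]
  have "valid (False, rev A' @ Z @ B')" using vZ A' B' bh assms(4) by (auto simp: valid_simps)
  then show False
    using no_merge2[of "(False, A @ B)" "(True, Z)" "(False, rev A' @ Z @ B')"]
      R path_cyc[OF R Z] pathin_inQ cycin_inQ ne Z A' B' by (auto simp: valid_def)
qed

text \<open>The chord from \<open>f\<close> to \<open>hd B\<close> lets one run through the loop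
  \<open>B\<close> from the mate of \<open>f\<close> to \<open>f\<close>. So \<open>Z\<close> can be
  attached at the mate and the opened loop \<open>A\<close> at \<open>f\<close>.\<close>

lemma two_loops_mate_closed:
  assumes B': "B = B' @ [f]" and Z: "cycin Z" "adj (last Z) (last B')" and g: "g \<in> set A"
  shows "\<not> adj f g"
proof
  assume fg: "adj f g"
  have ne: "A \<noteq> []" "B \<noteq> []" "B' \<noteq> []" using A B B' by auto
  obtain A' where A': "valid (True, A')" "hd A' = g" "mset A' = mset A"
    using valid_hd[OF loops_closed(1) g(1)] by metis
  note vZ = cycin_valid[OF Z(1)]
  have "valid (False, Z @ rev B' @ [f] @ A')"
    using vZ A' B B' ne Z fg pathin_valid[OF R] by (auto simp: valid_simps)
  then show False
    using no_merge2[of "(False, A @ B)" "(True, Z)" "(False, Z @ rev B' @ [f] @ A')"]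
      R path_cyc[OF R Z(1)] pathin_inQ cycin_inQ ne Z A' B' by (auto simp: valid_def)
qed

text \<open>The two chords closing the loops and the two edges from ends to mates would combine with
  the rest of the path into one cycle through all its nodes.\<close>

lemma two_loops_mates:
  assumes B': "B = B' @ [f]" and A': "A = e # A'" and "adj e (last B')"
  shows "\<not> adj f (hd A')"
proof
  assume f: "adj f (hd A')"
  have ne: "B' \<noteq> []" "A' \<noteq> []" using A B B' A' by auto
  have "valid (True, [f] @ B' @ [e] @ rev A')"
    using A' B A B' ne f assms(3) pathin_valid[OF R] by (cases B') (auto simp: valid_simps Suc_le_eq)
  then show False
    using no_close1[of "A @ B" "[f] @ B' @ [e] @ rev A'"] R pathin_inQ A' B' by auto
qed

end

section \<open>Claimed nodes\<close>

text \<open>Moving \<open>f\<close> between \<open>A\<close> and \<open>B\<close> turns its former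
  neighbour into an end of the rest of \<open>F\<close>, which must then obey the restrictions on
  ends. If nothing is left of \<open>F\<close>, a piece is saved.\<close>

lemma triangle_foreign:
  assumes S: "pathin (A @ B)" "A \<noteq> []" "B \<noteq> []" and f: "adj f (last A)" "adj f (hd B)"
    and F: "pathin F" "last F = f" "set F \<inter> set (A @ B) = {}"
  shows "length F \<ge> 2"
    and "F = G @ [f] \<Longrightarrow> is_end e \<Longrightarrow> adj (last G) e \<Longrightarrow> e \<noteq> f \<Longrightarrow> (e = hd G \<Longrightarrow> length G \<ge> 3) \<Longrightarrow> False"
    and "F = G @ [f] \<Longrightarrow> is_closed a \<Longrightarrow> \<not> adj (last G) a"
proof -
  note vS = pathin_valid[OF S(1)] and vF = pathin_valid[OF F(1)]
  have new: "valid (False, A @ [f] @ B)" using vS S f by (auto simp: valid_simps)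
  show len: "length F \<ge> 2"
  proof (rule ccontr)
    assume "\<not> length F \<ge> 2"
    then have "F = [f]" using vF F(2) by (cases F; cases "tl F") auto
    then show False
      using no_merge2[of "(False, A @ B)" "(False, F)" "(False, A @ [f] @ B)"] S F new pathin_inQ by auto
  qed
  {
    assume G: "F = G @ [f]" and e: "is_end e" "adj (last G) e" "e \<noteq> f" "e = hd G \<Longrightarrow> length G \<ge> 3"
    have Gne: "G \<noteq> []" using len G by auto
    show False
    proof (cases rule: end_cases[OF e(1) F(1)])
      case 1
      then have "valid (True, G)" using Gne G e vF by (auto simp: valid_simps)
      then show False using no_close2[of "A @ B" F G "A @ [f] @ B"] S F new pathin_inQ G by auto
    next
      case 2
      then show ?thesis using e(3) F(2) by simp
    next
      case (3 E)
      note vE = pathin_valid[OF 3(1)]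
      show False
      proof (cases "set (A @ B) \<inter> set E = {}")
        case True
        have "valid (False, E @ rev G)" using vE vF G Gne e 3 by (auto simp: valid_simps)
        then show False
          using no_merge3[of "(False, A @ B)" "(False, F)" "(False, E)" "(False, A @ [f] @ B)" "(False, E @ rev G)"]
            S F 3 True new pathin_inQ G vF by auto
      next
        case False
        \<comment> \<open>Here \<open>e\<close> is an end of the path that receives
          \<open>f\<close>, and it remains one after the insertion.\<close>
        then consider "E = A @ B" | "E = rev (A @ B)" using path_path[OF S(1) 3(1)] by auto
        then show False
        proof cases
          case 1
          then have "valid (False, A @ [f] @ B @ rev G)" using new vF G Gne e 3 S by (auto simp: valid_simps)
          then show False
            using no_merge2[of "(False, A @ B)" "(False, F)" "(False, A @ [f] @ B @ rev G)"] S F pathin_inQ G by auto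
        next
          case 2
          then have "e = hd A" using 3 S by (auto simp: last_rev)
          then have "valid (False, G @ A @ [f] @ B)" using new vF G Gne e S by (auto simp: valid_simps)
          then show False
            using no_merge2[of "(False, A @ B)" "(False, F)" "(False, G @ A @ [f] @ B)"] S F pathin_inQ G by auto
        qed
      qed
    qed
  }
  {
    assume G: "F = G @ [f]" and a: "is_closed a"
    have Gne: "G \<noteq> []" using len G by auto
    obtain Z where Z: "cycin Z" "last Z = a" using a cycin_last by (meson is_closed_def)
    note vZ = cycin_valid[OF Z(1)]
    show "\<not> adj (last G) a"
    proof
      assume "adj (last G) a"
      then have "valid (False, Z @ rev G)" using vZ vF G Gne Z by (auto simp: valid_simps)
      then show False
        using no_merge3[of "(False, A @ B)" "(False, F)" "(True, Z)" "(False, A @ [f] @ B)" "(False, Z @ rev G)"]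
          S F new pathin_inQ cycin_inQ vF path_cyc[OF S(1) Z(1)] path_cyc[OF F(1) Z(1)] Z G
        by (auto simp: Int_commute)
    qed
  }
qed

text \<open>The same move within one path: \<open>f\<close> gives up the last position, and
  \<open>last B\<close> becomes the end.\<close>

lemma triangle_own:
  assumes S: "pathin (A @ B @ [f])" "A \<noteq> []" and f: "adj f (last A)" "adj f (hd B)" and B: "B \<noteq> []"
  shows "is_end e \<Longrightarrow> adj (last B) e \<Longrightarrow> e \<noteq> f \<Longrightarrow> length (A @ B) \<ge> 3 \<Longrightarrow> False"
    and "is_closed a \<Longrightarrow> \<not> adj (last B) a"
proof -
  let ?R = "A @ B @ [f]"
  note vS = pathin_valid[OF S(1)]
  have new: "valid (False, A @ [f] @ B)" using vS S f B by (auto simp: valid_simps)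
  {
    assume e: "is_end e" "adj (last B) e" "e \<noteq> f" "length (A @ B) \<ge> 3"
    show False
    proof (cases rule: end_cases[OF e(1) S(1)])
      case 1
      then have "valid (True, A @ [f] @ B)" using new e B S by (auto simp: valid_simps)
      then show False using no_close1[of ?R "A @ [f] @ B"] S pathin_inQ by auto
    next
      case 2
      then show ?thesis using e(3) by simp
    next
      case (3 E)
      note vE = pathin_valid[OF 3(1)]
      have "valid (False, E @ rev B @ [f] @ rev A)" using vE vS B S f e 3 by (auto simp: valid_simps)
      then show False
        using no_merge2[of "(False, ?R)" "(False, E)" "(False, E @ rev B @ [f] @ rev A)"] S 3 pathin_inQ by auto
    qed
  }
  {
    assume a: "is_closed a"
    obtain Z where Z: "cycin Z" "last Z = a" using a cycin_last by (meson is_closed_def)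
    note vZ = cycin_valid[OF Z(1)]
    show "\<not> adj (last B) a"
    proof
      assume "adj (last B) a"
      then have "valid (False, Z @ rev B @ [f] @ rev A)" using vZ vS B Z f S by (auto simp: valid_simps)
      then show False
        using no_merge2[of "(False, ?R)" "(True, Z)" "(False, Z @ rev B @ [f] @ rev A)"]
          S pathin_inQ cycin_inQ path_cyc[OF S(1) Z(1)] Z by auto
    qed
  }
qed

section \<open>Claims and their positions on a path\<close>

text \<open>The inequalities exclude the two edges of the piece at \<open>v\<close>. The choice of
  direction in the witness is immaterial by \<open>claims_at\<close>.\<close>

definition claims :: "'a \<Rightarrow> 'a \<Rightarrow> bool" where
  "claims f v \<longleftrightarrow> adj f v \<and> (is_end f \<or> is_closed f) \<and>
     (\<exists>A B. pathin (A @ v # B) \<and> A \<noteq> [] \<and> B \<noteq> [] \<and> f \<noteq> last A \<and> f \<noteq> hd B)"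

lemma claims_at:
  assumes "pathin (A @ v # B)"
  shows "claims f v \<longleftrightarrow> adj f v \<and> (is_end f \<or> is_closed f) \<and> A \<noteq> [] \<and> B \<noteq> [] \<and> f \<noteq> last A \<and> f \<noteq> hd B"
proof
  assume c: "claims f v"
  then obtain C D where CD: "pathin (C @ v # D)" "C \<noteq> []" "D \<noteq> []" "f \<noteq> last C" "f \<noteq> hd D"
    by (auto simp: claims_def)
  have "set (A @ v # B) \<inter> set (C @ v # D) \<noteq> {}" by auto
  then consider "C @ v # D = A @ v # B" | "C @ v # D = rev (A @ v # B)"
    using path_path[OF assms CD(1)] by blast
  moreover have d: "distinct (C @ v # D)" "distinct (A @ v # B)" using pathin_distinct[OF CD(1)] pathin_distinct[OF assms] .
  ultimately have "(C = A \<and> D = B) \<or> (C = rev B \<and> D = rev A)"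
  proof cases
    case 1
    then show ?thesis using d by (subst (asm) append_Cons_eq_iff) auto
  next
    case 2
    then have "C @ v # D = rev B @ v # rev A" by simp
    then show ?thesis using d by (subst (asm) append_Cons_eq_iff) auto
  qed
  then show "adj f v \<and> (is_end f \<or> is_closed f) \<and> A \<noteq> [] \<and> B \<noteq> [] \<and> f \<noteq> last A \<and> f \<noteq> hd B"
    using c CD by (auto simp: claims_def hd_rev last_rev)
next
  assume "adj f v \<and> (is_end f \<or> is_closed f) \<and> A \<noteq> [] \<and> B \<noteq> [] \<and> f \<noteq> last A \<and> f \<noteq> hd B"
  then show "claims f v" unfolding claims_def using assms by blast
qed

definition claimed :: "'a \<Rightarrow> bool" where
  "claimed v \<longleftrightarrow> (\<exists>f. claims f v)"

lemma claims_nth: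
  assumes "pathin R" "i < length R"
  shows "claims f (R ! i) \<longleftrightarrow> adj f (R ! i) \<and> (is_end f \<or> is_closed f) \<and> 0 < i \<and> Suc i < length R \<and>
     f \<noteq> R ! (i - 1) \<and> f \<noteq> R ! Suc i"
proof -
  have R: "R = take i R @ R ! i # drop (Suc i) R" using assms(2) by (simp add: id_take_nth_drop)
  have "claims f (R ! i) \<longleftrightarrow> adj f (R ! i) \<and> (is_end f \<or> is_closed f) \<and> take i R \<noteq> [] \<and>
      drop (Suc i) R \<noteq> [] \<and> f \<noteq> last (take i R) \<and> f \<noteq> hd (drop (Suc i) R)"
    using claims_at[of "take i R" "R ! i" "drop (Suc i) R" f] assms R by simp
  moreover have "take i R \<noteq> [] \<longleftrightarrow> 0 < i" using assms by auto
  moreover have "drop (Suc i) R \<noteq> [] \<longleftrightarrow> Suc i < length R" by auto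
  moreover have "last (take i R) = R ! (i - 1)" if "0 < i" 
  proof -
    have "take i R \<noteq> []" using that assms by auto
    then show ?thesis using that assms by (simp add: last_conv_nth)
  qed
  moreover have "hd (drop (Suc i) R) = R ! Suc i" if "Suc i < length R" using that by (simp add: hd_drop_conv_nth)
  ultimately show ?thesis by auto
qed

lemma path_adj: "pathin R \<Longrightarrow> Suc i < length R \<Longrightarrow> adj (R ! i) (R ! Suc i)"
  using pathin_valid successively_conv_nth by blast

text \<open>Two of the at most three neighbours of \<open>v\<close> are its neighbours on the
  path.\<close>

lemma claims_unique:
  assumes "claims f v" "claims g v"
  shows "f = g"
proof -
  obtain A B where AB: "pathin (A @ v # B)" "A \<noteq> []" "B \<noteq> []" "f \<noteq> last A" "f \<noteq> hd B" "adj f v"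
    using assms by (auto simp: claims_def)
  have g: "g \<noteq> last A" "g \<noteq> hd B" "adj g v" using assms(2) claims_at[OF AB(1)] by auto
  have "last A \<in> set A" "hd B \<in> set B" using AB by auto
  then have "last A \<noteq> hd B" using pathin_distinct[OF AB(1)] by auto
  moreover have "adj (last A) v" "adj v (hd B)"
    using pathin_valid[OF AB(1)] AB by (auto simp: valid_simps)
  ultimately show "f = g"
    using nbs_third[of "last A" v "hd B" f g] AB g adj_nbs adj_sym by metis
qed

lemma claimed_not_end: "claimed v \<Longrightarrow> \<not> is_end v"
proof
  assume "claimed v" "is_end v"
  then obtain A B where AB: "pathin (A @ v # B)" "A \<noteq> []" "B \<noteq> []" by (auto simp: claimed_def claims_def)
  note d = pathin_distinct[OF AB(1)]
  show False
  proof (cases rule: end_cases[OF \<open>is_end v\<close> AB(1)])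
    case 1 then show False using d AB hd_in_set[of A] by auto
  next
    case 2 then show False using d AB last_in_set[of B] by auto
  next
    case (3 F) then show False using pathin_valid[OF 3(1)] last_in_set[of F] by auto
  qed
qed

lemma claimed_not_closed: "claimed v \<Longrightarrow> \<not> is_closed v"
  unfolding claimed_def claims_def is_closed_def using path_cyc by (metis disjoint_iff in_set_conv_decomp)

lemma end_claims_nbs:
  assumes F: "pathin F" "last F = f" "length F \<ge> 2" and "claims f v"
  shows "v \<in> nbs f - {last (butlast F)}"
proof -
  obtain G m where G: "F = G @ [m, f]"
    using F(2,3) by (cases F rule: rev_cases; cases "butlast F" rule: rev_cases) auto
  have "v \<noteq> m"
  proof
    assume "v = m"
    then have "f \<noteq> hd [f]" using assms(4) claims_at[of G m "[f]" f] F(1) G by simp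
    then show False by simp
  qed
  then show ?thesis using assms(4) G adj_nbs by (auto simp: claims_def butlast_append)
qed

definition same_closed :: "'a \<Rightarrow> 'a \<Rightarrow> bool" where
  "same_closed a b \<longleftrightarrow> (\<exists>Z. cycin Z \<and> a \<in> set Z \<and> b \<in> set Z)"

text \<open>As \<open>cycin\<close> allows rotation and reversal, \<open>hd\<close> and
  \<open>last\<close> can be any two consecutive nodes of the closed piece.\<close>

definition cyc_nb :: "'a \<Rightarrow> 'a \<Rightarrow> bool" where
  "cyc_nb a b \<longleftrightarrow> (\<exists>Z. cycin Z \<and> hd Z = a \<and> last Z = b)"

text \<open>The end and the two nodes are pairwise adjacent, whence the name. The path
  \<open>S\<close> may be the path of \<open>f\<close> or another one.\<close>

definition triangle :: "'a \<Rightarrow> bool" where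
  "triangle f \<longleftrightarrow> is_end f \<and> (\<exists>S i. pathin S \<and> Suc i < length S \<and> claims f (S ! i) \<and> claims f (S ! Suc i))"

lemma same_closed_sym: "same_closed a b \<Longrightarrow> same_closed b a"
  by (auto simp: same_closed_def)

lemma same_closed_trans: "same_closed a b \<Longrightarrow> same_closed b c \<Longrightarrow> same_closed a c"
  unfolding same_closed_def using cyc_cyc by (metis disjoint_iff)

lemma cyc_nb_sym: "cyc_nb a b \<Longrightarrow> cyc_nb b a"
  unfolding cyc_nb_def using cycin_rev cycin_valid by (metis hd_rev last_rev)

lemma is_closed_hd: "is_closed a \<Longrightarrow> \<exists>Z. cycin Z \<and> hd Z = a \<and> a \<in> set Z"
  unfolding is_closed_def using cycin_hd by metis

lemma edge_split:
  assumes "pathin R" "Suc i < length R"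
  obtains A B where "R = A @ B" "A \<noteq> []" "B \<noteq> []" "last A = R ! i" "hd B = R ! Suc i" "hd A = hd R"
    "last B = last R" "length A = Suc i" "length B = length R - Suc i"
    "\<And>j. j \<le> i \<Longrightarrow> R ! j \<in> set A" "\<And>j. i < j \<Longrightarrow> j < length R \<Longrightarrow> R ! j \<in> set B"
proof (rule that[of "take (Suc i) R" "drop (Suc i) R"])
  show ne: "take (Suc i) R \<noteq> []" "drop (Suc i) R \<noteq> []" using assms by auto
  show "last (take (Suc i) R) = R ! i" using assms ne by (simp add: last_conv_nth)
  show "hd (drop (Suc i) R) = R ! Suc i" using assms by (simp add: hd_drop_conv_nth)
  show "R ! j \<in> set (take (Suc i) R)" if "j \<le> i" for j
    using that assms by (metis Suc_le_eq in_set_conv_nth length_take le_imp_less_Suc min.absorb2 nth_take less_imp_le_nat)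
  show "R ! j \<in> set (drop (Suc i) R)" if "i < j" "j < length R" for j
    using that assms unfolding in_set_conv_nth
    by (intro exI[of _ "j - Suc i"]) auto
qed (use assms in \<open>auto simp: hd_conv_nth\<close>)

lemma last_nth: "pathin R \<Longrightarrow> last R = R ! (length R - 1)" "pathin R \<Longrightarrow> hd R = R ! 0"
  using pathin_valid by (auto simp: last_conv_nth hd_conv_nth)

text \<open>The node before the end is its path neighbour and cannot be claimed by it. So a loop
  closed by a claim has at least three nodes.\<close>

lemma claims_last_pos: "pathin R \<Longrightarrow> i < length R \<Longrightarrow> claims (last R) (R ! i) \<Longrightarrow> i + 3 \<le> length R"
proof -
  assume a: "pathin R" "i < length R" "claims (last R) (R ! i)"
  then have "0 < i \<and> Suc i < length R \<and> last R \<noteq> R ! Suc i" using claims_nth[of R i "last R"] by blast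
  moreover have "length R \<noteq> Suc (Suc i)"
  proof
    assume "length R = Suc (Suc i)"
    then show False using calculation last_nth(1)[OF a(1)] by simp
  qed
  ultimately show ?thesis by linarith
qed

lemma claims_hd_pos: "pathin R \<Longrightarrow> i < length R \<Longrightarrow> claims (hd R) (R ! i) \<Longrightarrow> 2 \<le> i"
  using claims_nth[of R i "hd R"] last_nth(2)[of R] by (cases "i = 1") auto

lemma claims_adj: "claims f v \<Longrightarrow> adj f v"
  by (simp add: claims_def)

lemma claims_kind: "claims f v \<Longrightarrow> is_end f \<or> is_closed f"
  by (auto simp: claims_def)

lemma claims_pos: "pathin R \<Longrightarrow> i < length R \<Longrightarrow> claims f (R ! i) \<Longrightarrow> 0 < i \<and> Suc i < length R"
  using claims_nth by blast

section \<open>Which claimers can occur at consecutive nodes\<close>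

lemma claim_ends:
  assumes R: "pathin R" "Suc i < length R" and c: "claims f (R ! i)" "claims g (R ! Suc i)"
    and e: "is_end f" "is_end g" "f \<noteq> g"
  shows "f = hd R \<and> g = last R"
proof -
  obtain A B where AB: "R = A @ B" "A \<noteq> []" "B \<noteq> []" "last A = R ! i" "hd B = R ! Suc i" "hd A = hd R"
    "last B = last R" "length A = Suc i" "length B = length R - Suc i"
    using edge_split[OF R] by metis
  have "0 < i" "Suc (Suc i) < length R"
    using claims_pos[OF R(1) _ c(1)] claims_pos[OF R(1) _ c(2)] R by auto
  have lA: "length A \<ge> 3" if "f = hd A"
    using claims_hd_pos[OF R(1), of i] c(1) R(2) AB(6,8) that by simp
  have lB: "length B \<ge> 3" if "g = last B"
    using claims_last_pos[OF R(1), of "Suc i"] c(2) R(2) AB(7,9) that by simp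
  have p: "pathin (A @ B)" using R AB(1) by simp
  have l: "length (A @ B) \<ge> 3" using \<open>Suc (Suc i) < length R\<close> AB(1) by simp
  have ad: "adj (last A) f" "adj (hd B) g" using claims_adj c AB(4,5) adj_sym by metis+
  have "f = hd A \<and> g = last B"
    using two_ends[OF p AB(2,3) l e ad lA lB] .
  then show ?thesis using AB(6,7) by simp
qed

lemma claim_closed_end:
  assumes R: "pathin R" "Suc i < length R" and c: "claims a (R ! i)" "claims f (R ! Suc i)"
    and e: "is_closed a" "is_end f"
  shows "f = last R"
proof -
  obtain A B where AB: "R = A @ B" "A \<noteq> []" "B \<noteq> []" "last A = R ! i" "hd B = R ! Suc i" "last B = last R"
    using edge_split[OF R] by metis
  obtain Z where Z: "cycin Z" "hd Z = a" using is_closed_hd e by blast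
  show ?thesis using closed_end[of A B Z f] AB R Z e c claims_adj adj_sym by metis
qed

lemma claim_closed_closed:
  assumes R: "pathin R" "Suc i < length R" and c: "claims a (R ! i)" "claims b (R ! Suc i)"
    and e: "is_closed a" "is_closed b"
  shows "same_closed a b \<and> \<not> cyc_nb a b"
proof -
  obtain A B where AB: "R = A @ B" "A \<noteq> []" "B \<noteq> []" "last A = R ! i" "hd B = R ! Suc i"
    using edge_split[OF R] by metis
  obtain Z where Z: "cycin Z" "hd Z = a" "a \<in> set Z" using is_closed_hd e by blast
  obtain Y where Y: "cycin Y" "hd Y = b" "b \<in> set Y" using is_closed_hd e by blast
  have "set Z = set Y" using closed_closed[of A B Z Y] AB R Z Y c claims_adj adj_sym by metis
  moreover have False if nb: "cyc_nb a b"
  proof -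
    obtain X where X: "cycin X" "hd X = a" "last X = b" using nb by (auto simp: cyc_nb_def)
    show False using closed_closed_gap[of A B X] AB R X c claims_adj adj_sym by metis
  qed
  ultimately show ?thesis using Z Y by (auto simp: same_closed_def)
qed

text \<open>The claim of \<open>last R\<close> closes the part from \<open>R ! Suc i\<close> on to a
  loop, while \<open>a\<close> lies on the closed piece attached to the rest.\<close>

lemma claim_loop:
  assumes R: "pathin R" "Suc i < length R" and c: "claims a (R ! i)" "claims (last R) (R ! Suc i)" "is_closed a"
    and j: "i < j" "j < length R"
  shows "is_end f \<Longrightarrow> f \<noteq> last R \<Longrightarrow> \<not> adj f (R ! j)"
    and "is_closed b \<Longrightarrow> adj b (R ! j) \<Longrightarrow> same_closed a b \<and> \<not> cyc_nb a b"
proof -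
  obtain A B where AB: "R = A @ B" "A \<noteq> []" "B \<noteq> []" "last A = R ! i" "hd B = R ! Suc i" "last B = last R"
    "length B = length R - Suc i" "R ! j \<in> set B"
    using edge_split[OF R] j by metis
  have l: "length B \<ge> 3" using claims_last_pos[OF R(1), of "Suc i"] c(2) R(2) AB(7) by simp
  obtain Z where Z: "cycin Z" "hd Z = a" "a \<in> set Z" using is_closed_hd c(3) by blast
  have ad: "adj (last A) (hd Z)" "adj (hd B) (last B)" using c claims_adj adj_sym AB(4,5,6) Z(2) by metis+
  have p: "pathin (A @ B)" using R AB(1) by simp
  show "\<not> adj f (R ! j)" if "is_end f" "f \<noteq> last R"
    using loop_no_end[OF p AB(2) Z(1) ad l that(1) _ AB(8)] that(2) AB(6) by simp
  show "same_closed a b \<and> \<not> cyc_nb a b" if ib: "is_closed b" and ab: "adj b (R ! j)"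
  proof -
    obtain Y where Y: "cycin Y" "b \<in> set Y" using ib by (auto simp: is_closed_def)
    have "set Y = set Z" using loop_no_closed[OF p AB(2) Z(1) ad l Y(1) _ Y(2) AB(8)] ab by blast
    moreover have False if nb: "cyc_nb a b"
    proof -
      obtain X where X: "cycin X" "hd X = a" "last X = b" using nb by (auto simp: cyc_nb_def)
      then show False using loop_no_neighbour[OF p AB(2) X(1) _ ad(2) l AB(8)] ad(1) Z(2) ab by simp
    qed
    ultimately show ?thesis using Z Y by (auto simp: same_closed_def)
  qed
qed

context
  fixes R i
  assumes R: "pathin R" "Suc i < length R" and c: "claims (hd R) (R ! i)" "claims (last R) (R ! Suc i)"
begin

lemma double_split:
  obtains A B where "R = A @ B" "pathin (A @ B)" "last A = R ! i" "hd B = R ! Suc i" "hd A = hd R" "last B = last R"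
    "length A \<ge> 3" "length B \<ge> 3" "adj (last A) (hd A)" "adj (hd B) (last B)"
    "length A = Suc i" "length B = length R - Suc i"
    "\<And>j. j \<le> i \<Longrightarrow> R ! j \<in> set A" "\<And>j. i < j \<Longrightarrow> j < length R \<Longrightarrow> R ! j \<in> set B"
proof -
  obtain A B where AB: "R = A @ B" "A \<noteq> []" "B \<noteq> []" "last A = R ! i" "hd B = R ! Suc i" "hd A = hd R"
    "last B = last R" "length A = Suc i" "length B = length R - Suc i"
    "\<And>j. j \<le> i \<Longrightarrow> R ! j \<in> set A" "\<And>j. i < j \<Longrightarrow> j < length R \<Longrightarrow> R ! j \<in> set B"
    using edge_split[OF R] by metis
  moreover have "length A \<ge> 3" using claims_hd_pos[OF R(1), of i] c(1) R(2) AB(8) by simp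
  moreover have "length B \<ge> 3" using claims_last_pos[OF R(1), of "Suc i"] c(2) R(2) AB(9) by simp
  moreover have "adj (last A) (hd A)" "adj (hd B) (last B)" using c claims_adj adj_sym AB(4-7) by metis+
  moreover have "pathin (A @ B)" using R AB(1) by simp
  ultimately show ?thesis using that by blast
qed

lemma double_no_foreign:
  assumes "is_end f" "f \<noteq> hd R" "f \<noteq> last R" "j < length R"
  shows "\<not> adj f (R ! j)"
proof -
  obtain A B where AB: "R = A @ B" "pathin (A @ B)" "length A \<ge> 3" "length B \<ge> 3" "adj (last A) (hd A)"
    "adj (hd B) (last B)" using double_split by metis
  show ?thesis
  proof (cases rule: end_cases[OF assms(1) R(1)])
    case (3 F)
    have "R ! j \<in> set (A @ B)" using assms(4) AB(1) nth_mem by metis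
    then show ?thesis using two_loops_no_foreign[OF AB(2,5,3,6,4) 3(1) _ , of "R ! j"] AB(1) 3 by auto
  qed (use assms in auto)
qed

lemma double_closed:
  assumes "j \<le> i" "i < l" "l < length R" "is_closed a" "is_closed b" "adj a (R ! j)" "adj b (R ! l)"
  shows "same_closed a b \<and> \<not> cyc_nb a b"
proof -
  obtain A B where AB: "R = A @ B" "pathin (A @ B)" "length A \<ge> 3" "length B \<ge> 3" "adj (last A) (hd A)"
    "adj (hd B) (last B)" "R ! j \<in> set A" "R ! l \<in> set B" using double_split assms(1-3) by metis
  obtain Z where Z: "cycin Z" "a \<in> set Z" using assms by (auto simp: is_closed_def)
  obtain Y where Y: "cycin Y" "b \<in> set Y" using assms by (auto simp: is_closed_def)
  have "set Z = set Y" using two_loops_closed[OF AB(2,5,3,6,4) Z(1) Y(1) _ AB(7,8) Z(2) Y(2)] assms by blast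
  moreover have False if nb: "cyc_nb a b"
  proof -
    obtain X where X: "cycin X" "hd X = a" "last X = b" using nb by (auto simp: cyc_nb_def)
    then show False using two_loops_gap[OF AB(2,5,3,6,4) X(1) AB(7,8)] assms by simp
  qed
  ultimately show ?thesis using Z Y by (auto simp: same_closed_def)
qed

lemma double_mate_closed:
  assumes "is_closed a" "adj a (R ! (length R - 2))" "j \<le> i"
  shows "\<not> adj (last R) (R ! j)"
proof -
  obtain A B where AB: "R = A @ B" "pathin (A @ B)" "length A \<ge> 3" "length B \<ge> 3" "adj (last A) (hd A)"
    "adj (hd B) (last B)" "R ! j \<in> set A" "last B = last R" using double_split assms(3) by metis
  obtain Z where Z: "cycin Z" "last Z = a" using assms cycin_last by (meson is_closed_def)
  have B: "B = butlast B @ [last R]" using AB(8,4) append_butlast_last_id[of B] by (cases B) auto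
  have "last (butlast B) = R ! (length R - 2)"
  proof -
    have ne: "butlast B \<noteq> []" using AB(4) by (cases B; cases "tl B") auto
    have "R = A @ butlast B @ [last R]" using AB(1) B by metis
    moreover have "(A @ butlast B @ [last R]) ! (length (A @ butlast B @ [last R]) - 2) = last (butlast B)"
      using ne by (cases "butlast B" rule: rev_cases) (auto simp: nth_append)
    ultimately show ?thesis by metis
  qed
  then show ?thesis using two_loops_mate_closed[OF AB(2,5,3,6,4) B Z(1) _ AB(7)] assms Z by auto
qed

lemma double_mates:
  "\<not> (adj (hd R) (R ! (length R - 2)) \<and> adj (last R) (R ! 1))"
proof -
  obtain A B where AB: "R = A @ B" "pathin (A @ B)" "length A \<ge> 3" "length B \<ge> 3" "adj (last A) (hd A)"
    "adj (hd B) (last B)" "last B = last R" "hd A = hd R" using double_split by metis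
  have B: "B = butlast B @ [last R]" using AB(7,4) append_butlast_last_id[of B] by (cases B) auto
  have A: "A = hd R # tl A" using AB(8,3) by (cases A) auto
  have ne: "butlast B \<noteq> []" using AB(4) by (cases B; cases "tl B") auto
  have "last (butlast B) = R ! (length R - 2)"
  proof -
    have "R = A @ butlast B @ [last R]" using AB(1) B by metis
    moreover have "(A @ butlast B @ [last R]) ! (length (A @ butlast B @ [last R]) - 2) = last (butlast B)"
      using ne by (cases "butlast B" rule: rev_cases) (auto simp: nth_append)
    ultimately show ?thesis by metis
  qed
  moreover have "hd (tl A) = R ! 1" using AB(1,3) by (cases A; cases "tl A") auto
  ultimately show ?thesis using two_loops_mates[OF AB(2,5,3,6,4) B A] by auto
qed

end

section \<open>Ends that claim two consecutive nodes\<close>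

text \<open>Since \<open>f\<close> can be moved between the two nodes that it claims, its mate would
  become an end, and a claim on the mate would be an edge forbidden for ends.\<close>

lemma triangle_mate:
  assumes f: "triangle f" and F: "pathin F" "last F = f"
  shows "length F \<ge> 2" and "length F \<ge> 3 \<Longrightarrow> \<not> claimed (F ! (length F - 2))"
proof -
  obtain S i where S: "pathin S" "Suc i < length S" and c: "claims f (S ! i)" "claims f (S ! Suc i)"
    and e: "is_end f" using f by (auto simp: triangle_def)
  obtain A B where AB: "S = A @ B" "A \<noteq> []" "B \<noteq> []" "last A = S ! i" "hd B = S ! Suc i"
    "length A = Suc i" "length B = length S - Suc i"
    using edge_split[OF S] by metis
  have lAB: "length A \<ge> 2" "length B \<ge> 2"
    using claims_pos[OF S(1) _ c(1)] claims_pos[OF S(1) _ c(2)] S AB(6,7) by auto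
  have a: "adj f (last A)" "adj f (hd B)" using c claims_adj AB by auto
  have F2: "length F \<ge> 2 \<and> (length F \<ge> 3 \<longrightarrow> \<not> claimed (F ! (length F - 2)))"
  proof (cases "set F \<inter> set S = {}")
    case True
    have d: "set F \<inter> set (A @ B) = {}" using True AB by simp
    note p = S(1)[unfolded AB(1)]
    have l: "length F \<ge> 2" using triangle_foreign(1)[OF p AB(2,3) a F d] .
    moreover have False if l3: "length F \<ge> 3" and cl: "claimed (F ! (length F - 2))"
    proof -
      obtain G where G: "F = G @ [f]" using F l by (cases F rule: rev_cases) auto
      have Gl: "G \<noteq> []" "F ! (length F - 2) = last G" using l3 G
        by (cases G rule: rev_cases; simp add: nth_append)+
      obtain g where g: "claims g (last G)" using cl Gl by (auto simp: claimed_def)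
      have gn: "g \<noteq> F ! (length F - 3)" "g \<noteq> f"
        using claims_nth[OF F(1), of "length F - 2" g] g Gl l3 G
        by (auto simp: nth_append eval_nat_numeral split: if_splits)
      show False
      proof (cases "is_end g")
        case True
        \<comment> \<open>If only two nodes were left, \<open>g\<close> would be the path neighbour
          of the claimed node.\<close>
        have "length G \<ge> 3" if "g = hd G"
        proof (rule ccontr)
          assume "\<not> length G \<ge> 3"
          then have "length G = 2" using l3 G by simp
          then show False using gn(1) that G by (cases G; cases "tl G") auto
        qed
        then show False
          using triangle_foreign(2)[OF p AB(2,3) a F d G True _ gn(2)] g claims_adj adj_sym by blast
      next
        case False
        then have "is_closed g" using claims_kind g by blast
        then show False using triangle_foreign(3)[OF p AB(2,3) a F d G] g claims_adj adj_sym by blast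
      qed
    qed
    ultimately show ?thesis by blast
  next
    case False
    \<comment> \<open>Orient both parts along \<open>F\<close>, so that \<open>f\<close> stands at
      the last position.\<close>
    define A' B' where "A' = (if F = S then A else rev B)" and "B' = (if F = S then B else rev A)"
    have FS: "F = A' @ B'" "A' \<noteq> []" "B' \<noteq> []" "adj f (last A')" "adj f (hd B')"
      using path_path[OF S(1) F(1)] False AB a by (auto simp: A'_def B'_def last_rev hd_rev Int_commute)
    obtain B2 where B2: "B' = B2 @ [f]" using F FS by (cases B' rule: rev_cases) auto
    have B2n: "B2 \<noteq> []" using FS(5) B2 by (cases B2) auto
    have l3: "length F \<ge> 3" using FS B2 B2n by (cases A'; cases B2) auto
    have p: "pathin (A' @ B2 @ [f])" using F FS B2 by simp
    have ad: "adj f (last A')" "adj f (hd B2)" using FS B2 B2n by auto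
    have lG: "F ! (length F - 2) = last B2" using FS B2 B2n
      by (cases B2 rule: rev_cases) (auto simp: nth_append)
    have False if cl: "claimed (F ! (length F - 2))"
    proof -
      obtain g where g: "claims g (last B2)" using cl lG by (auto simp: claimed_def)
      have gn: "g \<noteq> f" using claims_nth[OF F(1), of "length F - 2" g] g lG l3 FS B2
        by (auto simp: nth_append eval_nat_numeral split: if_splits)
      show False
      proof (cases "is_end g")
        case True
        have "length A' \<ge> 2" using lAB by (simp add: A'_def)
        then have "length (A' @ B2) \<ge> 3" using B2n by (cases B2) auto
        then show False using triangle_own(1)[OF p FS(2) ad B2n True] g gn claims_adj adj_sym by blast
      next
        case False
        then have "is_closed g" using claims_kind g by blast
        then show False using triangle_own(2)[OF p FS(2) ad B2n] g claims_adj adj_sym by blast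
      qed
    qed
    then show ?thesis using l3 by auto
  qed
  then show "length F \<ge> 2" "length F \<ge> 3 \<Longrightarrow> \<not> claimed (F ! (length F - 2))" by auto
qed

lemma rev_edge:
  assumes "Suc i < length xs"
  obtains j where "Suc j < length (rev xs)" "rev xs ! j = xs ! Suc i" "rev xs ! Suc j = xs ! i"
  using assms by (intro that[of "length xs - Suc (Suc i)"]) (auto simp: rev_nth Suc_diff_Suc)

lemma insert_two:
  assumes P: "pathin (A @ C @ D)" "pathin [m, f]" "set [m, f] \<inter> set (A @ C @ D) = {}"
    and ne: "A \<noteq> []" "C \<noteq> []" "D \<noteq> []" and eg: "mset [e, g] = mset [m, f]"
    and ad: "adj e (last A)" "adj e (hd C)" "adj g (last C)" "adj g (hd D)"
  shows False
proof -
  have "valid (False, A @ [e] @ C @ [g] @ D)"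
    using pathin_valid[OF P(1)] ne ad by (auto simp: valid_simps)
  moreover have "mset (A @ [e] @ C @ [g] @ D) = mset (A @ C @ D) + mset [m, f]"
    using eg by (simp add: add_mset_commute)
  ultimately show False
    using no_merge2[of "(False, A @ C @ D)" "(False, [m, f])" "(False, A @ [e] @ C @ [g] @ D)"] P pathin_inQ
    by (auto simp: ne)
qed

text \<open>Both nodes could be inserted where they claim, and their piece would disappear. A path
  of two nodes has a single edge to pay with, so it must not have two triangles to pay for.\<close>

lemma two_triangles:
  assumes P: "pathin [m, f]" and t: "triangle m" "triangle f"
  shows False
proof -
  obtain S i where S: "pathin S" "Suc i < length S" and cS: "claims m (S ! i)" "claims m (S ! Suc i)"
    using t by (auto simp: triangle_def)
  obtain T j where T: "pathin T" "Suc j < length T" and cT: "claims f (T ! j)" "claims f (T ! Suc j)"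
    using t by (auto simp: triangle_def)
  have mf: "m \<noteq> f" using pathin_distinct[OF P] by simp
  have long: "length S \<ge> 3" "length T \<ge> 3"
    using claims_pos[OF S(1) _ cS(2)] claims_pos[OF T(1) _ cT(2)] S T by auto
  have d: "set [m, f] \<inter> set X = {}" if "pathin X" "length X \<ge> 3" for X
  proof (rule ccontr)
    assume "set [m, f] \<inter> set X \<noteq> {}"
    then have "[m, f] = X \<or> [m, f] = rev X" using path_path[OF that(1) P] by (metis Int_commute)
    then have "length X = length [m, f]" by (metis length_rev)
    then show False using that(2) by simp
  qed
  obtain A B where AB: "S = A @ B" "A \<noteq> []" "B \<noteq> []" "last A = S ! i" "hd B = S ! Suc i" "length A = Suc i"
    using edge_split[OF S] by metis
  have aS: "adj m (last A)" "adj m (hd B)" using cS claims_adj AB by auto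
  show False
  proof (cases "set S \<inter> set T = {}")
    case True
    obtain C D where CD: "T = C @ D" "C \<noteq> []" "D \<noteq> []" "last C = T ! j" "hd D = T ! Suc j"
      using edge_split[OF T] by metis
    have "valid (False, A @ [m] @ B)" "valid (False, C @ [f] @ D)"
      using pathin_valid[OF S(1)] pathin_valid[OF T(1)] cT claims_adj AB CD aS by (auto simp: valid_simps)
    then show False
      using no_merge3[of "(False, S)" "(False, T)" "(False, [m, f])" "(False, A @ [m] @ B)" "(False, C @ [f] @ D)"]
        True d[OF S(1) long(1)] d[OF T(1) long(2)] S T P pathin_inQ AB CD by auto
  next
    case False
    obtain l where l: "Suc l < length S" "claims f (S ! l)" "claims f (S ! Suc l)"
    proof (cases "T = S")
      case True
      then show thesis using that T cT by blast
    next
      case ne: False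
      then have "S = rev T" using path_path[OF S(1) T(1) False] by auto
      then show thesis using rev_edge[OF T(2)] cT that by metis
    qed
    \<comment> \<open>The two claimed pairs are disjoint because claimers are unique; hence the two
      insertions do not interfere.\<close>
    have neq: "l \<noteq> i" "l \<noteq> Suc i" "i \<noteq> Suc l" using l cS claims_unique mf by metis+
    show False
    proof (cases "l < i")
      case True
      have lA: "Suc l < length A" "l < length A" using True AB by auto
      define C D where "C = take (Suc l) A" and "D = drop (Suc l) A"
      have A: "A = C @ D" "C \<noteq> []" "D \<noteq> []" using lA by (auto simp: C_def D_def)
      have "last C = A ! l" "hd D = A ! Suc l" "last D = last A"
        using lA by (simp_all add: C_def D_def take_Suc_conv_app_nth hd_drop_conv_nth)
      then have "adj f (last C)" "adj f (hd D)" using l claims_adj lA AB(1) by (auto simp: nth_append)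
      moreover have "adj m (last D)" using aS \<open>last D = last A\<close> by simp
      ultimately show False
        using insert_two[of C D B m f f m] d[OF S(1) long(1)] S(1) AB A P aS by (simp add: add_mset_commute)
    next
      case False
      then have lB: "l - Suc i < length B" "Suc (l - Suc i) < length B" "l \<ge> Suc i" "0 < l - Suc i"
        using neq l AB by auto
      define C D where "C = take (l - i) B" and "D = drop (l - i) B"
      have B: "B = C @ D" "C \<noteq> []" "D \<noteq> []" using lB by (auto simp: C_def D_def)
      have li: "l - i = Suc (l - Suc i)" using lB by simp
      have "last C = B ! (l - Suc i)" "hd D = B ! Suc (l - Suc i)"
        using lB by (simp_all add: C_def D_def li take_Suc_conv_app_nth hd_drop_conv_nth)
      moreover have "hd C = hd B" using B by simp
      ultimately have "adj f (last C)" "adj f (hd D)" "adj m (hd C)"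
        using l claims_adj lB AB(1,6) aS by (auto simp: nth_append li)
      then show False
        using insert_two[of A C D m f m f] d[OF S(1) long(1)] S(1) AB B P aS by simp
    qed
  qed
qed

text \<open>The degrees in \<open>S\<close> add up to \<open>2 * card S\<close>, and at least 2 of
  this leaves \<open>S\<close>. Inner edges are counted in both directions.\<close>

lemma cut_le:
  assumes "S \<noteq> {}" "S \<noteq> UNIV"
  shows "(\<Sum>u\<in>S. \<Sum>v\<in>S. w u v) \<le> 2 * real (card S) - 2"
proof -
  have "(\<Sum>v\<in>S. w u v) + (\<Sum>v\<in>-S. w u v) = 2" for u
    using sum.union_disjoint[of S "-S" "w u"] w_sum[of u] by simp
  then have "(\<Sum>u\<in>S. \<Sum>v\<in>-S. w u v) = (\<Sum>u\<in>S. 2 - (\<Sum>v\<in>S. w u v))"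
    by (intro sum.cong refl) (simp add: algebra_simps)
  then show ?thesis using w_cut[OF assms] by (simp add: sum_subtractf)
qed

text \<open>Otherwise the end, its mate and the two claimed nodes would carry inner weight at least
  7/2: 2 at \<open>f\<close>, and 3/2 at \<open>y\<close> apart from the edge to \<open>f\<close>.
  The cut condition allows only 3.\<close>

lemma triangle_length:
  assumes R: "pathin R" "Suc i < length R" and c: "claims (last R) (R ! i)" "claims (last R) (R ! Suc i)"
  shows "i + 5 \<le> length R"
proof (rule ccontr)
  assume "\<not> i + 5 \<le> length R"
  then have len: "length R = i + 4" using claims_last_pos[OF R c(2)] by simp
  have i: "0 < i" using claims_pos[OF R(1) _ c(1)] R by simp
  define x y m f z where v: "x = R ! i" "y = R ! (i + 1)" "m = R ! (i + 2)" "f = R ! (i + 3)" "z = R ! (i - 1)"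
  have f: "last R = f" using last_nth(1)[OF R(1)] len v by (simp add: add.commute)
  have d: "distinct R" using pathin_distinct[OF R(1)] .
  have dist: "x \<noteq> y" "x \<noteq> m" "x \<noteq> f" "y \<noteq> m" "y \<noteq> f" "m \<noteq> f" "z \<noteq> x" "z \<noteq> y" "z \<noteq> m" "z \<noteq> f"
    using d i len by (auto simp: v nth_eq_iff_index_eq)
  have a: "adj z x" "adj x y" "adj y m" "adj m f"
    using path_adj[OF R(1), of "i - 1"] path_adj[OF R(1), of i] path_adj[OF R(1), of "i + 1"]
      path_adj[OF R(1), of "i + 2"] len i by (auto simp: v eval_nat_numeral)
  have ac: "adj f x" "adj f y" using c claims_adj f v by auto
  \<comment> \<open>An edge of weight 1 and cost 1 at the end lies on the path, so it leads to the
    mate.\<close>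
  have only_m: "w f g \<noteq> 1" if ag: "adj f g" "g \<noteq> m" for g
  proof
    assume "w f g = 1"
    then obtain F' where F': "R = F' @ [g, f]" using end_one_used[OF R(1)] ag f by metis
    then have "R ! (length R - 2) = g" by (simp add: nth_append)
    then show False using ag len v by simp
  qed
  have half: "w f x = 1/2" "w f y = 1/2"
    using only_m[OF ac(1)] only_m[OF ac(2)] dist ac w_values[of f x] w_values[of f y] by (auto simp: adj_def)
  have sub: "{x, y, m} \<subseteq> nbs f" "{x, m, f} \<subseteq> nbs y" using a ac adj_nbs adj_sym by auto
  have eq: "nbs f = {x, y, m}" "nbs y = {x, m, f}"
    using card_seteq[OF _ sub(1)] card_seteq[OF _ sub(2)] card_nbs_le[of f] card_nbs_le[of y] dist by auto
  have tot: "(\<Sum>g\<in>nbs u. w u g) = 2" for u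
  proof -
    have "(\<Sum>g\<in>nbs u. w u g) = (\<Sum>g\<in>UNIV. w u g)"
      using w_nonneg by (intro sum.mono_neutral_left) (auto simp: nbs_def order_less_le)
    then show ?thesis using w_sum by simp
  qed
  have tf: "w f x + w f y + w f m = 2" "w y x + w y m + w y f = 2"
    using tot[of f] tot[of y] dist unfolding eq by (simp_all add: add.assoc)
  \<comment> \<open>The node before \<open>x\<close> exists because claimed nodes are inner; it
    makes the set of four proper.\<close>
  have "z \<notin> {x, y, m, f}" using dist by auto
  then have S: "{x, y, m, f} \<noteq> UNIV" by blast
  have "card {x, y, m, f} = 4" using dist by auto
  then have "(\<Sum>u\<in>{x, y, m, f}. \<Sum>v\<in>{x, y, m, f}. w u v) \<le> 6" using cut_le[OF _ S] by simp
  moreover have "(\<Sum>u\<in>{x, y, m, f}. \<Sum>v\<in>{x, y, m, f}. w u v)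
      = 2 * (w x y + w x m + w f x + w y m + w f y + w f m)"
    using dist w_sym[of y x] w_sym[of m x] w_sym[of x f] w_sym[of m y] w_sym[of y f] w_sym[of m f]
    by (simp add: w_irrefl)
  ultimately have "2 * (w x y + w x m + w f x + w y m + w f y + w f m) \<le> 6" by simp
  then show False using tf half w_sym[of y x] w_sym[of y f] w_nonneg[of x m] by argo
qed

section \<open>Consecutive claimed nodes on a path\<close>

lemma rev_at: "i < length R \<Longrightarrow> rev R ! (length R - Suc i) = R ! i"
  by (simp add: rev_nth)

lemma rev_at_Suc: "Suc i < length R \<Longrightarrow> Suc (length R - Suc (Suc i)) = length R - Suc i"
  by simp

lemma hd_not_claimed: "pathin R \<Longrightarrow> \<not> claimed (R ! 0)"
  using claimed_not_end end_hd last_nth(2) by metis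

lemma last_not_claimed: "pathin R \<Longrightarrow> \<not> claimed (R ! (length R - 1))"
  using claimed_not_end end_last last_nth(1) by metis

lemma end_two_claims:
  assumes F: "pathin F" "last F = f" "length F \<ge> 2" and c: "claims f x" "claims f y" "claims f z"
  shows "x = y \<or> x = z \<or> y = z"
proof (rule ccontr)
  assume "\<not> ?thesis"
  then have "card {x, y, z} = 3" by auto
  moreover have "{x, y, z} \<subseteq> nbs f - {last (butlast F)}" using end_claims_nbs[OF F] c by blast
  then have "card {x, y, z} \<le> card (nbs f - {last (butlast F)})" by (intro card_mono) auto
  moreover have "last (butlast F) \<in> nbs f"
  proof -
    obtain G m where "F = G @ [m, f]"
      using F(2,3) by (cases F rule: rev_cases; cases "butlast F" rule: rev_cases) auto
    moreover from this have "adj m f" using pathin_valid[OF F(1)] by (auto simp: valid_simps)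
    ultimately show ?thesis using adj_nbs adj_sym by (auto simp: butlast_append)
  qed
  then have "card (nbs f - {last (butlast F)}) \<le> 2" using card_nbs_le[of f] by simp
  ultimately show False by simp
qed

lemma last_two_claims:
  assumes R: "pathin R" and c: "claims (last R) (R ! a)" "claims (last R) (R ! b)" "claims (last R) (R ! c)"
    and l: "a < length R" "b < length R" "c < length R"
  shows "a = b \<or> a = c \<or> b = c"
proof -
  have "length R \<ge> 2" using claims_last_pos[OF R l(1) c(1)] by simp
  then show ?thesis
    using end_two_claims[OF R refl _ c] pathin_distinct[OF R] l by (simp add: nth_eq_iff_index_eq)
qed

lemma hd_two_claims:
  assumes R: "pathin R" and c: "claims (hd R) (R ! a)" "claims (hd R) (R ! b)" "claims (hd R) (R ! c)"
    and l: "a < length R" "b < length R" "c < length R"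
  shows "a = b \<or> a = c \<or> b = c"
proof -
  have "length R - Suc a = length R - Suc b \<or> length R - Suc a = length R - Suc c \<or> length R - Suc b = length R - Suc c"
    using last_two_claims[OF pathin_rev[OF R], of "length R - Suc a" "length R - Suc b" "length R - Suc c"]
      c l by (simp add: last_rev rev_at)
  then show ?thesis using l by arith
qed

text \<open>The triangle uses up both claims of the end, so any claim on its own path is one of
  these two.\<close>

lemma triangle_at:
  assumes R: "pathin R" "triangle (last R)" "claims (last R) (R ! j)" "j < length R"
  obtains l where "Suc l < length R" "claims (last R) (R ! l)" "claims (last R) (R ! Suc l)" "j = l \<or> j = Suc l"
proof -
  obtain S i where S: "pathin S" "Suc i < length S" and c: "claims (last R) (S ! i)" "claims (last R) (S ! Suc i)"
    using R by (auto simp: triangle_def)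
  have l2: "length R \<ge> 2" using claims_last_pos[OF R(1,4,3)] by simp
  have "S ! i \<noteq> S ! Suc i" using S pathin_distinct[OF S(1)] by (simp add: nth_eq_iff_index_eq)
  then have Rj: "R ! j = S ! i \<or> R ! j = S ! Suc i" using end_two_claims[OF R(1) refl l2 R(3) c] by auto
  then have "R ! j \<in> set S" "R ! j \<in> set R" using S R by auto
  then have SR: "S = R \<or> S = rev R" using path_path[OF R(1) S(1)] by blast
  obtain l where l: "Suc l < length R" "claims (last R) (R ! l)" "claims (last R) (R ! Suc l)"
  proof (cases "S = R")
    case True
    then show thesis using that S c by blast
  next
    case False
    then have "R = rev S" using SR by simp
    then show thesis using rev_edge[OF S(2)] c that by metis
  qed
  then have "j = l \<or> j = Suc l" using last_two_claims[OF R(1,3) l(2,3) R(4)] by auto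
  then show thesis using that l by blast
qed

lemma claim_end_closed:
  assumes R: "pathin R" "Suc i < length R" and c: "claims f (R ! i)" "claims a (R ! Suc i)"
    and e: "is_end f" "is_closed a"
  shows "f = hd R"
  using claim_closed_end[OF pathin_rev[OF R(1)], of "length R - Suc (Suc i)" a f] R c e
  by (simp add: rev_at rev_at_Suc last_rev)

lemma claim_loop_rev:
  assumes R: "pathin R" "Suc i < length R" and c: "claims (hd R) (R ! i)" "claims a (R ! Suc i)" "is_closed a"
    and j: "j \<le> i"
  shows "is_end f \<Longrightarrow> f \<noteq> hd R \<Longrightarrow> \<not> adj f (R ! j)"
    and "is_closed b \<Longrightarrow> adj b (R ! j) \<Longrightarrow> same_closed a b \<and> \<not> cyc_nb a b"
  using claim_loop[OF pathin_rev[OF R(1)], of "length R - Suc (Suc i)" a "length R - Suc j"] R c j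
  by (simp_all add: rev_at rev_at_Suc last_rev)

lemma double_mate_closed_rev:
  assumes R: "pathin R" "Suc i < length R" and c: "claims (hd R) (R ! i)" "claims (last R) (R ! Suc i)"
    and "is_closed a" "adj a (R ! 1)" "i < j" "j < length R"
  shows "\<not> adj (hd R) (R ! j)"
proof -
  have "rev R ! (length R - 2) = R ! 1" using rev_at[of 1 R] R by (simp add: numeral_2_eq_2)
  then show ?thesis
    using double_mate_closed[OF pathin_rev[OF R(1)], of "length R - Suc (Suc i)" a "length R - Suc j"] assms
    by (simp add: rev_at rev_at_Suc last_rev hd_rev)
qed

text \<open>Here and below, the index \<open>i\<close> stands for the edge from \<open>R ! i\<close> to \<open>R ! Suc i\<close>.\<close>

definition unclaimed_edges :: "'a list \<Rightarrow> nat set" where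
  "unclaimed_edges R = {i. Suc i < length R \<and> \<not> claimed (R ! i) \<and> \<not> claimed (R ! Suc i)}"

text \<open>The middle edge of a path with an even number of nodes is in neither half, so this set
  is disjoint from the mirror image of its counterpart for \<open>rev R\<close>.\<close>

definition upper_unclaimed :: "'a list \<Rightarrow> nat set" where
  "upper_unclaimed R = {i \<in> unclaimed_edges R. length R \<le> 2 * i + 1}"

text \<open>The edges between a claim of a closed piece and a claim of the end for which no gap can
  pay, since no closed piece claims a later node.\<close>

definition closed_last :: "'a list \<Rightarrow> nat set" where
  "closed_last R = {e. Suc e < length R \<and> (\<exists>a. is_closed a \<and> claims a (R ! e)) \<and> claims (last R) (R ! Suc e) \<and>
     (\<forall>j b. e < j \<longrightarrow> j < length R \<longrightarrow> is_closed b \<longrightarrow> \<not> claims b (R ! j))}"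

text \<open>What the unclaimed edges in the upper half of \<open>R\<close> have to pay for; those in the lower half
  are treated by reversing \<open>R\<close>.\<close>

definition tail_need :: "'a list \<Rightarrow> nat" where
  "tail_need R = card (closed_last R) + (if triangle (last R) then 1 else 0)"

lemma finite_edges [simp]: "finite (unclaimed_edges R)" "finite (upper_unclaimed R)" "finite (closed_last R)"
  by (auto simp: unclaimed_edges_def upper_unclaimed_def closed_last_def
      intro: finite_subset[of _ "{..<length R}"])

lemma upper_unclaimed_pos: "i \<in> upper_unclaimed R \<Longrightarrow> 1 \<le> card (upper_unclaimed R)"
  by (metis One_nat_def Suc_leI card_gt_0_iff empty_iff finite_edges(2))

lemma upper_unclaimedI: "Suc i < length R \<Longrightarrow> \<not> claimed (R ! i) \<Longrightarrow> \<not> claimed (R ! Suc i) \<Longrightarrow> length R \<le> 2 * i + 1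
    \<Longrightarrow> i \<in> upper_unclaimed R"
  by (simp add: upper_unclaimed_def unclaimed_edges_def)

lemma last_edge_unclaimed:
  "pathin R \<Longrightarrow> length R \<ge> 3 \<Longrightarrow> \<not> claimed (R ! (length R - 2)) \<Longrightarrow> length R - 2 \<in> upper_unclaimed R"
  using last_not_claimed[of R] by (intro upper_unclaimedI) (auto simp: Suc_diff_Suc numeral_2_eq_2)

lemma last_two_edges_unclaimed:
  assumes "pathin R" "length R \<ge> 5" "\<not> claimed (R ! (length R - 2))" "\<not> claimed (R ! (length R - 3))"
  shows "2 \<le> card (upper_unclaimed R)"
proof -
  have s: "Suc (length R - 3) = length R - 2" using assms(2) by simp
  have "length R - 3 \<in> upper_unclaimed R" using assms by (intro upper_unclaimedI) (auto simp: s)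
  then have "{length R - 3, length R - 2} \<subseteq> upper_unclaimed R" using last_edge_unclaimed assms by simp
  from card_mono[OF _ this] show ?thesis using assms(2) by auto
qed

lemma claims_last_not_mate: "pathin R \<Longrightarrow> length R \<ge> 2 \<Longrightarrow> \<not> claims (last R) (R ! (length R - 2))"
  using claims_last_pos[of R "length R - 2"] by (cases "length R = 0") auto

text \<open>The nodes past \<open>e\<close> form a loop. It bars all other ends by
  \<open>claim_loop\<close>, and closed pieces are barred by \<open>closed_last\<close>.\<close>

lemma closed_last_beyond:
  assumes R: "pathin R" "e \<in> closed_last R" and j: "e < j" "j < length R" "claims g (R ! j)"
  shows "g = last R"
proof (rule ccontr)
  assume n: "g \<noteq> last R"
  obtain a where a: "is_closed a" "claims a (R ! e)" "claims (last R) (R ! Suc e)" "Suc e < length R"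
    using R by (auto simp: closed_last_def)
  have "\<not> is_closed g" using R j by (auto simp: closed_last_def)
  then have "is_end g" using claims_kind j by blast
  then show False using claim_loop(1)[OF R(1) a(4,2,3,1) j(1,2)] n j(3) claims_adj by blast
qed

lemma closed_last_card: 
  assumes "pathin R" shows "closed_last R = {} \<or> (\<exists>e. closed_last R = {e})"
proof -
  have "\<not> e < e'" if "e \<in> closed_last R" "e' \<in> closed_last R" for e e'
    using that by (auto simp: closed_last_def)
  then show ?thesis by (metis (no_types, opaque_lifting) equals0I is_singletonI' is_singleton_def nat_neq_iff)
qed

text \<open>The node \<open>R ! Suc e\<close> is in the triangle, and its partner is not
  \<open>R ! e\<close>, which is claimed by \<open>a\<close>. Both claims of the end are then spent
  near \<open>e\<close>, away from position \<open>length R - 3\<close>.\<close>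

lemma triangle_next:
  assumes R: "pathin R" "Suc e < length R" "triangle (last R)" "claims (last R) (R ! Suc e)"
    and a: "claims a (R ! e)" "a \<noteq> last R"
  shows "claims (last R) (R ! (e + 2))" "e + 6 \<le> length R" "\<not> claims (last R) (R ! (length R - 3))"
proof -
  obtain l where l: "Suc l < length R" "claims (last R) (R ! l)" "claims (last R) (R ! Suc l)"
      "Suc e = l \<or> Suc e = Suc l"
    using triangle_at[OF R(1,3,4,2)] .
  have "l \<noteq> e" using claims_unique[OF a(1)] l(2) a(2) by auto
  then have le: "l = Suc e" using l(4) by auto
  then show c: "claims (last R) (R ! (e + 2))" using l by simp
  show len: "e + 6 \<le> length R" using triangle_length[OF R(1) l(1-3)] le by simp
  show "\<not> claims (last R) (R ! (length R - 3))"
  proof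
    assume "claims (last R) (R ! (length R - 3))"
    then have "l = Suc l \<or> l = length R - 3 \<or> Suc l = length R - 3"
      using last_two_claims[OF R(1) l(2,3), of "length R - 3"] len l(1) by simp
    then show False using len le by arith
  qed
qed

text \<open>Whenever something is needed, the mate of the end is unclaimed, which frees the last
  edge. If both a triangle and an edge of \<open>closed_last\<close> are to be paid, the node before
  the mate is unclaimed as well.\<close>

lemma tail_need:
  assumes R: "pathin R" "length R \<ge> 3"
  shows "tail_need R \<le> card (upper_unclaimed R)"
proof (cases "closed_last R = {}")
  case True
  have "length R - 2 \<in> upper_unclaimed R" if "triangle (last R)"
    using triangle_mate[OF that R(1) refl] last_edge_unclaimed[OF R] R by auto
  then have "triangle (last R) \<longrightarrow> 1 \<le> card (upper_unclaimed R)" using upper_unclaimed_pos by blast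
  then show ?thesis using True by (simp add: tail_need_def)
next
  case False
  then obtain e where W: "closed_last R = {e}" using closed_last_card[OF R(1)] by blast
  then have eW: "e \<in> closed_last R" by simp
  then obtain a where a: "is_closed a" "claims a (R ! e)" "claims (last R) (R ! Suc e)" "Suc e < length R"
    by (auto simp: closed_last_def)
  have al: "a \<noteq> last R" using a end_not_closed end_last R(1) by blast
  have e3: "Suc e + 3 \<le> length R" using claims_last_pos[OF R(1) a(4,3)] .
  have m2: "\<not> claimed (R ! (length R - 2))"
    using closed_last_beyond[OF R(1) eW, of "length R - 2"] claims_last_not_mate[OF R(1)] e3
    by (auto simp: claimed_def)
  show ?thesis
  proof (cases "triangle (last R)")
    case True
    note t = triangle_next[OF R(1) a(4) True a(3,2) al]
    have "\<not> claimed (R ! (length R - 3))"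
      using closed_last_beyond[OF R(1) eW, of "length R - 3"] t by (auto simp: claimed_def)
    then show ?thesis using last_two_edges_unclaimed[OF R(1) _ m2] t(2) W by (simp add: tail_need_def True)
  next
    case False
    have "1 \<le> card (upper_unclaimed R)" using last_edge_unclaimed[OF R m2] by (rule upper_unclaimed_pos)
    then show ?thesis using False W by (simp add: tail_need_def)
  qed
qed

lemma upper_lower:
  assumes "length R \<ge> 1"
  shows "card (upper_unclaimed R) + card (upper_unclaimed (rev R)) \<le> card (unclaimed_edges R)"
proof -
  let ?m = "\<lambda>i. length R - Suc (Suc i)"
  have inj: "inj_on ?m (upper_unclaimed (rev R))"
    by (rule inj_onI) (auto simp: upper_unclaimed_def unclaimed_edges_def)
  have "?m ` upper_unclaimed (rev R) \<subseteq> unclaimed_edges R - upper_unclaimed R"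
    by (auto simp: upper_unclaimed_def unclaimed_edges_def rev_nth Suc_diff_Suc)
  then have dj: "upper_unclaimed R \<inter> ?m ` upper_unclaimed (rev R) = {}"
    and sub: "upper_unclaimed R \<union> ?m ` upper_unclaimed (rev R) \<subseteq> unclaimed_edges R"
    by (auto simp: upper_unclaimed_def)
  then have "card (upper_unclaimed R) + card (?m ` upper_unclaimed (rev R)) \<le> card (unclaimed_edges R)"
    using card_mono[OF _ sub] dj by (simp add: card_Un_disjoint)
  then show ?thesis using card_image[OF inj] by simp
qed

section \<open>Edges claimed from both ends of their path\<close>

definition double_edges :: "'a list \<Rightarrow> nat set" where
  "double_edges R = {i. Suc i < length R \<and> claims (hd R) (R ! i) \<and> claims (last R) (R ! Suc i)}"

lemma double_pos:
  assumes "pathin R" "i \<in> double_edges R"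
  shows "2 \<le> i" "i + 4 \<le> length R"
  using assms claims_hd_pos[of R i] claims_last_pos[of R "Suc i"] by (auto simp: double_edges_def)

lemma double_claims_closed:
  assumes "pathin R" "i \<in> double_edges R" "claims g (R ! j)" "j < length R" "g \<noteq> hd R" "g \<noteq> last R"
  shows "is_closed g"
proof -
  have "\<not> is_end g"
    using double_no_foreign[of R i g j] assms claims_adj by (auto simp: double_edges_def)
  then show ?thesis using claims_kind assms by blast
qed

lemma double_no_closed_last:
  assumes R: "pathin R" "i \<in> double_edges R" and e: "e \<in> closed_last R"
  shows "i \<le> e"
proof (rule ccontr)
  have i: "Suc i < length R" "claims (hd R) (R ! i)" using R by (auto simp: double_edges_def)
  assume "\<not> i \<le> e"
  then have "hd R = last R" using closed_last_beyond[OF R(1) e, of i "hd R"] i by simp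
  moreover have "length R \<ge> 2" using i by simp
  ultimately show False using pathin_distinct[OF R(1)] by (cases R) (auto split: if_splits)
qed

text \<open>The end \<open>hd R\<close> has spent both claims on the positions \<open>i\<close> and \<open>l\<close>, neither of which can be
  part of a closed-end pattern or of a triangle at that end.\<close>

lemma no_tail_need_rev:
  assumes R: "pathin R" "i \<in> double_edges R" and l: "i < l" "Suc l < length R" "claims (hd R) (R ! l)"
    and c: "\<And>b. is_closed b \<Longrightarrow> \<not> claims b (R ! Suc l)"
  shows "tail_need (rev R) = 0"
proof -
  have i: "Suc i < length R" "claims (hd R) (R ! i)" "claims (last R) (R ! Suc i)" using R by (auto simp: double_edges_def)
  have l2: "length R \<ge> 2" using i by simp
  have ne: "hd R \<noteq> last R" using pathin_distinct[OF R(1)] l2 by (cases R) (auto split: if_splits)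
  have il: "l \<noteq> Suc i" using claims_unique[OF i(3)] l ne by metis
  have lst: "\<not> is_closed (last R)" using end_last[OF R(1)] end_not_closed by blast
  have two: "j = i \<or> j = l" if "claims (hd R) (R ! j)" "j < length R" for j
    using hd_two_claims[OF R(1) i(2) l(3) that(1)] l i that by auto
  have "closed_last (rev R) = {}"
  proof (rule equals0I)
    fix e assume "e \<in> closed_last (rev R)"
    then obtain a where e: "Suc e < length R" "is_closed a" "claims a (rev R ! e)" "claims (hd R) (rev R ! Suc e)"
      by (auto simp: closed_last_def last_rev)
    define j where "j = length R - Suc (Suc e)"
    have j: "Suc j < length R" "claims (hd R) (R ! j)" "claims a (R ! Suc j)"
      using e by (auto simp: j_def rev_nth Suc_diff_Suc)
    have "j = i \<or> j = l" using two j by simp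
    then show False using c[OF e(2)] j(3) claims_unique[OF i(3)] lst e(2) by metis
  qed
  moreover have "\<not> triangle (last (rev R))"
  proof
    assume t: "triangle (last (rev R))"
    have ci: "claims (last (rev R)) (rev R ! (length R - Suc i))" "length R - Suc i < length (rev R)"
      using i by (simp_all add: last_rev rev_at)
    obtain e where "Suc e < length (rev R)" "claims (last (rev R)) (rev R ! e)"
        "claims (last (rev R)) (rev R ! Suc e)"
      using triangle_at[OF pathin_rev[OF R(1)] t ci] .
    then have e: "Suc e < length R" "claims (hd R) (rev R ! e)" "claims (hd R) (rev R ! Suc e)"
      by (simp_all add: last_rev)
    define j where "j = length R - Suc (Suc e)"
    have j: "Suc j < length R" "claims (hd R) (R ! j)" "claims (hd R) (R ! Suc j)"
      using e by (auto simp: j_def rev_nth Suc_diff_Suc)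
    have "j = i \<or> j = l" "Suc j = i \<or> Suc j = l" using two j by simp_all
    then show False using l(1) il by auto
  qed
  ultimately show ?thesis by (simp add: tail_need_def)
qed

lemma rev_last_edge_unclaimed:
  "pathin R \<Longrightarrow> length R \<ge> 3 \<Longrightarrow> \<not> claimed (R ! 1) \<Longrightarrow> card (upper_unclaimed (rev R)) \<ge> 1"
proof -
  assume a: "pathin R" "length R \<ge> 3" "\<not> claimed (R ! 1)"
  have "rev R ! (length R - 2) = R ! 1" using rev_at[of 1 R] a by (simp add: numeral_2_eq_2)
  then have "length (rev R) - 2 \<in> upper_unclaimed (rev R)" using last_edge_unclaimed[OF pathin_rev] a by simp
  then show ?thesis by (metis One_nat_def Suc_leI card_gt_0_iff empty_iff finite_edges(2))
qed

lemma hd_claims_not_mate: "pathin R \<Longrightarrow> length R \<ge> 2 \<Longrightarrow> \<not> claims (hd R) (R ! 1)"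
  using claims_hd_pos[of R 1] by auto

text \<open>A claim on the mate by \<open>hd R\<close> would be its third. A claim by a closed piece
  contradicts \<open>double_mate_closed\<close> for \<open>i'\<close>, because \<open>last R\<close>
  is also adjacent to \<open>R ! Suc i\<close>, which lies in the other loop.\<close>

lemma two_doubles:
  assumes R: "pathin R" "i \<in> double_edges R" "i' \<in> double_edges R" "i < i'"
  shows "\<not> claimed (R ! (length R - 2))"
proof
  assume "claimed (R ! (length R - 2))"
  then obtain g where g: "claims g (R ! (length R - 2))" by (auto simp: claimed_def)
  have i: "claims (hd R) (R ! i)" "claims (last R) (R ! Suc i)" and
    i': "Suc i' < length R" "claims (hd R) (R ! i')" "claims (last R) (R ! Suc i')" using R by (auto simp: double_edges_def)
  have l: "length R - 2 < length R" using i' by simp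
  have gl: "g \<noteq> last R" using claims_last_not_mate[OF R(1)] g i' by auto
  show False
  proof (cases "g = hd R")
    case True
    then have "i = length R - 2 \<or> i' = length R - 2"
      using hd_two_claims[OF R(1) i(1) i'(2), of "length R - 2"] g R(4) i'(1) l by auto
    then show False using double_pos[OF R(1,2)] double_pos[OF R(1,3)] by auto
  next
    case False
    have "is_closed g" using double_claims_closed[OF R(1,2) g l False gl] .
    then show False
      using double_mate_closed[OF R(1) i' _ claims_adj[OF g], of "Suc i"] R(4) i(2) claims_adj by auto
  qed
qed

lemma rev_double:
  assumes "i \<in> double_edges R"
  shows "length R - Suc (Suc i) \<in> double_edges (rev R)"
  using assms by (auto simp: double_edges_def rev_nth hd_rev last_rev Suc_diff_Suc)

lemma double_no_need:
  assumes R: "pathin R" "i \<in> double_edges R" "i' \<in> double_edges R" "i < i'"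
  shows "tail_need (rev R) = 0"
proof -
  have i': "Suc i' < length R" "claims (hd R) (R ! i')" "claims (last R) (R ! Suc i')" using R by (auto simp: double_edges_def)
  have "\<not> claims b (R ! Suc i')" if "is_closed b" for b
    using claims_unique[OF i'(3)] that end_last[OF R(1)] end_not_closed by metis
  then show ?thesis using no_tail_need_rev[OF R(1,2,4) i'(1,2)] by blast
qed

text \<open>Each end has spent both claims on the double edges and has no need of its own, and the
  first and last edges of the path are free to pay.\<close>

lemma two_double_count:
  assumes R: "pathin R" "i \<in> double_edges R" "i' \<in> double_edges R" "i < i'"
  shows "tail_need R + tail_need (rev R) + 2 \<le> card (unclaimed_edges R)"
proof -
  have l: "length R \<ge> 3" using double_pos[OF R(1,2)] by simp
  define j j' where "j = length R - Suc (Suc i)" and "j' = length R - Suc (Suc i')"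
  have j: "j \<in> double_edges (rev R)" "j' \<in> double_edges (rev R)" "j' < j"
    using rev_double R double_pos[OF R(1,3)] by (auto simp: j_def j'_def)
  have z: "tail_need R = 0" "tail_need (rev R) = 0"
    using double_no_need[OF R] double_no_need[OF pathin_rev[OF R(1)] j(2,1,3)] by auto
  have "length R - 2 \<in> upper_unclaimed R" "length R - 2 \<in> upper_unclaimed (rev R)"
    using last_edge_unclaimed[OF R(1) l two_doubles[OF R]]
      last_edge_unclaimed[OF pathin_rev[OF R(1)] _ two_doubles[OF pathin_rev[OF R(1)] j(2,1,3)]] l by auto
  then have "card (upper_unclaimed R) \<noteq> 0" "card (upper_unclaimed (rev R)) \<noteq> 0" by (auto simp: card_eq_0_iff)
  then show ?thesis using upper_lower[of R] l z by linarith
qed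

text \<open>Past \<open>i\<close> only the two ends can claim. The additional unclaimed edge is
  found near \<open>last R\<close>, unless \<open>hd R\<close> spends its second claim past
  \<open>i\<close>; in that case the need at \<open>hd R\<close> vanishes and the first edge is
  unclaimed.\<close>

lemma one_double_count:
  assumes R: "pathin R" "i \<in> double_edges R"
    and right: "\<And>j b. i < j \<Longrightarrow> j < length R \<Longrightarrow> is_closed b \<Longrightarrow> \<not> claims b (R ! j)"
  shows "tail_need R + tail_need (rev R) + 1 \<le> card (unclaimed_edges R)"
proof -
  have i: "Suc i < length R" "claims (hd R) (R ! i)" "claims (last R) (R ! Suc i)" using R by (auto simp: double_edges_def)
  note pos = double_pos[OF R]
  have l3: "length R \<ge> 3" "length (rev R) \<ge> 3" "length R \<ge> 1" using pos by simp_all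
  have ne: "hd R \<noteq> last R" using pathin_distinct[OF R(1)] l3 by (cases R) (auto split: if_splits)
  have W: "closed_last R = {}"
  proof (rule equals0I)
    fix e assume e: "e \<in> closed_last R"
    then obtain a where a: "is_closed a" "claims a (R ! e)" "Suc e < length R" by (auto simp: closed_last_def)
    have "\<not> i < e" using right[of e a] a by auto
    then have "e = i" using double_no_closed_last[OF R e] by simp
    then show False using claims_unique[OF i(2)] a end_hd[OF R(1)] end_not_closed by metis
  qed
  note low = tail_need[OF pathin_rev[OF R(1)] l3(2)] and ul = upper_lower[OF l3(3)]
  have claimers: "g = hd R \<or> g = last R" if "i < j" "j < length R" "claims g (R ! j)" for g j
    using double_claims_closed[OF R that(3,2)] right[OF that(1,2)] that(3) by blast
  have mate: "claims (hd R) (R ! (length R - 2))" if cm: "claimed (R ! (length R - 2))"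
  proof -
    obtain g where g: "claims g (R ! (length R - 2))" using cm by (auto simp: claimed_def)
    moreover have "g \<noteq> last R" using claims_last_not_mate[OF R(1)] g l3 by auto
    ultimately show ?thesis using claimers[of "length R - 2" g] pos by auto
  qed
  \<comment> \<open>The node \<open>R ! 1\<close> is the mate of \<open>hd R\<close>. A closed piece
    cannot claim it once \<open>hd R\<close> is adjacent to a node of the opposite loop.\<close>
  have first: "\<not> claimed (R ! 1)" if l: "i < l" "l < length R" "claims (hd R) (R ! l)"
    and "\<not> claims (last R) (R ! 1)" for l
  proof
    assume "claimed (R ! 1)"
    then obtain g where g: "claims g (R ! 1)" by (auto simp: claimed_def)
    have "g \<noteq> hd R" "g \<noteq> last R" using hd_claims_not_mate[OF R(1)] g that l3 by auto
    then have "is_closed g" using double_claims_closed[OF R g] l3 by simp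
    then show False using double_mate_closed_rev[OF R(1) i _ claims_adj[OF g] l(1,2)] l claims_adj by auto
  qed
  show ?thesis
  proof (cases "triangle (last R)")
    case False
    then have nR: "tail_need R = 0" using W by (simp add: tail_need_def)
    show ?thesis
    proof (cases "claimed (R ! (length R - 2))")
      case False
      then have "card (upper_unclaimed R) \<noteq> 0"
        using last_edge_unclaimed[OF R(1) l3(1)] by (auto simp: card_eq_0_iff)
      then show ?thesis using nR low ul by linarith
    next
      case True
      note m = mate[OF True]
      have "tail_need (rev R) = 0"
        using no_tail_need_rev[OF R _ _ m] right pos by auto
      moreover have "\<not> claims (last R) (R ! 1)"
        using double_mates[OF R(1) i] m claims_adj by auto
      then have "\<not> claimed (R ! 1)" using first[OF _ _ m] pos by auto
      then have "card (upper_unclaimed (rev R)) \<ge> 1" using rev_last_edge_unclaimed[OF R(1) l3(1)] by simp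
      ultimately show ?thesis using nR ul by linarith
    qed
  next
    case t: True
    then have nR: "tail_need R = 1" using W by (simp add: tail_need_def)
    note tn = triangle_next[OF R(1) i(1) t i(3,2) ne]
    have m: "\<not> claimed (R ! (length R - 2))" using triangle_mate[OF t R(1) refl] l3 by simp
    show ?thesis
    proof (cases "\<exists>l. i < l \<and> l < length R \<and> claims (hd R) (R ! l)")
      case False
      have "i < length R - 3" "length R - 3 < length R" using tn(2) by simp_all
      then have "\<not> claimed (R ! (length R - 3))"
        using claimers tn(3) False unfolding claimed_def by metis
      then show ?thesis using last_two_edges_unclaimed[OF R(1) _ m] tn(2) nR low ul by linarith
    next
      case True
      then obtain l where l: "i < l" "l < length R" "claims (hd R) (R ! l)" by blast
      have "Suc l < length R" using claims_pos[OF R(1) l(2,3)] by simp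
      then have "tail_need (rev R) = 0" using no_tail_need_rev[OF R l(1) _ l(3)] right l by auto
      moreover have "\<not> claims (last R) (R ! 1)"
        using last_two_claims[OF R(1) i(3) tn(1), of 1] tn(2) pos by auto
      then have "\<not> claimed (R ! 1)" using first[OF l] by blast
      then have "card (upper_unclaimed (rev R)) \<ge> 1" using rev_last_edge_unclaimed[OF R(1) l3(1)] by simp
      moreover have "card (upper_unclaimed R) \<ge> 1" using tail_need[OF R(1) l3(1)] nR by simp
      ultimately show ?thesis using nR ul by linarith
    qed
  qed
qed

section \<open>Gaps and the count for one path\<close>

text \<open>Successive claims of one closed piece along the path. That piece will pay one unit for
  each; it can, because they are fewer than its claims and small pieces have few pairs of
  non-neighbours.\<close>

definition gaps :: "'a list \<Rightarrow> (nat \<times> nat) set" where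
  "gaps R = {(p, q). p < q \<and> q < length R \<and> (\<exists>a b. claims a (R ! p) \<and> claims b (R ! q) \<and> same_closed a b \<and>
     \<not> cyc_nb a b \<and> (\<forall>l c. p < l \<longrightarrow> l < q \<longrightarrow> claims c (R ! l) \<longrightarrow> \<not> same_closed a c))}"

definition claimed_edges :: "'a list \<Rightarrow> nat set" where
  "claimed_edges R = {i. Suc i < length R \<and> claimed (R ! i) \<and> claimed (R ! Suc i)}"

definition end_triangles :: "'a list \<Rightarrow> nat set" where
  "end_triangles R = {i. Suc i < length R \<and> (\<exists>f. is_end f \<and> claims f (R ! i) \<and> claims f (R ! Suc i))}"

definition triangle_ends :: "'a list \<Rightarrow> nat" where
  "triangle_ends R = card {f \<in> {hd R, last R}. triangle f}"

lemma finite_gaps [simp]: "finite (gaps R)" "finite (claimed_edges R)" "finite (double_edges R)"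
  "finite (end_triangles R)"
proof -
  have "gaps R \<subseteq> {..<length R} \<times> {..<length R}" by (auto simp: gaps_def)
  then show "finite (gaps R)" by (rule finite_subset) auto
qed (auto simp: claimed_edges_def double_edges_def end_triangles_def intro: finite_subset[of _ "{..<length R}"])

lemma same_closed_closed: "same_closed a b \<Longrightarrow> is_closed a" "same_closed a b \<Longrightarrow> is_closed b"
  by (auto simp: same_closed_def is_closed_def)

lemma gapsI:
  assumes "p < q" "q < length R" "claims a (R ! p)" "claims b (R ! q)" "same_closed a b" "\<not> cyc_nb a b"
    "\<And>l c. p < l \<Longrightarrow> l < q \<Longrightarrow> claims c (R ! l) \<Longrightarrow> \<not> is_closed c"
  shows "(p, q) \<in> gaps R"
  unfolding gaps_def using assms same_closed_closed by blast

lemma edge_kinds: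
  assumes R: "pathin R" and e: "e \<in> claimed_edges R - end_triangles R"
  obtains (closed) a b where "claims a (R ! e)" "claims b (R ! Suc e)" "is_closed a" "is_closed b"
      "same_closed a b" "\<not> cyc_nb a b"
    | (closed_end) a where "claims a (R ! e)" "is_closed a" "claims (last R) (R ! Suc e)"
    | (end_closed) a where "claims (hd R) (R ! e)" "claims a (R ! Suc e)" "is_closed a"
    | (double) "e \<in> double_edges R"
proof -
  obtain a b where ab: "Suc e < length R" "claims a (R ! e)" "claims b (R ! Suc e)"
    using e by (auto simp: claimed_edges_def claimed_def)
  note k = claims_kind[OF ab(2)] claims_kind[OF ab(3)]
  show thesis
  proof (cases "is_closed a"; cases "is_closed b")
    assume "is_closed a" "is_closed b"
    then show thesis using closed claim_closed_closed[OF R ab] ab by blast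
  next
    assume "is_closed a" "\<not> is_closed b"
    then show thesis using closed_end claim_closed_end[OF R ab] ab k by blast
  next
    assume "\<not> is_closed a" "is_closed b"
    then show thesis using end_closed claim_end_closed[OF R ab] ab k by blast
  next
    assume "\<not> is_closed a" "\<not> is_closed b"
    then have ends: "is_end a" "is_end b" using k by auto
    moreover have "a \<noteq> b" using e ab ends by (auto simp: end_triangles_def)
    ultimately have "a = hd R \<and> b = last R" using claim_ends[OF R ab] by blast
    then show thesis using double ab by (auto simp: double_edges_def)
  qed
qed

text \<open>The rule by which gaps pay for edges. A gap may pay at its first or last edge, or for a
  double edge that it spans if that is the only one; this keeps the assignment injective.\<close>

definition gapped :: "'a list \<Rightarrow> nat \<Rightarrow> nat \<times> nat \<Rightarrow> bool" where
  "gapped R e g \<longleftrightarrow> g \<in> gaps R \<and> fst g \<le> e \<and> e < snd g \<and>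
     (fst g = e \<or> snd g = Suc e \<or> double_edges R = {e})"

text \<open>If the gap starts at \<open>e\<close>, the next node must be claimed by
  \<open>last R\<close>, as a claim of the same closed piece would end the gap; the resulting loop
  bars \<open>hd R\<close> from \<open>R ! e'\<close>. Otherwise \<open>e\<close> is the only double
  edge and the gap ends at \<open>Suc e'\<close>; then the loop of \<open>hd R\<close> bars
  \<open>last R\<close> from \<open>R ! Suc e\<close>.\<close>

lemma gapped_unique:
  assumes R: "pathin R" and e: "e \<in> claimed_edges R - end_triangles R" "e' \<in> claimed_edges R - end_triangles R"
    and g: "gapped R e (p, q)" "gapped R e' (p, q)"
  shows "\<not> e < e'"
proof
  assume lt: "e < e'"
  obtain a b where ab: "claims a (R ! p)" "claims b (R ! q)" "same_closed a b" "q < length R" "p < q"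
    and no: "\<And>l c. p < l \<Longrightarrow> l < q \<Longrightarrow> claims c (R ! l) \<Longrightarrow> \<not> same_closed a c"
    using g by (auto simp: gapped_def gaps_def)
  note sc = same_closed_closed[OF ab(3)]
  have pq: "p \<le> e" "Suc e < q" "p < e'" "e' < q" using g lt by (auto simp: gapped_def)
  have ends: "\<not> is_closed (hd R)" "\<not> is_closed (last R)" "is_end (hd R)" "is_end (last R)"
    using end_hd[OF R] end_last[OF R] end_not_closed by auto
  have "length R \<ge> 2" using pq ab by simp
  then have ne: "hd R \<noteq> last R" using pathin_distinct[OF R] by (cases R) (auto split: if_splits)
  have 1: "claims (last R) (R ! Suc e) \<and> claims a (R ! e)" if pe: "p = e"
    using R e(1)
  proof (cases rule: edge_kinds)
    case (closed a' b')
    then have "a' = a" using claims_unique[of a'] ab pe by simp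
    then show ?thesis using no[of "Suc e" b'] closed pq by auto
  next
    case (closed_end a')
    then show ?thesis using claims_unique[of a'] ab pe by blast
  next
    case (end_closed a')
    then show ?thesis using claims_unique[of a "R ! e" "hd R"] ab pe sc ends by auto
  next
    case double
    then show ?thesis using claims_unique[of a "R ! e" "hd R"] ab pe sc ends by (auto simp: double_edges_def)
  qed
  have 2: "claims (hd R) (R ! e') \<and> claims b (R ! Suc e')" if qe: "q = Suc e'"
    using R e(2)
  proof (cases rule: edge_kinds)
    case (closed a' b')
    then have "b' = b" using claims_unique[of b'] ab qe by simp
    then have "same_closed a a'" using same_closed_trans[OF ab(3)] same_closed_sym closed by blast
    then show ?thesis using no[of e' a'] closed pq by auto
  next
    case (closed_end a')
    then show ?thesis using claims_unique[of b "R ! Suc e'" "last R"] ab qe sc ends by auto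
  next
    case (end_closed a')
    then show ?thesis using claims_unique[of a'] ab qe by blast
  next
    case double
    then show ?thesis using claims_unique[of b "R ! Suc e'" "last R"] ab qe sc ends by (auto simp: double_edges_def)
  qed
  have hd: "claims (hd R) (R ! e')"
    using 2 g(2) pq by (auto simp: gapped_def double_edges_def)
  show False
  proof (cases "p = e")
    case True
    then have "\<not> adj (hd R) (R ! e')"
      using claim_loop(1)[OF R _ _ _ sc(1) lt, of "hd R"] 1 ab pq ends ne by simp
    then show False using hd claims_adj by blast
  next
    case False
    then have d: "double_edges R = {e}" using g(1) pq by (auto simp: gapped_def)
    then have q: "q = Suc e'" using g(2) pq lt by (auto simp: gapped_def)
    have "claims (last R) (R ! Suc e)" using d by (auto simp: double_edges_def)
    moreover have "\<not> adj (last R) (R ! Suc e)"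
      using claim_loop_rev(1)[OF R _ hd _ sc(2), of "Suc e" "last R"] 2[OF q] ab q lt ends ne by auto
    ultimately show False using claims_adj by blast
  qed
qed

lemma gapped_gap: "gapped R e g \<Longrightarrow> g \<in> gaps R"
  by (simp add: gapped_def)

lemma gapped_card:
  assumes R: "pathin R"
  shows "card {e \<in> claimed_edges R - end_triangles R. \<exists>g. gapped R e g} \<le> card (gaps R)"
proof (rule card_inj_on_le)
  let ?h = "\<lambda>e. SOME g. gapped R e g"
  let ?G = "{e \<in> claimed_edges R - end_triangles R. \<exists>g. gapped R e g}"
  have h: "gapped R e (?h e)" if "e \<in> ?G" for e
    using that by (auto intro: someI_ex)
  show "inj_on ?h ?G"
  proof (rule inj_onI)
    fix e e' assume e: "e \<in> ?G" "e' \<in> ?G" "?h e = ?h e'"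
    obtain p q where pq: "?h e = (p, q)" by fastforce
    have "gapped R e (p, q)" "gapped R e' (p, q)" using h[OF e(1)] h[OF e(2)] e(3) pq by auto
    then have "\<not> e < e'" "\<not> e' < e" using gapped_unique[OF R] e by blast+
    then show "e = e'" by simp
  qed
  show "?h ` ?G \<subseteq> gaps R" using gapped_gap[OF h] by (rule image_subsetI)
qed simp

text \<open>By \<open>claim_loop\<close>, the first later claim of a closed piece would come from
  the piece of \<open>a\<close> and from a non-neighbour of \<open>a\<close>, so it would end a gap
  starting at \<open>e\<close>.\<close>

lemma closed_end_ungapped:
  assumes R: "pathin R" "Suc e < length R" and c: "claims a (R ! e)" "is_closed a" "claims (last R) (R ! Suc e)"
    and g: "\<nexists>g. gapped R e g"
  shows "e \<in> closed_last R"
proof (rule ccontr)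
  define P where "P j \<longleftrightarrow> e < j \<and> j < length R \<and> (\<exists>b. is_closed b \<and> claims b (R ! j))" for j
  assume "e \<notin> closed_last R"
  then have ex: "\<exists>j. P j" using R c unfolding P_def closed_last_def by blast
  define j where "j = (LEAST j. P j)"
  have j: "P j" unfolding j_def using LeastI_ex[OF ex] .
  have no: "\<not> P l" if "l < j" for l using not_less_Least that unfolding j_def by blast
  obtain b where b: "e < j" "j < length R" "is_closed b" "claims b (R ! j)" using j by (auto simp: P_def)
  have "same_closed a b \<and> \<not> cyc_nb a b"
    using claim_loop(2)[OF R c(1,3,2) b(1,2,3) claims_adj[OF b(4)]] .
  moreover have "\<not> is_closed c'" if "e < l" "l < j" "claims c' (R ! l)" for l c'
    using no[OF that(2)] that b by (auto simp: P_def)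
  ultimately have "(e, j) \<in> gaps R" using gapsI[OF b(1,2) c(1) b(4)] by blast
  then have "gapped R e (e, j)" using b by (simp add: gapped_def)
  then show False using g by blast
qed

lemma end_closed_ungapped:
  assumes R: "pathin R" "Suc e < length R" and c: "claims (hd R) (R ! e)" "claims a (R ! Suc e)" "is_closed a"
    and g: "\<nexists>g. gapped R e g"
  shows "length R - Suc (Suc e) \<in> closed_last (rev R)"
proof (rule ccontr)
  define P where "P j \<longleftrightarrow> j \<le> e \<and> (\<exists>b. is_closed b \<and> claims b (R ! j))" for j
  assume n: "length R - Suc (Suc e) \<notin> closed_last (rev R)"
  have r: "rev R ! (length R - Suc (Suc e)) = R ! Suc e" "rev R ! Suc (length R - Suc (Suc e)) = R ! e"
      "Suc (length R - Suc (Suc e)) < length R"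
    using R by (simp_all add: rev_nth Suc_diff_Suc)
  have "\<exists>i b. length R - Suc (Suc e) < i \<and> i < length R \<and> is_closed b \<and> claims b (rev R ! i)"
    using n c r by (auto simp: closed_last_def last_rev)
  then obtain i b where i: "length R - Suc (Suc e) < i" "i < length R" "is_closed b" "claims b (rev R ! i)" by blast
  then have "P (length R - Suc i)" using R by (auto simp: P_def rev_nth)
  then have ex: "\<exists>j. P j" by blast
  have bd: "\<forall>j. P j \<longrightarrow> j \<le> e" by (simp add: P_def)
  define j where "j = (GREATEST j. P j)"
  have j: "P j" unfolding j_def using GreatestI_ex_nat[OF ex] bd by blast
  have no: "\<not> P l" if "j < l" for l
    using Greatest_le_nat[of P l e] bd that unfolding j_def by fastforce
  obtain b where b: "j \<le> e" "is_closed b" "claims b (R ! j)" using j by (auto simp: P_def)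
  have "same_closed a b \<and> \<not> cyc_nb a b"
    using claim_loop_rev(2)[OF R c b(1,2) claims_adj[OF b(3)]] .
  then have "same_closed b a" "\<not> cyc_nb b a" using same_closed_sym cyc_nb_sym by blast+
  moreover have "\<not> is_closed c'" if "j < l" "l < Suc e" "claims c' (R ! l)" for l c'
    using no[OF that(1)] that by (auto simp: P_def)
  ultimately have "(j, Suc e) \<in> gaps R" using gapsI[OF _ R(2) b(3) c(2)] b by simp
  then have "gapped R e (j, Suc e)" using b by (simp add: gapped_def)
  then show False using g by blast
qed

text \<open>The closed claims nearest to the edge on either side would form a gap by
  \<open>double_closed\<close>.\<close>

lemma double_side:
  assumes R: "pathin R" "double_edges R = {i}" and g: "\<nexists>g. gapped R i g"
    and jl: "j \<le> i" "is_closed a" "claims a (R ! j)" "i < l" "l < length R" "is_closed b" "claims b (R ! l)"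
  shows False
proof -
  define P where "P j \<longleftrightarrow> j \<le> i \<and> (\<exists>b. is_closed b \<and> claims b (R ! j))" for j
  define P' where "P' j \<longleftrightarrow> i < j \<and> j < length R \<and> (\<exists>b. is_closed b \<and> claims b (R ! j))" for j
  have ex: "\<exists>j. P j" "\<exists>j. P' j" using jl unfolding P_def P'_def by blast+
  have bd: "\<forall>j. P j \<longrightarrow> j \<le> i" by (simp add: P_def)
  define p where "p = (GREATEST j. P j)"
  have p: "P p" unfolding p_def using GreatestI_ex_nat[OF ex(1)] bd by blast
  have nop: "\<not> P l" if "p < l" for l
    using Greatest_le_nat[of P l i] bd that unfolding p_def by fastforce
  define q where "q = (LEAST j. P' j)"
  have q: "P' q" unfolding q_def using LeastI_ex[OF ex(2)] .
  have noq: "\<not> P' l" if "l < q" for l using not_less_Least that unfolding q_def by blast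
  obtain a' where a: "p \<le> i" "is_closed a'" "claims a' (R ! p)" using p by (auto simp: P_def)
  obtain b' where b: "i < q" "q < length R" "is_closed b'" "claims b' (R ! q)" using q by (auto simp: P'_def)
  have i: "Suc i < length R" "claims (hd R) (R ! i)" "claims (last R) (R ! Suc i)"
    using R(2) by (auto simp: double_edges_def)
  have "same_closed a' b' \<and> \<not> cyc_nb a' b'"
    using double_closed[OF R(1) i a(1) b(1,2) a(2) b(3) claims_adj[OF a(3)] claims_adj[OF b(4)]] .
  moreover have "\<not> is_closed c'" if "p < l" "l < q" "claims c' (R ! l)" for l c'
    using nop[OF that(1)] noq[OF that(2)] that b by (auto simp: P_def P'_def not_le)
  ultimately have "(p, q) \<in> gaps R" using gapsI[OF _ b(2) a(3) b(4)] a b by simp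
  then have "gapped R i (p, q)" using a b R(2) by (simp add: gapped_def)
  then show False using g by blast
qed

lemma unclaimed_edges_rev: "card (unclaimed_edges (rev R)) \<le> card (unclaimed_edges R)"
proof (rule card_inj_on_le)
  show "inj_on (\<lambda>i. length R - Suc (Suc i)) (unclaimed_edges (rev R))"
    by (rule inj_onI) (auto simp: unclaimed_edges_def)
  show "(\<lambda>i. length R - Suc (Suc i)) ` unclaimed_edges (rev R) \<subseteq> unclaimed_edges R"
    by (auto simp: unclaimed_edges_def rev_nth Suc_diff_Suc)
qed simp

text \<open>Each end has only two claims on a path of this length, so there are at most two double
  edges, and two are paid for even without gaps. A single ungapped one has closed claims on one side
  only, which by reversal is the side of \<open>hd R\<close>.\<close>

lemma double_count:
  assumes R: "pathin R" "length R \<ge> 3"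
  shows "tail_need R + tail_need (rev R) + card {i \<in> double_edges R. \<nexists>g. gapped R i g} \<le> card (unclaimed_edges R)"
    (is "_ + card ?D \<le> _")
proof (cases "?D = {}")
  case True
  then have "card ?D = 0" by (simp only: card.empty)
  then show ?thesis
    using tail_need[OF R] tail_need[OF pathin_rev[OF R(1)]] upper_lower[of R] R(2)
    by (simp only: length_rev) auto
next
  case False
  then obtain i where i: "i \<in> double_edges R" "\<nexists>g. gapped R i g" by blast
  show ?thesis
  proof (cases "double_edges R = {i}")
    case True
    have "?D = {i}" using True i by blast
    then have one: "card ?D = 1" by simp
    have ln: "Suc i < length R" using i by (auto simp: double_edges_def)
    show ?thesis
    proof (cases "\<exists>l b. i < l \<and> l < length R \<and> is_closed b \<and> claims b (R ! l)")
      case False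
      then show ?thesis using one_double_count[OF R(1) i(1)] one by auto
    next
      case rt: True
      have "\<not> claims b (rev R ! j)" if j: "length R - Suc (Suc i) < j" "j < length (rev R)" "is_closed b" for j b
      proof
        assume "claims b (rev R ! j)"
        then have "claims b (R ! (length R - Suc j))" "length R - Suc j \<le> i" using j by (auto simp: rev_nth)
        then show False using double_side[OF R(1) True i(2) _ j(3)] rt by blast
      qed
      then have "tail_need (rev R) + tail_need (rev (rev R)) + 1 \<le> card (unclaimed_edges (rev R))"
        using one_double_count[OF pathin_rev[OF R(1)] rev_double[OF i(1)]] by blast
      then show ?thesis using unclaimed_edges_rev[of R] one by simp
    qed
  next
    case False
    then obtain i' where i': "i' \<in> double_edges R" "i' \<noteq> i" using i by blast
    have "double_edges R \<subseteq> {i, i'}"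
    proof
      fix x assume "x \<in> double_edges R"
      then have "i = i' \<or> i = x \<or> i' = x"
        using hd_two_claims[OF R(1), of i i' x] i i' by (simp add: double_edges_def)
      then show "x \<in> {i, i'}" using i'(2) by auto
    qed
    then have "?D \<subseteq> {i, i'}" by blast
    then have "card ?D \<le> card {i, i'}" by (intro card_mono) auto
    then have "card ?D \<le> 2" using i' by auto
    moreover have "tail_need R + tail_need (rev R) + 2 \<le> card (unclaimed_edges R)"
      using two_double_count[OF R(1) i(1) i'(1)] two_double_count[OF R(1) i'(1) i(1)] i'(2) by linarith
    ultimately show ?thesis by linarith
  qed
qed

text \<open>Without a gap, an edge of \<open>claimed_edges R - end_triangles R\<close> belongs to
  \<open>closed_last\<close> at one of the two ends or is a double edge. These, together with the
  triangles at the ends, are paid by unclaimed edges. Paths of fewer than three nodes have no inner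
  pair, only possibly a triangle at an end.\<close>

lemma path_count:
  assumes R: "pathin R"
  shows "card (claimed_edges R - end_triangles R) + triangle_ends R \<le> card (unclaimed_edges R) + card (gaps R)"
proof (cases "length R \<ge> 3")
  case False
  have "claimed_edges R = {}"
    using False hd_not_claimed[OF R] last_not_claimed[OF R] by (auto simp: claimed_edges_def not_le less_Suc_eq numeral_3_eq_3)
  moreover have "triangle_ends R \<le> card (unclaimed_edges R)"
  proof (cases "length R = 2")
    case True
    then obtain m f where mf: "R = [m, f]" by (cases R; cases "tl R") auto
    have "0 \<in> unclaimed_edges R" using hd_not_claimed[OF R] last_not_claimed[OF R] True
      by (auto simp: unclaimed_edges_def)
    then have "card (unclaimed_edges R) \<noteq> 0" by (auto simp: card_eq_0_iff)
    moreover have "{g \<in> {hd R, last R}. triangle g} \<subseteq> {m} \<or> {g \<in> {hd R, last R}. triangle g} \<subseteq> {f}"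
      using two_triangles[of m f] R mf by auto
    then have "triangle_ends R \<le> 1"
      unfolding triangle_ends_def using card_mono[of "{m}"] card_mono[of "{f}"] by fastforce
    ultimately show ?thesis by linarith
  next
    case False
    then have "length R = 1" using \<open>\<not> 3 \<le> length R\<close> pathin_valid[OF R] by (cases R) (auto simp: not_le less_Suc_eq numeral_3_eq_3)
    then have "\<not> triangle (last R)" "hd R = last R" using triangle_mate(1)[OF _ R refl] by (auto simp: length_Suc_conv)
    then have "{g \<in> {hd R, last R}. triangle g} = {}" by auto
    then show ?thesis unfolding triangle_ends_def by (simp only: card.empty)
  qed
  ultimately show ?thesis by simp
next
  case True
  let ?N = "claimed_edges R - end_triangles R"
  let ?G = "{e \<in> ?N. \<exists>g. gapped R e g}" and ?D = "{i \<in> double_edges R. \<nexists>g. gapped R i g}"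
  let ?M = "(\<lambda>i. length R - Suc (Suc i)) ` closed_last (rev R)"
  have "?N \<subseteq> ?G \<union> (closed_last R \<union> (?M \<union> ?D))"
  proof
    fix e assume e: "e \<in> ?N"
    have l: "Suc e < length R" using e by (auto simp: claimed_edges_def)
    show "e \<in> ?G \<union> (closed_last R \<union> (?M \<union> ?D))"
    proof (cases "\<exists>g. gapped R e g")
      case True then show ?thesis using e by blast
    next
      case ng: False
      from R e show ?thesis
      proof (cases rule: edge_kinds)
        case (closed a b)
        then have "(e, Suc e) \<in> gaps R" using gapsI[of e "Suc e" R a b] l by simp
        then have "gapped R e (e, Suc e)" by (simp add: gapped_def)
        then show ?thesis using ng by blast
      next
        case (closed_end a)
        then show ?thesis using closed_end_ungapped[OF R l] ng by blast
      next
        case (end_closed a)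
        then have "length R - Suc (Suc e) \<in> closed_last (rev R)" using end_closed_ungapped[OF R l] ng by blast
        moreover have "e = length R - Suc (Suc (length R - Suc (Suc e)))" using l by simp
        ultimately show ?thesis by blast
      next
        case double
        then show ?thesis using ng by blast
      qed
    qed
  qed
  then have "card ?N \<le> card (?G \<union> (closed_last R \<union> (?M \<union> ?D)))" by (intro card_mono) auto
  also have "\<dots> \<le> card ?G + (card (closed_last R) + (card ?M + card ?D))"
    using card_Un_le by (meson add_left_mono order_trans)
  also have "card ?M \<le> card (closed_last (rev R))" by (rule card_image_le) simp
  finally have 1: "card ?N \<le> card ?G + (card (closed_last R) + (card (closed_last (rev R)) + card ?D))" by simp
  have "hd R \<noteq> last R" using pathin_distinct[OF R] True by (cases R) (auto split: if_splits)
  moreover have "{f \<in> {hd R, last R}. triangle f} =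
    (if triangle (hd R) then {hd R} else {}) \<union> (if triangle (last R) then {last R} else {})" by auto
  ultimately have "triangle_ends R = (if triangle (last R) then 1 else 0) + (if triangle (hd R) then 1 else 0)"
    by (auto simp: triangle_ends_def)
  then have "triangle_ends R + (card (closed_last R) + card (closed_last (rev R))) = tail_need R + tail_need (rev R)"
    by (simp add: tail_need_def last_rev)
  then show ?thesis using 1 gapped_card[OF R] double_count[OF R True] by linarith
qed

end

section \<open>The charging argument for paths\<close>

text \<open>The term \<open>1 - s i - s (Suc i)\<close> is 1 on a pair outside \<open>P\<close>, -1
  on a pair inside and 0 otherwise. As the extremities are outside \<open>P\<close>, the sum meets
  each element of \<open>P\<close> twice.\<close>

lemma alternation_count:
  assumes "m \<ge> 1" "\<not> P 0" "\<not> P (m - 1 :: nat)"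
  shows "real m = 1 + 2 * real (card {i. i < m \<and> P i}) + real (card {i. Suc i < m \<and> \<not> P i \<and> \<not> P (Suc i)})
     - real (card {i. Suc i < m \<and> P i \<and> P (Suc i)})"
proof -
  define s where "s i = (if P i then 1 else 0 :: real)" for i
  have sum: "real (card {i. i < l \<and> R i}) = (\<Sum>i<l. if R i then 1 else 0)" for l and R :: "nat \<Rightarrow> bool"
    by (simp add: sum.If_cases Int_def lessThan_def)
  have S: "{i. Suc i < m \<and> R i} = {i. i < m - 1 \<and> R i}" for R by auto
  have "real (card {i. Suc i < m \<and> \<not> P i \<and> \<not> P (Suc i)}) - real (card {i. Suc i < m \<and> P i \<and> P (Suc i)})
    = (\<Sum>i<m-1. 1 - s i - s (Suc i))"
    unfolding S sum sum_subtractf[symmetric] s_def by (intro sum.cong) auto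
  also have "\<dots> = real (m - 1) - (\<Sum>i<m-1. s i) - (\<Sum>i<m-1. s (Suc i))"
    by (simp add: sum_subtractf)
  also have "(\<Sum>i<m-1. s i) = (\<Sum>i<m. s i)"
    using assms by (cases m) (auto simp: s_def)
  also have "(\<Sum>i<m-1. s (Suc i)) = (\<Sum>i<m. s i)"
    using assms by (cases m) (auto simp: s_def sum.lessThan_Suc_shift simp del: sum.lessThan_Suc)
  also have "(\<Sum>i<m. s i) = real (card {i. i < m \<and> P i})"
    unfolding sum s_def by simp
  finally show ?thesis using assms(1) by simp
qed

context optimal_cover
begin

definition paths :: "'a list set" where
  "paths = {xs. (False, xs) \<in># Q}"

definition cycs :: "'a list set" where
  "cycs = {xs. (True, xs) \<in># Q}"

definition phi :: "'a \<Rightarrow> real" where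
  "phi v = (\<Sum>u | k v u. 5 * w v u)"

definition worth :: "'a \<Rightarrow> real" where
  "worth f = 2 * real (card {v. claims f v}) + phi f"

lemma set_Q: "set_mset Q = Pair False ` paths \<union> Pair True ` cycs"
proof (intro equalityI subsetI)
  fix p assume "p \<in># Q"
  then show "p \<in> Pair False ` paths \<union> Pair True ` cycs"
    by (cases p; cases "fst p") (auto simp: paths_def cycs_def)
qed (auto simp: paths_def cycs_def)

lemma finite_pieces [simp]: "finite paths" "finite cycs"
proof -
  have "finite (Pair False ` paths)" "finite (Pair True ` cycs)"
    using set_Q finite_set_mset[of Q] by (metis finite_Un)+
  then show "finite paths" "finite cycs" by (auto simp: finite_image_iff inj_on_def)
qed

lemma Q_simple: "Q = mset_set (set_mset Q)"
proof (rule multiset_eqI)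
  fix p
  show "count Q p = count (mset_set (set_mset Q)) p"
  proof (cases "p \<in># Q")
    case True
    obtain a where a: "a \<in> set (snd p)" using piece_valid[OF True] by (metis valid_def list.set_intros(1) neq_Nil_conv)
    have "count Q p = 1"
    proof (rule ccontr)
      assume "count Q p \<noteq> 1"
      moreover have "0 < count Q p" using True by (rule count_greater_zero_iff[THEN iffD2])
      ultimately have "1 < count Q p" by linarith
      then have "p \<in># Q - {#p#}" by (simp add: in_diff_count)
      then have "Q = add_mset p (add_mset p (Q - {#p#} - {#p#}))" using True by (metis insert_DiffM)
      then have "nodes Q = mset (snd p) + (mset (snd p) + nodes (Q - {#p#} - {#p#}))" by (metis nodes_simps(2))
      moreover have "count (nodes Q) a \<le> 1" using cover_Q by (simp add: cover_def)
      moreover have "count (mset (snd p)) a \<ge> 1" using a by (simp add: Suc_le_eq)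
      ultimately show False by simp
    qed
    then show ?thesis using True by simp
  qed (simp add: not_in_iff)
qed

lemma sum_pieces: "(\<Sum>p\<in>#Q. h p) = (\<Sum>R\<in>paths. h (False, R)) + (\<Sum>Z\<in>cycs. h (True, Z))"
proof -
  have "(\<Sum>p\<in>#Q. h p) = (\<Sum>p\<in>set_mset Q. h p)"
    using Q_simple by (metis sum_unfold_sum_mset)
  also have "\<dots> = (\<Sum>p\<in>Pair False ` paths. h p) + (\<Sum>p\<in>Pair True ` cycs. h p)"
    unfolding set_Q by (rule sum.union_disjoint) auto
  finally show ?thesis by (simp add: sum.reindex inj_on_def)
qed

lemma size_Q: "size Q = card paths + card cycs"
  using sum_pieces[of "\<lambda>_. 1 :: nat"] by simp

lemma length_pieces: "CARD('a) = (\<Sum>R\<in>paths. length R) + (\<Sum>Z\<in>cycs. length Z)"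
  using sum_pieces[of "\<lambda>p. length (snd p)"] cover_length[OF cover_Q] by simp

lemma paths_in: "R \<in> paths \<Longrightarrow> pathin R"
  by (simp add: paths_def pathin_def)

lemma cycs_in: "Z \<in> cycs \<Longrightarrow> cycin Z"
  unfolding cycs_def cycin_def by (metis mem_Collect_eq rotate0 id_apply)

lemma paths_disjoint: "R \<in> paths \<Longrightarrow> S \<in> paths \<Longrightarrow> R \<noteq> S \<Longrightarrow> set R \<inter> set S = {}"
  using pieces_disjoint[of "(False, R)" "(False, S)"] by (auto simp: paths_def)

lemma cycs_disjoint: "R \<in> cycs \<Longrightarrow> S \<in> cycs \<Longrightarrow> R \<noteq> S \<Longrightarrow> set R \<inter> set S = {}"
  using pieces_disjoint[of "(True, R)" "(True, S)"] by (auto simp: cycs_def)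

lemma pathin_paths: "pathin R \<Longrightarrow> R \<in> paths \<or> rev R \<in> paths"
  by (simp add: pathin_def paths_def)

lemma cycin_cycs:
  assumes "cycin Z" obtains Y where "Y \<in> cycs" "set Y = set Z"
  using assms unfolding cycin_def cycs_def by auto

lemma phi_nonneg: "phi f \<ge> 0"
  unfolding phi_def using w_nonneg by (intro sum_nonneg) auto

lemma worth_nonneg: "worth f \<ge> 0"
  using phi_nonneg[of f] by (simp add: worth_def)

lemma claimed_position:
  assumes "claimed v"
  obtains R i where "R \<in> paths" "i < length R" "R ! i = v"
proof -
  obtain A B where "pathin (A @ v # B)" using assms by (auto simp: claimed_def claims_def)
  then obtain R where "R \<in> paths" "v \<in> set R" using pathin_paths by fastforce
  then show ?thesis using that by (metis in_set_conv_nth)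
qed

lemma path_length:
  assumes "R \<in> paths"
  shows "real (length R) = 1 + 2 * real (card {v \<in> set R. claimed v}) + real (card (unclaimed_edges R))
     - real (card (claimed_edges R))"
proof -
  note R = paths_in[OF assms]
  have "bij_betw (\<lambda>i. R ! i) {i. i < length R \<and> claimed (R ! i)} {v \<in> set R. claimed v}"
    unfolding bij_betw_def using pathin_distinct[OF R]
    by (auto simp: inj_on_def nth_eq_iff_index_eq in_set_conv_nth)
  then have "card {i. i < length R \<and> claimed (R ! i)} = card {v \<in> set R. claimed v}" by (rule bij_betw_same_card)
  moreover have "length R \<ge> 1" using pathin_valid[OF R] by (cases R) auto
  ultimately show ?thesis
    using alternation_count[of "length R" "\<lambda>i. claimed (R ! i)"] hd_not_claimed[OF R] last_not_claimed[OF R]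
    by (simp add: unclaimed_edges_def claimed_edges_def)
qed

lemma card_claimed: "(\<Sum>R\<in>paths. card {v \<in> set R. claimed v}) = (\<Sum>f\<in>UNIV. card {v. claims f v})"
proof -
  have "(\<Sum>R\<in>paths. card {v \<in> set R. claimed v}) = card (\<Union>R\<in>paths. {v \<in> set R. claimed v})"
    using paths_disjoint by (intro card_UN_disjoint[symmetric]) auto
  also have "(\<Union>R\<in>paths. {v \<in> set R. claimed v}) = (\<Union>f\<in>UNIV. {v. claims f v})"
  proof (intro equalityI subsetI)
    fix v assume "v \<in> (\<Union>f\<in>UNIV. {v. claims f v})"
    then have "claimed v" by (auto simp: claimed_def)
    then obtain R i where "R \<in> paths" "i < length R" "R ! i = v" using claimed_position by blast
    then show "v \<in> (\<Union>R\<in>paths. {v \<in> set R. claimed v})" using \<open>claimed v\<close> nth_mem by blast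
  qed (auto simp: claimed_def)
  also have "card \<dots> = (\<Sum>f\<in>UNIV. card {v. claims f v})"
    using claims_unique by (intro card_UN_disjoint) auto
  finally show ?thesis .
qed

text \<open>The two units that a claimed node contributes in \<open>path_length\<close> are handed
  to its unique claimer.\<close>

lemma ledger:
  "real CARD('a) + (\<Sum>v\<in>UNIV. phi v) =
     (\<Sum>R\<in>paths. 1 + real (card (unclaimed_edges R)) - real (card (claimed_edges R)))
     + (\<Sum>Z\<in>cycs. real (length Z)) + (\<Sum>f\<in>UNIV. worth f)"
proof -
  have "real CARD('a) = (\<Sum>R\<in>paths. real (length R)) + (\<Sum>Z\<in>cycs. real (length Z))"
    using length_pieces by simp
  also have "(\<Sum>R\<in>paths. real (length R)) = (\<Sum>R\<in>paths. 2 * real (card {v \<in> set R. claimed v}) +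
      (1 + real (card (unclaimed_edges R)) - real (card (claimed_edges R))))"
    using path_length by (intro sum.cong) auto
  also have "\<dots> = 2 * real (\<Sum>R\<in>paths. card {v \<in> set R. claimed v}) +
      (\<Sum>R\<in>paths. 1 + real (card (unclaimed_edges R)) - real (card (claimed_edges R)))"
    by (simp add: sum.distrib sum_distrib_left)
  also have "2 * real (\<Sum>R\<in>paths. card {v \<in> set R. claimed v}) = (\<Sum>f\<in>UNIV. worth f) - (\<Sum>f\<in>UNIV. phi f)"
    unfolding card_claimed worth_def by (simp add: sum.distrib sum_distrib_left)
  finally show ?thesis by simp
qed

section \<open>What the ends of paths collect\<close>

text \<open>Ends and closed pieces are excluded as neighbours of \<open>f\<close> by optimality, so
  \<open>g\<close> is an inner node; the condition on \<open>F\<close> says that \<open>g\<close> is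
  not the mate of \<open>f\<close>.\<close>

lemma claims_other:
  assumes f: "is_end f" "adj f g" and F: "pathin F" "last F = f" and g: "\<And>G. F \<noteq> G @ [g, f]"
  shows "claims f g"
proof -
  have gf: "g \<noteq> f" using f adj_irrefl by metis
  have "\<not> is_closed g" using end_closed_nonadj f by blast
  then obtain R where R: "pathin R" "g \<in> set R" using node_cases[of g] is_closed_def by metis
  have "\<not> is_end g"
  proof
    assume e: "is_end g"
    show False
    proof (cases rule: end_cases[OF e F(1)])
      case 1
      then have "\<not> length F \<ge> 3" using same_ends_nonadj[OF F(1)] F f by auto
      moreover have "F \<noteq> []" "F \<noteq> [f]" using 1 gf pathin_valid[OF F(1)] by auto
      ultimately have "F = [g, f]"
        using 1 F(2) by (cases F; cases "tl F"; cases "tl (tl F)") auto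
      then show False using g[of "[]"] by simp
    next
      case 2 then show False using F gf by simp
    next
      case (3 G)
      then show False using ends_nonadj[OF F(1) 3(1)] F f by auto
    qed
  qed
  then have "g \<noteq> hd R" "g \<noteq> last R" using end_hd end_last R by blast+
  then obtain A c d B where AB: "R = A @ [c, g, d] @ B" using path_split3[OF R] by metis
  have "f \<noteq> c \<and> f \<noteq> d"
  proof (cases "set F \<inter> set R = {}")
    case True
    moreover have "f \<in> set F" using F pathin_valid[OF F(1)] by auto
    ultimately show ?thesis using AB by auto
  next
    case False
    have d: "distinct R" using pathin_distinct R by blast
    have "R = F \<or> R = rev F" using path_path[OF F(1) R(1) False] .
    then show ?thesis
    proof
      assume "R = F"
      then have "last R = f" using F by simp
      then have "last (d # B) = f" unfolding AB by simp
      then have "f \<in> set (d # B)" by (metis last_in_set list.distinct(1))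
      moreover have "B \<noteq> []" if "d = f" using that AB g[of "A @ [c]"] \<open>R = F\<close> by auto
      ultimately show ?thesis using d AB \<open>last (d # B) = f\<close> by (auto split: if_splits)
    next
      assume rF: "R = rev F"
      then have "hd R = f" using F by (simp add: hd_rev)
      then have hd: "hd (A @ [c]) = f" unfolding AB by (simp add: hd_append split: if_splits)
      then have "f \<in> set (A @ [c])" by (metis hd_in_set snoc_eq_iff_butlast)
      moreover have "A \<noteq> []" if "c = f"
      proof
        assume "A = []"
        then have "F = rev ([f, g, d] @ B)" using AB rF that by (metis append_Nil rev_rev_ident)
        then show False using g[of "rev B @ [d]"] by simp
      qed
      ultimately show ?thesis using d AB hd by (auto simp: hd_append split: if_splits)
    qed
  qed
  moreover have "pathin ((A @ [c]) @ g # (d # B))" using R AB by simp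
  ultimately show ?thesis
    using claims_at[of "A @ [c]" g "d # B" f] f by auto
qed

definition share :: "'a \<Rightarrow> 'a \<Rightarrow> real" where
  "share f g = (if claims f g then 2 else 0) + (if k f g then 5 * w f g else 0)"

lemma worth_share: "worth f = (\<Sum>g\<in>nbs f. share f g)"
proof -
  have "{v. claims f v} = nbs f \<inter> {v. claims f v}" using claims_adj adj_nbs by auto
  then have "(\<Sum>g\<in>nbs f. if claims f g then 2 else 0 :: real) = 2 * real (card {v. claims f v})"
    by (simp add: sum.If_cases mult.commute)
  moreover have "(\<Sum>g\<in>nbs f. if k f g then 5 * w f g else 0) = phi f"
  proof -
    have "(\<Sum>g\<in>nbs f. if k f g then 5 * w f g else 0) = (\<Sum>g\<in>nbs f \<inter> {g. k f g}. 5 * w f g)"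
      by (simp add: sum.If_cases Int_def)
    also have "\<dots> = phi f" unfolding phi_def using w_nonneg
      by (intro sum.mono_neutral_left) (auto simp: nbs_def order_less_le)
    finally show ?thesis .
  qed
  ultimately show ?thesis unfolding worth_def share_def by (simp add: sum.distrib)
qed

lemma share_nonneg: "share f g \<ge> 0"
  using w_nonneg by (simp add: share_def)

lemma nbs_half: "g \<in> nbs f \<Longrightarrow> w f g \<ge> 1/2"
  using w_values[of f g] by (auto simp: nbs_def)

text \<open>A missing edge gives 2 by a claim if it has cost 1, and at least 5/2 if it has cost 2.
  With weight 1 it must have cost 2, by \<open>end_one_used\<close>, and gives 5.\<close>

lemma end_share:
  assumes F: "pathin F" "last F = f" and g: "g \<in> nbs f" "\<And>G. F \<noteq> G @ [g, f]"
  shows "share f g \<ge> 2" "w f g = 1 \<Longrightarrow> share f g \<ge> 5"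
proof -
  have e: "is_end f" using F end_last by blast
  show "share f g \<ge> 2"
  proof (cases "k f g")
    case True
    then show ?thesis using nbs_half[OF g(1)] by (simp add: share_def)
  next
    case False
    then have "adj f g" using g by (simp add: adj_def nbs_def)
    then show ?thesis using claims_other[OF e _ F] g False by (simp add: share_def)
  qed
  show "share f g \<ge> 5" if "w f g = 1"
  proof -
    have "k f g"
    proof (rule ccontr)
      assume "\<not> k f g"
      then have "adj f g" using that by (simp add: adj_def)
      then show False using end_one_used[OF F(1)] F(2) that g(2) by metis
    qed
    then show ?thesis using that by (simp add: share_def)
  qed
qed

lemma card_ge_2: "finite A \<Longrightarrow> card A \<ge> 2 \<Longrightarrow> x \<in> A \<Longrightarrow> \<exists>y. y \<in> A \<and> y \<noteq> x"
  by (metis One_nat_def Suc_1 card_1_singleton_iff card_le_Suc0_iff_eq not_less_eq_eq)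

lemma share_sum: "A \<subseteq> nbs f \<Longrightarrow> (\<Sum>g\<in>A. share f g) \<le> worth f"
  unfolding worth_share using share_nonneg by (intro sum_mono2) auto

text \<open>With three neighbours, two edges are missing and give at least 2 each. With two
  neighbours both edges have weight 1, and the missing one gives at least 5.\<close>

lemma end_worth:
  assumes F: "pathin F" "length F \<ge> 2"
  shows "worth (last F) \<ge> 4"
proof -
  define f where "f = last F"
  obtain G m where G: "F = G @ [m, f]"
    using F(2) f_def by (cases F rule: rev_cases; cases "butlast F" rule: rev_cases) auto
  have "adj m f" using pathin_valid[OF F(1)] G by (auto simp: valid_simps)
  then have m: "m \<in> nbs f" using adj_nbs adj_sym by blast
  note es = end_share[OF F(1) f_def[symmetric]]
  have oth: "\<And>H. F \<noteq> H @ [g, f]" if "g \<noteq> m" for g using that G by auto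
  have "worth f \<ge> 4"
  proof (cases "card (nbs f) \<ge> 3")
    case True
    have "real (card (nbs f - {m})) * 2 \<le> (\<Sum>g\<in>nbs f - {m}. share f g)"
      using es(1) oth by (intro sum_bounded_below) auto
    moreover have "card (nbs f - {m}) \<ge> 2" using True m by simp
    ultimately show ?thesis using share_sum[of "nbs f - {m}" f] by auto
  next
    case False
    then have "card {v. w f v = 1} = 2" "{v. w f v = 1/2} = {}" using node_types[of f] card_nbs[of f] by auto
    then have ones: "w f g = 1" if "g \<in> nbs f" for g using that nbs_split by auto
    obtain g where g: "g \<in> nbs f" "g \<noteq> m" using card_ge_2[OF _ card_nbs_ge m] by auto
    have "share f g \<ge> 5" using es(2)[OF g(1) oth[OF g(2)] ones[OF g(1)]] .
    then show ?thesis using share_sum[of "{g}" f] g by simp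
  qed
  then show ?thesis by (simp add: f_def)
qed

text \<open>A single node stands for both ends of its piece, so it has to collect 8. All its edges
  are missing and give at least 5 + 2 + 2 or 5 + 5.\<close>

lemma single_worth:
  assumes F: "pathin [f]"
  shows "worth f \<ge> 8"
proof -
  note es = end_share[OF F, of f, simplified]
  obtain v where v: "w f v = 1" using ex_one by blast
  then have vn: "v \<in> nbs f" by (simp add: nbs_def)
  have v5: "share f v \<ge> 5" using es(2)[OF vn] v by simp
  show ?thesis
  proof (cases "card (nbs f) \<ge> 3")
    case True
    have "real (card (nbs f - {v})) * 2 \<le> (\<Sum>g\<in>nbs f - {v}. share f g)"
      using es(1) by (intro sum_bounded_below) auto
    moreover have "card (nbs f - {v}) \<ge> 2" using True vn by simp
    moreover have "worth f = share f v + (\<Sum>g\<in>nbs f - {v}. share f g)"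
      unfolding worth_share by (rule sum.remove) (use vn in auto)
    ultimately show ?thesis using v5 by auto
  next
    case False
    then have "card {v. w f v = 1} = 2" "{v. w f v = 1/2} = {}" using node_types[of f] card_nbs[of f] by auto
    then have ones: "w f g = 1" if "g \<in> nbs f" for g using that nbs_split by auto
    obtain g where g: "g \<in> nbs f" "g \<noteq> v" using card_ge_2[OF _ card_nbs_ge vn] by auto
    have "share f g \<ge> 5" using es(2)[OF g(1)] ones g by simp
    then show ?thesis using share_sum[of "{g, v}" f] g vn v5 by simp
  qed
qed

lemma ends_worth:
  assumes "R \<in> paths"
  shows "8 \<le> (\<Sum>f\<in>{hd R, last R}. worth f)"
proof (cases "length R \<ge> 2")
  case True
  note R = paths_in[OF assms]
  have "worth (last R) \<ge> 4" "worth (hd R) \<ge> 4"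
    using end_worth[OF R True] end_worth[OF pathin_rev[OF R]] True by (auto simp: last_rev)
  moreover have "hd R \<noteq> last R" using pathin_distinct[OF R] True by (cases R) (auto split: if_splits)
  ultimately show ?thesis by simp
next
  case False
  note R = paths_in[OF assms]
  obtain f where "R = [f]" using False pathin_valid[OF R] by (cases R; cases "tl R") auto
  then show ?thesis using single_worth R by simp
qed

text \<open>An end with a triangle has no further claims, so it accounts for one edge only. The
  reserve for that edge is set aside on the path of the end, which may differ from the path of the
  edge; hence the sums over all paths.\<close>

lemma triangle_balance: "(\<Sum>R\<in>paths. card (end_triangles R)) \<le> (\<Sum>R\<in>paths. triangle_ends R)"
proof -
  let ?S = "SIGMA R:paths. end_triangles R"
  let ?P = "\<lambda>(R, i) f. is_end f \<and> claims f (R ! i) \<and> claims f (R ! Suc i)"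
  let ?c = "\<lambda>p. SOME f. ?P p f"
  have c: "?P p (?c p)" if "p \<in> ?S" for p
    using that by (intro someI_ex[of "?P p"]) (auto simp: end_triangles_def)
  have "(\<Sum>R\<in>paths. card (end_triangles R)) = card ?S" by simp
  also have "\<dots> \<le> card {f. triangle f}"
  proof (rule card_inj_on_le)
    show "?c ` ?S \<subseteq> {f. triangle f}"
    proof (rule image_subsetI)
      fix p assume p: "p \<in> ?S"
      obtain R i where pi: "p = (R, i)" by fastforce
      have "pathin R" "Suc i < length R" using p paths_in by (auto simp: pi end_triangles_def)
      then show "?c p \<in> {f. triangle f}" using c[OF p] unfolding triangle_def pi by blast
    qed
    show "inj_on ?c ?S"
    proof (rule inj_onI)
      fix p q assume pq: "p \<in> ?S" "q \<in> ?S" "?c p = ?c q"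
      obtain R i S j where e: "p = (R, i)" "q = (S, j)" by fastforce
      define f where "f = ?c p"
      have R: "R \<in> paths" "Suc i < length R" and S: "S \<in> paths" "Suc j < length S"
        using pq by (auto simp: e end_triangles_def)
      have cR: "is_end f" "claims f (R ! i)" "claims f (R ! Suc i)" using c[OF pq(1)] by (auto simp: e f_def)
      have cS: "claims f (S ! j)" "claims f (S ! Suc j)" using c[OF pq(2)] pq(3) by (auto simp: e f_def)
      obtain F where F: "pathin F" "last F = f" using cR(1) by (auto simp: is_end_def)
      have "triangle f" unfolding triangle_def using cR R paths_in by blast
      then have "length F \<ge> 2" using triangle_mate(1) F by blast
      note two = end_two_claims[OF F this cR(2,3)]
      have dR: "distinct R" and dS: "distinct S" using R S paths_in pathin_distinct by blast+
      then have n: "R ! i \<noteq> R ! Suc i" "S ! j \<noteq> S ! Suc j" using R S by (auto simp: nth_eq_iff_index_eq)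
      have k: "S ! j = R ! i \<and> S ! Suc j = R ! Suc i \<or> S ! j = R ! Suc i \<and> S ! Suc j = R ! i"
        using two[OF cS(1)] two[OF cS(2)] n by auto
      have "S ! j \<in> set S" "R ! i \<in> set R" "R ! Suc i \<in> set R" using R S by auto
      then have "S = R" using paths_disjoint[OF R(1) S(1)] k by (metis disjoint_iff)
      then show "p = q" using k dR R(2) S(2) by (auto simp: e nth_eq_iff_index_eq)
    qed
  qed simp
  also have "{f. triangle f} \<subseteq> (\<Union>R\<in>paths. {f \<in> {hd R, last R}. triangle f})"
  proof
    fix f assume "f \<in> {f. triangle f}"
    then have f: "triangle f" "is_end f" by (auto simp: triangle_def)
    then obtain F where F: "pathin F" "last F = f" by (auto simp: is_end_def)
    then consider "F \<in> paths" | "rev F \<in> paths" using pathin_paths by blast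
    then show "f \<in> (\<Union>R\<in>paths. {f \<in> {hd R, last R}. triangle f})"
    proof cases
      case 1 then show ?thesis using F f by blast
    next
      case 2
      moreover have "hd (rev F) = f" using F by (simp add: hd_rev)
      ultimately show ?thesis using f by blast
    qed
  qed
  then have "card {f. triangle f} \<le> card (\<Union>R\<in>paths. {f \<in> {hd R, last R}. triangle f})"
    by (intro card_mono) auto
  also have "\<dots> \<le> (\<Sum>R\<in>paths. triangle_ends R)"
    unfolding triangle_ends_def by (rule card_UN_le) simp
  finally show ?thesis .
qed

section \<open>The charging argument for cycles\<close>

text \<open>Both gaps belong to the closed piece of the claimer at \<open>q\<close>, so the later of
  the two starting nodes would interrupt the other gap.\<close>

lemma gaps_upper:
  assumes "(p, q) \<in> gaps R" "(p', q) \<in> gaps R"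
  shows "\<not> p < p'"
proof
  assume "p < p'"
  obtain a b where a: "claims b (R ! q)" "same_closed a b"
      "\<And>l c. p < l \<Longrightarrow> l < q \<Longrightarrow> claims c (R ! l) \<Longrightarrow> \<not> same_closed a c"
    using assms(1) by (auto simp: gaps_def)
  obtain a' b' where a': "p' < q" "claims a' (R ! p')" "claims b' (R ! q)" "same_closed a' b'"
    using assms(2) by (auto simp: gaps_def)
  have "b' = b" using claims_unique a'(3) a(1) by blast
  then have "same_closed a a'" using a(2) a'(4) same_closed_sym same_closed_trans by blast
  then show False using a(3)[OF \<open>p < p'\<close> a'(1,2)] by simp
qed

text \<open>A gap is represented by its later node, which determines it by
  \<open>gaps_upper\<close>; the claimer of that node shows which closed piece pays.\<close>

definition gap_nodes :: "'a list \<Rightarrow> 'a set" where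
  "gap_nodes Z = {v. \<exists>R\<in>paths. \<exists>p q. (p, q) \<in> gaps R \<and> v = R ! q \<and> (\<exists>b\<in>set Z. claims b v)}"

lemma paths_position:
  assumes "R \<in> paths" "S \<in> paths" "R ! i = S ! j" "i < length R" "j < length S"
  shows "R = S \<and> i = j"
proof -
  have "R = S" using paths_disjoint[OF assms(1,2)] assms nth_mem by (metis disjoint_iff)
  then show ?thesis using assms pathin_distinct[OF paths_in[OF assms(1)]] by (simp add: nth_eq_iff_index_eq)
qed

lemma gap_balance: "(\<Sum>R\<in>paths. card (gaps R)) \<le> (\<Sum>Z\<in>cycs. card (gap_nodes Z))"
proof -
  let ?S = "SIGMA R:paths. gaps R" and ?h = "\<lambda>(R, p, q). R ! q"
  have "(\<Sum>R\<in>paths. card (gaps R)) = card ?S" by simp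
  also have "\<dots> \<le> card (\<Union>Z\<in>cycs. gap_nodes Z)"
  proof (rule card_inj_on_le)
    show "inj_on ?h ?S"
    proof (rule inj_onI)
      fix x y assume xy: "x \<in> ?S" "y \<in> ?S" "?h x = ?h y"
      obtain R p q S p' q' where e: "x = (R, p, q)" "y = (S, p', q')" by (metis prod_cases3)
      have "R \<in> paths" "S \<in> paths" "q < length R" "q' < length S" "R ! q = S ! q'"
        using xy by (auto simp: e gaps_def)
      then have "R = S" "q = q'" using paths_position by blast+
      then show "x = y" using gaps_upper[of p q R p'] gaps_upper[of p' q R p] xy(1,2) by (auto simp: e)
    qed
    show "?h ` ?S \<subseteq> (\<Union>Z\<in>cycs. gap_nodes Z)"
    proof (rule image_subsetI)
      fix x assume x: "x \<in> ?S"
      obtain R p q where e: "x = (R, p, q)" by (metis prod_cases3)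
      then have R: "R \<in> paths" "(p, q) \<in> gaps R" using x by auto
      obtain a b where b: "claims b (R ! q)" "same_closed a b" using R(2) by (auto simp: gaps_def)
      then obtain Y where "cycin Y" "b \<in> set Y" by (auto simp: same_closed_def)
      then obtain Z where Z: "Z \<in> cycs" "b \<in> set Z" using cycin_cycs by metis
      then have "R ! q \<in> gap_nodes Z" unfolding gap_nodes_def using R b by blast
      then show "?h x \<in> (\<Union>Z\<in>cycs. gap_nodes Z)" using Z e by auto
    qed
  qed simp
  also have "\<dots> \<le> (\<Sum>Z\<in>cycs. card (gap_nodes Z))" by (rule card_UN_le) simp
  finally show ?thesis .
qed

lemma cycin_shift: "cycin (x # xs) \<Longrightarrow> cycin (xs @ [x])"
  using cycin_rotate[of "x # xs" 1] by simp

lemma cycin_nbs: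
  assumes "cycin (a # ys)"
  shows "adj a (hd ys)" "adj a (last ys)" "hd ys \<noteq> last ys" "ys \<noteq> []"
proof -
  have v: "length (a # ys) \<ge> 3" "successively adj (a # ys)" "adj (last (a # ys)) a"
    using cycin_valid[OF assms] by (auto simp: valid_def)
  then obtain y z zs where ys: "ys = y # z # zs" by (cases ys; cases "tl ys") auto
  have "distinct (y # z # zs)" using cycin_distinct[OF assms] ys by simp
  moreover have "last (z # zs) \<in> set (z # zs)" by (metis last_in_set list.distinct(1))
  ultimately show "hd ys \<noteq> last ys" using ys by (auto split: if_splits)
  show "adj a (hd ys)" "adj a (last ys)" "ys \<noteq> []" using v ys adj_sym by (auto split: if_splits)
qed

section \<open>Edges leaving a closed piece\<close>

lemma leave_unique:
  assumes Z: "cycin Z" "a \<in> set Z" and v: "v \<in> nbs a" "v' \<in> nbs a" "v \<notin> set Z" "v' \<notin> set Z"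
  shows "v = v'"
proof -
  obtain Y where Y: "cycin Y" "hd Y = a" "set Y = set Z" using cycin_hd[OF Z] by blast
  moreover have "Y \<noteq> []" using Y Z by auto
  ultimately obtain ys where ys: "Y = a # ys" by (cases Y) auto
  note n = cycin_nbs[OF Y(1)[unfolded ys]]
  have "hd ys \<in> set ys" "last ys \<in> set ys" using n(4) by simp_all
  then have "hd ys \<in> set Z" "last ys \<in> set Z" unfolding Y(3)[symmetric] ys by simp_all
  then have "v \<noteq> hd ys" "v \<noteq> last ys" "v' \<noteq> hd ys" "v' \<noteq> last ys" using v by blast+
  then show ?thesis
    using nbs_third[OF adj_nbs[OF n(1)] adj_nbs[OF n(2)] v(1,2) n(3)] by blast
qed

lemma leave_claims:
  assumes Z: "cycin Z" "a \<in> set Z" and v: "adj a v" "v \<notin> set Z"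
  shows "claims a v"
proof -
  have a: "is_closed a" using Z by (auto simp: is_closed_def)
  have "\<not> is_closed v"
  proof
    assume "is_closed v"
    then obtain Y where Y: "cycin Y" "v \<in> set Y" by (auto simp: is_closed_def)
    then have "set Y \<inter> set Z = {}" using cyc_cyc[OF Y(1) Z(1)] v by auto
    then show False using closed_closed_nonadj[OF Y(1) Z(1) _ Y(2) Z(2)] v adj_sym by blast
  qed
  then obtain R where R: "pathin R" "v \<in> set R" using node_cases[of v] is_closed_def by metis
  have "\<not> is_end v" using end_closed_nonadj a v adj_sym by blast
  then have "v \<noteq> hd R" "v \<noteq> last R" using end_hd end_last R by blast+
  then obtain A c d B where AB: "R = A @ [c, v, d] @ B" using path_split3[OF R] by metis
  have "pathin ((A @ [c]) @ v # (d # B))" using R AB by simp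
  moreover have "a \<notin> set R" using path_cyc[OF R(1) Z(1)] Z(2) by blast
  then have "a \<noteq> c" "a \<noteq> d" using AB by auto
  ultimately show ?thesis using claims_at[of "A @ [c]" v "d # B" a] a v by auto
qed

definition outflow :: "'a set \<Rightarrow> 'a \<Rightarrow> real" where
  "outflow S a = (\<Sum>v\<in>-S. w a v)"

lemma inside_sum: "(\<Sum>v\<in>S. w a v) = 2 - outflow S a"
  using sum.union_disjoint[of S "-S" "w a"] w_sum[of a] by (simp add: outflow_def)

lemma outflow_nonneg: "outflow S a \<ge> 0"
  unfolding outflow_def using w_nonneg by (intro sum_nonneg) auto

lemma outflow_pos:
  assumes "outflow S a > 0"
  obtains v where "v \<in> nbs a" "v \<notin> S"
proof -
  have "\<exists>v\<in>-S. w a v \<noteq> 0"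
  proof (rule ccontr)
    assume "\<not> ?thesis"
    then have "outflow S a = 0" unfolding outflow_def by (intro sum.neutral) auto
    then show False using assms by simp
  qed
  then show ?thesis using that w_nonneg by (fastforce simp: nbs_def order_less_le)
qed

lemma outflow_eq:
  assumes Z: "cycin Z" "a \<in> set Z" and v: "v \<in> nbs a" "v \<notin> set Z"
  shows "outflow (set Z) a = w a v"
proof -
  have "w a u = 0" if "u \<in> - set Z - {v}" for u
  proof (rule ccontr)
    assume "w a u \<noteq> 0"
    then have "u \<in> nbs a" using w_nonneg[of a u] by (simp add: nbs_def)
    then show False using leave_unique[OF Z v(1) _ v(2)] that by auto
  qed
  then have "(\<Sum>u\<in>- set Z - {v}. w a u) = 0" by (intro sum.neutral) auto
  moreover have "outflow (set Z) a = w a v + (\<Sum>u\<in>- set Z - {v}. w a u)"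
    unfolding outflow_def by (rule sum.remove) (use v in auto)
  ultimately show ?thesis by simp
qed

lemma outflow_le: "cycin Z \<Longrightarrow> a \<in> set Z \<Longrightarrow> outflow (set Z) a \<le> 1"
  using outflow_pos[of "set Z" a] outflow_eq[of Z a] w_le_1 by (metis linorder_not_less order.trans zero_le_one)

text \<open>Besides the leaving edge of weight 1 there are only two edges of weight 1/2, and these
  must run along the closed piece.\<close>

lemma full_node:
  assumes Z: "cycin (a # ys)" and out: "outflow (set (a # ys)) a = 1"
  shows "w a (hd ys) = 1/2" "w a (last ys) = 1/2"
    "z \<in> set ys \<Longrightarrow> z \<noteq> hd ys \<Longrightarrow> z \<noteq> last ys \<Longrightarrow> w a z = 0"
proof -
  note n = cycin_nbs[OF Z]
  obtain v where v: "v \<in> nbs a" "v \<notin> set (a # ys)" using outflow_pos[of "set (a # ys)" a] out by auto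
  have "w a v = 1" using outflow_eq[OF Z _ v] out by simp
  moreover have "hd ys \<in> set ys" "last ys \<in> set ys" using n(4) by simp_all
  then have "v \<noteq> hd ys" "v \<noteq> last ys" using v(2) by auto
  ultimately show h: "w a (hd ys) = 1/2" "w a (last ys) = 1/2"
    using three_nbs[of v a "hd ys" "last ys"] v n adj_nbs by auto
  assume z: "z \<in> set ys" "z \<noteq> hd ys" "z \<noteq> last ys"
  have "(\<Sum>u\<in>{hd ys, last ys, z}. w a u) \<le> (\<Sum>u\<in>set (a # ys). w a u)"
    using z n(4) w_nonneg by (intro sum_mono2) auto
  also have "\<dots> = 1" using inside_sum[where S="set (a # ys)" and a=a] out by simp
  finally show "w a z = 0" using h z n(3) w_nonneg[of a z] by simp
qed

text \<open>Both other nodes offer \<open>c\<close> only weight 1/2, while it needs 2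
  inside.\<close>

lemma no_two_of_three:
  assumes Z: "cycin [a, b, c]"
    and o: "outflow {a, b, c} a = 1" "outflow {a, b, c} b = 1" "outflow {a, b, c} c = 0"
  shows False
proof -
  have d: "distinct [a, b, c]" using cycin_distinct[OF Z] .
  have s: "set [b, c, a] = {a, b, c}" by auto
  have "w a c = 1/2" using full_node[OF Z] o by simp
  moreover have "w b c = 1/2" using full_node[of b "[c, a]"] cycin_shift[OF Z] o s by simp
  moreover have "w c a + w c b = 2"
    using inside_sum[where S="{a, b, c}" and a=c] o d by (simp add: w_irrefl)
  ultimately show False using w_sym[of c a] w_sym[of c b] by simp
qed

text \<open>Neighbouring exits leave \<open>c\<close> at most 3/2 inside; opposite exits turn the
  closed piece into a 4-cycle of weight 1/2.\<close>

lemma no_two_of_four: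
  assumes Z: "cycin [a, b, c, d]" and o: "outflow {a, b, c, d} a = 1"
    and o': "outflow {a, b, c, d} b = 1 \<and> outflow {a, b, c, d} c = 0 \<or> outflow {a, b, c, d} c = 1"
  shows False
proof -
  have dd: "distinct [a, b, c, d]" using cycin_distinct[OF Z] .
  have s: "set [b, c, d, a] = {a, b, c, d}" "set [c, d, a, b] = {a, b, c, d}" by auto
  have Z': "cycin [b, c, d, a]" "cycin [c, d, a, b]"
    using cycin_shift[OF Z] cycin_shift[of b "[c, d, a]"] by simp_all
  have a: "w a b = 1/2" "w a d = 1/2" "w a c = 0" using full_node[OF Z] o dd by auto
  from o' show False
  proof
    assume o1: "outflow {a, b, c, d} b = 1 \<and> outflow {a, b, c, d} c = 0"
    have b: "w b c = 1/2" using full_node(1)[OF Z'(1)] o1 s by simp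
    have "w c a + w c b + w c d = 2"
      using inside_sum[where S="{a, b, c, d}" and a=c] o1 dd by (simp add: w_irrefl)
    then show False using a b w_sym[of c a] w_sym[of c b] w_le_1[of c d] by simp
  next
    assume o2: "outflow {a, b, c, d} c = 1"
    have "w c d = 1/2" "w c b = 1/2" using full_node[OF Z'(2)] o2 s dd by auto
    then show False using no_half_quad[of a b c d] a w_sym[of b c] w_sym[of d a] dd by auto
  qed
qed

text \<open>For neighbouring exits the degree sums force \<open>w c e = 1/2\<close>, and
  \<open>a\<close>, \<open>b\<close>, \<open>c\<close>, \<open>e\<close> form a 4-cycle of weight
  1/2. For exits at distance two they give \<open>b\<close> four neighbours.\<close>

lemma no_two_of_five:
  assumes Z: "cycin [a, b, c, d, e]" and o: "outflow {a, b, c, d, e} a = 1"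
      "outflow {a, b, c, d, e} d = 0" "outflow {a, b, c, d, e} e = 0"
    and o': "outflow {a, b, c, d, e} b = 1 \<and> outflow {a, b, c, d, e} c = 0 \<or>
      outflow {a, b, c, d, e} c = 1 \<and> outflow {a, b, c, d, e} b = 0"
  shows False
proof -
  have dd: "distinct [a, b, c, d, e]" using cycin_distinct[OF Z] .
  have s: "set [b, c, d, e, a] = {a, b, c, d, e}" "set [c, d, e, a, b] = {a, b, c, d, e}" by auto
  have Z': "cycin [b, c, d, e, a]" "cycin [c, d, e, a, b]"
    using cycin_shift[OF Z] cycin_shift[of b "[c, d, e, a]"] by simp_all
  have a: "w a b = 1/2" "w a e = 1/2" "w a c = 0" "w a d = 0" using full_node[OF Z] o dd by auto
  have sums: "w d a + w d b + w d c + w d e = 2" "w e a + w e b + w e c + w e d = 2"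
    using inside_sum[where S="{a, b, c, d, e}" and a=d] inside_sum[where S="{a, b, c, d, e}" and a=e] o dd
    by (simp_all add: w_irrefl)
  note sym = w_sym[of b a] w_sym[of c a] w_sym[of d a] w_sym[of e a] w_sym[of c b] w_sym[of d b] w_sym[of e b]
    w_sym[of d c] w_sym[of e c] w_sym[of e d]
  from o' show False
  proof
    assume o1: "outflow {a, b, c, d, e} b = 1 \<and> outflow {a, b, c, d, e} c = 0"
    have b: "w b c = 1/2" "w b d = 0" "w b e = 0" using full_node[OF Z'(1)] o1 s dd by auto
    have "w c a + w c b + w c d + w c e = 2"
      using inside_sum[where S="{a, b, c, d, e}" and a=c] o1 dd by (simp add: w_irrefl)
    then have "w c e = 1/2" using a b sums sym w_le_1[of c d] w_le_1[of d e] by linarith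
    then show False using no_half_quad[of a b c e] a b sym dd by auto
  next
    assume o2: "outflow {a, b, c, d, e} c = 1 \<and> outflow {a, b, c, d, e} b = 0"
    have c: "w c d = 1/2" "w c b = 1/2" "w c e = 0" using full_node[OF Z'(2)] o2 s dd by auto
    have "w b a + w b c + w b d + w b e = 2"
      using inside_sum[where S="{a, b, c, d, e}" and a=b] o2 dd by (simp add: w_irrefl)
    then have "w b d = 1/2" "w b e = 1/2" using a c sums sym by linarith+
    then have "{a, c, d, e} \<subseteq> nbs b" using a c sym by (auto simp: nbs_def)
    then have "card {a, c, d, e} \<le> 3" using card_mono[of "nbs b" "{a, c, d, e}"] card_nbs_le[of b] by simp
    then show False using dd by simp
  qed
qed

context
  fixes Z
  assumes Z: "cycin Z" and proper: "set Z \<noteq> UNIV"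
begin

abbreviation (input) "out \<equiv> outflow (set Z)"

definition leaving :: "'a set" where
  "leaving = {a \<in> set Z. outflow (set Z) a > 0}"

definition claiming :: "'a set" where
  "claiming = {a \<in> set Z. \<exists>v. claims a v}"

lemma len_Z: "length Z \<ge> 3"
  using cycin_valid[OF Z] by (simp add: valid_def)

lemma out_sum: "(\<Sum>a\<in>set Z. out a) \<ge> 2"
  unfolding outflow_def using w_cut[of "set Z"] proper len_Z by fastforce

lemma out_sum_leaving: "(\<Sum>a\<in>set Z. out a) = (\<Sum>a\<in>leaving. out a)"
  using outflow_nonneg by (intro sum.mono_neutral_right) (auto simp: leaving_def order_less_le)

lemma leaving_card: "card leaving \<ge> 2"
proof -
  have "(\<Sum>a\<in>leaving. out a) \<le> (\<Sum>a\<in>leaving. 1)"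
    using outflow_le[OF Z] by (intro sum_mono) (auto simp: leaving_def)
  then show ?thesis using out_sum out_sum_leaving by simp
qed

lemma leaving_two:
  assumes "card leaving = 2"
  obtains a b where "a \<in> set Z" "b \<in> set Z" "a \<noteq> b" "out a = 1" "out b = 1"
    "\<And>c. c \<in> set Z \<Longrightarrow> c \<noteq> a \<Longrightarrow> c \<noteq> b \<Longrightarrow> out c = 0"
proof -
  obtain a b where ab: "leaving = {a, b}" "a \<noteq> b" using assms by (auto simp: card_2_iff)
  then have in_Z: "a \<in> set Z" "b \<in> set Z" by (auto simp: leaving_def)
  have "out a + out b \<ge> 2" using out_sum out_sum_leaving ab by simp
  then have "out a = 1" "out b = 1" using outflow_le[OF Z in_Z(1)] outflow_le[OF Z in_Z(2)] by linarith+
  moreover have "out c = 0" if "c \<in> set Z" "c \<noteq> a" "c \<noteq> b" for c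
    using that ab(1) outflow_nonneg[of "set Z" c] by (force simp: leaving_def)
  ultimately show ?thesis using that in_Z ab(2) by blast
qed

text \<open>Two leaving nodes must both have outflow 1 to fill the cut. Up to rotation they are
  neighbours or at distance two, and both cases have just been excluded.\<close>

lemma leaving_three:
  assumes "length Z \<le> 5"
  shows "card leaving \<ge> 3"
proof (rule ccontr)
  assume "\<not> ?thesis"
  then have "card leaving = 2" using leaving_card by simp
  then obtain a b where ab: "a \<in> set Z" "b \<in> set Z" "a \<noteq> b" "out a = 1" "out b = 1"
    "\<And>c. c \<in> set Z \<Longrightarrow> c \<noteq> a \<Longrightarrow> c \<noteq> b \<Longrightarrow> out c = 0"
    using leaving_two by metis
  obtain Y where Y: "cycin Y" "hd Y = a" "set Y = set Z" using cycin_hd[OF Z ab(1)] by blast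
  have dY: "distinct Y" "distinct Z" using cycin_distinct Y(1) Z by blast+
  then have lY: "length Y = length Z" using Y(3) by (metis distinct_card)
  obtain ys where ys: "Y = a # ys" using Y lY len_Z by (cases Y) auto
  have zero: "outflow (set Z) c = 0" if "c \<in> set ys" "c \<noteq> b" for c
    using ab(6)[of c] that Y(3) ys dY by auto
  have "b \<in> set (a # ys)" using ab(2) unfolding Y(3)[symmetric] ys .
  then have b: "b \<in> set ys" using ab(3) by simp
  consider "length ys = 2" | "length ys = 3" | "length ys = 4" using lY len_Z assms ys by force
  then show False
  proof cases
    case 1
    then obtain p q where pq: "ys = [p, q]" by (auto simp: length_Suc_conv numeral_2_eq_2)
    have S: "set Z = {a, p, q}" "set Z = {q, a, p}" using Y(3) ys pq by auto
    have C: "cycin [a, p, q]" "cycin [q, a, p]"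
      using Y(1) ys pq cycin_shift[of p "[q, a]"] cycin_shift[of a "[p, q]"] by simp_all
    consider "b = p" | "b = q" using b pq by auto
    then show False
    proof cases
      case 1
      then show False using no_two_of_three[OF C(1)] ab(4,5) zero[of q] dY ys pq S(1) by auto
    next
      case 2
      then show False using no_two_of_three[OF C(2)] ab(4,5) zero[of p] dY ys pq S(2) by auto
    qed
  next
    case 2
    then obtain p q r where pq: "ys = [p, q, r]" by (auto simp: length_Suc_conv numeral_3_eq_3)
    have S: "set Z = {a, p, q, r}" "set Z = {r, a, p, q}" using Y(3) ys pq by auto
    have C: "cycin [a, p, q, r]" "cycin [r, a, p, q]"
      using Y(1) ys pq cycin_shift[of q "[r, a, p]"] cycin_shift[of p "[q, r, a]"] cycin_shift[of a "[p, q, r]"]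
      by simp_all
    consider "b = p" | "b = q" | "b = r" using b pq by auto
    then show False
    proof cases
      case 1
      then show False using no_two_of_four[OF C(1)] ab(4,5) zero[of q] dY ys pq S(1) by auto
    next
      case 2
      then show False using no_two_of_four[OF C(1)] ab(4,5) S(1) by auto
    next
      case 3
      then show False using no_two_of_four[OF C(2)] ab(4,5) zero[of p] dY ys pq S(2) by auto
    qed
  next
    case 3
    then obtain p q r s where pq: "ys = [p, q, r, s]" by (auto simp: length_Suc_conv eval_nat_numeral)
    have S: "set Z = {a, p, q, r, s}" "set Z = {s, a, p, q, r}" "set Z = {r, s, a, p, q}" using Y(3) ys pq by auto
    have C: "cycin [a, p, q, r, s]" "cycin [s, a, p, q, r]" "cycin [r, s, a, p, q]"
      using Y(1) ys pq cycin_shift[of r "[s, a, p, q]"] cycin_shift[of q "[r, s, a, p]"]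
        cycin_shift[of p "[q, r, s, a]"] cycin_shift[of a "[p, q, r, s]"]
      by simp_all
    have dd: "distinct [a, p, q, r, s]" using dY ys pq by simp
    consider "b = p" | "b = q" | "b = r" | "b = s" using b pq by auto
    then show False
    proof cases
      case 1
      have "out q = 0" "out r = 0" "out s = 0" using zero pq dd 1 by auto
      then show False using no_two_of_five[OF C(1)] ab(4,5) 1 S(1) by auto
    next
      case 2
      have "out p = 0" "out r = 0" "out s = 0" using zero pq dd 2 by auto
      then show False using no_two_of_five[OF C(1)] ab(4,5) 2 S(1) by auto
    next
      case 3
      have "out p = 0" "out q = 0" "out s = 0" using zero pq dd 3 by auto
      then show False using no_two_of_five[OF C(3)] ab(4,5) 3 S(3) by auto
    next
      case 4
      have "out p = 0" "out q = 0" "out r = 0" using zero pq dd 4 by auto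
      then show False using no_two_of_five[OF C(2)] ab(4,5) 4 S(2) by auto
    qed
  qed
qed

lemma claims_leave: "a \<in> set Z \<Longrightarrow> claims a v \<Longrightarrow> v \<notin> set Z \<and> v \<in> nbs a"
  using claimed_not_closed[of v] Z claims_adj adj_nbs by (auto simp: claimed_def is_closed_def)

lemma claims_one: "a \<in> set Z \<Longrightarrow> claims a v \<Longrightarrow> claims a v' \<Longrightarrow> v = v'"
  using leave_unique[OF Z] claims_leave by blast

lemma claiming_leaving: "claiming \<subseteq> leaving"
proof
  fix a assume "a \<in> claiming"
  then obtain v where v: "a \<in> set Z" "claims a v" by (auto simp: claiming_def)
  then have "outflow (set Z) a = w a v" "w a v > 0"
    using outflow_eq[OF Z v(1)] claims_leave[OF v] by (auto simp: nbs_def)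
  then show "a \<in> leaving" using v by (simp add: leaving_def)
qed

lemma claiming_worth: "a \<in> claiming \<Longrightarrow> worth a \<ge> 2"
proof -
  assume "a \<in> claiming"
  then obtain v where v: "claims a v" by (auto simp: claiming_def)
  then have "share a v \<ge> 2" using w_nonneg by (simp add: share_def)
  moreover have "v \<in> nbs a" using v claims_adj adj_nbs by blast
  ultimately show ?thesis using share_sum[of "{v}" a] by simp
qed

lemma nonclaiming_worth:
  assumes "a \<in> set Z" "a \<notin> claiming"
  shows "worth a \<ge> 5 * out a"
proof (cases "out a > 0")
  case True
  then obtain v where v: "v \<in> nbs a" "v \<notin> set Z" using outflow_pos by blast
  have "k a v"
  proof (rule ccontr)
    assume "\<not> k a v"
    then have "adj a v" using v by (simp add: adj_def nbs_def)
    then have "claims a v" using leave_claims[OF Z assms(1) _ v(2)] by simp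
    then show False using assms by (auto simp: claiming_def)
  qed
  then have "share a v \<ge> 5 * out a" using outflow_eq[OF Z assms(1) v] by (simp add: share_def)
  then show ?thesis using share_sum[of "{v}" a] v by simp
next
  case False
  then show ?thesis using outflow_nonneg[of "set Z" a] worth_nonneg[of a] by simp
qed

text \<open>A leaving node that claims nothing leaves by an edge of cost 2 and weight at least 1/2,
  which gives 5/2.\<close>

lemma piece_worth_sum:
  "2 * real (card claiming) + 5/2 * real (card (leaving - claiming)) \<le> (\<Sum>a\<in>set Z. worth a)"
proof -
  have "real (card claiming) * 2 \<le> (\<Sum>a\<in>claiming. worth a)"
    using claiming_worth by (intro sum_bounded_below) auto
  moreover have "real (card (leaving - claiming)) * (5/2) \<le> (\<Sum>a\<in>leaving - claiming. worth a)"
  proof (rule sum_bounded_below)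
    fix a assume a: "a \<in> leaving - claiming"
    then have aZ: "a \<in> set Z" "out a > 0" by (auto simp: leaving_def)
    then obtain v where v: "v \<in> nbs a" "v \<notin> set Z" using outflow_pos by blast
    then show "5/2 \<le> worth a" using nonclaiming_worth[OF aZ(1)] a outflow_eq[OF Z aZ(1) v] nbs_half[OF v(1)] by auto
  qed
  moreover have "(\<Sum>a\<in>claiming. worth a) + (\<Sum>a\<in>leaving - claiming. worth a) = (\<Sum>a\<in>leaving. worth a)"
    using claiming_leaving by (metis add.commute sum.subset_diff finite)
  moreover have "(\<Sum>a\<in>leaving. worth a) \<le> (\<Sum>a\<in>set Z. worth a)"
    using worth_nonneg by (intro sum_mono2) (auto simp: leaving_def)
  ultimately show ?thesis by linarith
qed

lemma gap_nodeE:
  assumes "v \<in> gap_nodes Z"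
  obtains R p q a b where "R \<in> paths" "p < q" "q < length R" "v = R ! q" "claims a (R ! p)" "claims b v"
    "a \<in> set Z" "b \<in> set Z" "a \<noteq> b" "\<not> cyc_nb a b"
proof -
  obtain R p q b where R: "R \<in> paths" "(p, q) \<in> gaps R" "v = R ! q" "b \<in> set Z" "claims b v"
    using assms by (auto simp: gap_nodes_def)
  then obtain a b' where a: "p < q" "q < length R" "claims a (R ! p)" "claims b' (R ! q)" "same_closed a b'" "\<not> cyc_nb a b'"
    by (auto simp: gaps_def)
  have b': "b' = b" using claims_unique a(4) R(3,5) by blast
  have aZ: "a \<in> set Z" using a(5) cyc_cyc[OF _ Z] R(4) b' by (auto simp: same_closed_def)
  have "R ! p \<noteq> R ! q" using pathin_distinct[OF paths_in[OF R(1)]] a(1,2) by (simp add: nth_eq_iff_index_eq)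
  then have "a \<noteq> b" using claims_one[OF aZ a(3)] R(3,5) by auto
  then show ?thesis using that[of R p q a b] R a b' aZ by blast
qed

text \<open>The first node that the closed piece claims on some path is not the later node of a
  gap.\<close>

lemma gap_nodes_less:
  assumes "claiming \<noteq> {}"
  shows "card (gap_nodes Z) < card claiming"
proof -
  let ?K = "{v. \<exists>a\<in>set Z. claims a v}"
  define P where "P R i \<longleftrightarrow> R \<in> paths \<and> i < length R \<and> (\<exists>a\<in>set Z. claims a (R ! i))" for R i
  obtain a v where av: "a \<in> set Z" "claims a v" using assms by (auto simp: claiming_def)
  obtain R i where "R \<in> paths" "i < length R" "R ! i = v"
    using claimed_position[of v] av(2) by (auto simp: claimed_def)
  then have ex: "\<exists>i. P R i" using av by (auto simp: P_def)
  define j where "j = (LEAST i. P R i)"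
  have j: "P R j" unfolding j_def using LeastI_ex[OF ex] .
  have no: "\<not> P R l" if "l < j" for l using not_less_Least that unfolding j_def by blast
  have "R ! j \<notin> gap_nodes Z"
  proof
    assume "R ! j \<in> gap_nodes Z"
    then obtain S p q a where S: "S \<in> paths" "p < q" "q < length S" "R ! j = S ! q" "claims a (S ! p)" "a \<in> set Z"
      by (rule gap_nodeE)
    then have "R = S \<and> j = q" using paths_position j by (auto simp: P_def)
    then have "P R p" using S by (auto simp: P_def)
    then show False using no S \<open>R = S \<and> j = q\<close> by blast
  qed
  moreover have "R ! j \<in> ?K" using j by (auto simp: P_def)
  moreover have "gap_nodes Z \<subseteq> ?K" by (auto simp: gap_nodes_def)
  ultimately have "card (gap_nodes Z) < card ?K" by (intro psubset_card_mono) auto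
  also have "card ?K \<le> card claiming"
  proof (rule surj_card_le)
    show "?K \<subseteq> (\<lambda>a. THE v. claims a v) ` claiming"
    proof
      fix v assume "v \<in> ?K"
      then obtain a where a: "a \<in> set Z" "claims a v" by blast
      then have "(THE v. claims a v) = v" using claims_one by blast
      moreover have "a \<in> claiming" using a by (auto simp: claiming_def)
      ultimately show "v \<in> (\<lambda>a. THE v. claims a v) ` claiming" by force
    qed
  qed simp
  finally show ?thesis .
qed

lemma gap_nodes_three:
  assumes "length Z = 3"
  shows "gap_nodes Z = {}"
proof (rule equals0I)
  fix v assume "v \<in> gap_nodes Z"
  then obtain a b where ab: "a \<in> set Z" "b \<in> set Z" "a \<noteq> b" "\<not> cyc_nb a b" by (rule gap_nodeE)
  obtain p q r where Zp: "Z = [p, q, r]" using assms by (auto simp: length_Suc_conv numeral_3_eq_3)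
  have "cycin [p, q, r]" "cycin [q, r, p]" "cycin [r, p, q]"
    using Z Zp cycin_shift[of p "[q, r]"] cycin_shift[of q "[r, p]"] by simp_all
  then have "cyc_nb p r" "cyc_nb q p" "cyc_nb r q" unfolding cyc_nb_def by force+
  then show False using ab Zp cyc_nb_sym by auto
qed

text \<open>Non-neighbours on four nodes are opposite, and three claiming nodes contain only one
  opposite pair. Its two nodes claim one node each, and only the later of these can end a
  gap.\<close>

lemma gap_nodes_four:
  assumes "length Z = 4" "card claiming = 3"
  shows "card (gap_nodes Z) \<le> 1"
proof -
  obtain p q r s where Zp: "Z = [p, q, r, s]" using assms by (auto simp: length_Suc_conv eval_nat_numeral)
  have "cycin [p, q, r, s]" "cycin [q, r, s, p]" "cycin [r, s, p, q]" "cycin [s, p, q, r]"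
    using Z Zp cycin_shift[of p "[q, r, s]"] cycin_shift[of q "[r, s, p]"] cycin_shift[of r "[s, p, q]"] by simp_all
  then have nb: "cyc_nb p s" "cyc_nb q p" "cyc_nb r q" "cyc_nb s r" unfolding cyc_nb_def by force+
  have opp: "{a, b} = {p, r} \<or> {a, b} = {q, s}" if "a \<in> set Z" "b \<in> set Z" "a \<noteq> b" "\<not> cyc_nb a b" for a b
    using that nb cyc_nb_sym unfolding Zp by auto
  have "v = v'" if v: "v \<in> gap_nodes Z" "v' \<in> gap_nodes Z" for v v'
  proof (rule ccontr)
    assume n: "v \<noteq> v'"
    obtain R i j a b where R: "R \<in> paths" "i < j" "j < length R" "v = R ! j" "claims a (R ! i)" "claims b v"
      "a \<in> set Z" "b \<in> set Z" "a \<noteq> b" "\<not> cyc_nb a b" using v(1) by (rule gap_nodeE)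
    obtain R' i' j' a' b' where R': "R' \<in> paths" "i' < j'" "j' < length R'" "v' = R' ! j'" "claims a' (R' ! i')" "claims b' v'"
      "a' \<in> set Z" "b' \<in> set Z" "a' \<noteq> b'" "\<not> cyc_nb a' b'" using v(2) by (rule gap_nodeE)
    have bb: "b \<noteq> b'" using claims_one[OF R(8,6)] R'(6) n by auto
    have sub: "{a, b} \<union> {a', b'} \<subseteq> claiming" using R R' by (auto simp: claiming_def)
    have "{a, b} = {a', b'}"
    proof (rule ccontr)
      assume "{a, b} \<noteq> {a', b'}"
      then have "{a, b} \<union> {a', b'} = {p, q, r, s}" using opp[OF R(7-10)] opp[OF R'(7-10)] by auto
      then have "card {p, q, r, s} \<le> card claiming" using card_mono[OF _ sub] by simp
      moreover have "card {p, q, r, s} = 4" using cycin_distinct[OF Z] Zp by simp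
      ultimately show False using assms(2) by simp
    qed
    then have "a = b'" "a' = b" using bb by (auto simp: doubleton_eq_iff)
    then have "R ! i = R' ! j'" "R' ! i' = R ! j"
      using claims_one[OF R(7,5)] claims_one[OF R'(7,5)] R R' by auto
    then have "R = R' \<and> i = j'" "R' = R \<and> i' = j"
      using paths_position[OF R(1) R'(1)] paths_position[OF R'(1) R(1)] R R' by auto
    then show False using R(2) R'(2) by simp
  qed
  then show ?thesis by (metis card_le_Suc0_iff_eq One_nat_def finite)
qed

text \<open>If nothing is claimed, all leaving edges have cost 2 and the outflow of at least 2 is
  worth 10. Otherwise \<open>gap_nodes_less\<close> suffices from length 5 on, and for length 4
  unless exactly three nodes leave and all of them claim. That case and length 3 need the sharper
  bounds on gaps.\<close>

lemma piece_worth: "9 + real (card (gap_nodes Z)) \<le> real (length Z) + (\<Sum>a\<in>set Z. worth a)"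
proof (cases "claiming = {}")
  case True
  have "gap_nodes Z = {}" using True by (auto simp: gap_nodes_def claiming_def)
  moreover have "(\<Sum>a\<in>set Z. 5 * out a) \<le> (\<Sum>a\<in>set Z. worth a)"
    using nonclaiming_worth True by (intro sum_mono) auto
  then have "10 \<le> (\<Sum>a\<in>set Z. worth a)" using out_sum by (simp flip: sum_distrib_left)
  ultimately show ?thesis by simp
next
  case False
  define l1 l2 where "l1 = card claiming" and "l2 = card (leaving - claiming)"
  have fin: "finite claiming" by simp
  have l: "l1 + l2 = card leaving"
    unfolding l1_def l2_def using claiming_leaving card_Diff_subset[OF fin claiming_leaving]
      card_mono[OF _ claiming_leaving] by simp
  have g: "card (gap_nodes Z) + 1 \<le> l1" using gap_nodes_less[OF False] by (simp add: l1_def)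
  have s: "2 * real l1 + 5/2 * real l2 \<le> (\<Sum>a\<in>set Z. worth a)" using piece_worth_sum by (simp add: l1_def l2_def)
  have l2: "l1 + l2 \<ge> 2" "length Z \<le> 5 \<Longrightarrow> l1 + l2 \<ge> 3" using leaving_card leaving_three l by auto
  consider "length Z = 3" | "length Z = 4" | "length Z = 5" | "length Z \<ge> 6" using len_Z by linarith
  then show ?thesis
  proof cases
    case 1
    then show ?thesis using s l2 gap_nodes_three by simp
  next
    case 2
    show ?thesis
    proof (cases "l1 = 3 \<and> l2 = 0")
      case True
      then show ?thesis using gap_nodes_four[OF 2] s 2 by (simp add: l1_def)
    next
      case False
      then have "l1 \<ge> 4 \<or> l2 \<ge> 1" using l2(2) 2 by linarith
      then show ?thesis using s g l2(2) 2 by linarith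
    qed
  qed (use s g l2 in linarith)+
qed

end

text \<open>Ends and nodes of closed pieces are different, so no \<open>worth\<close> is spent
  twice. An open piece yields 1 + 8 up to triangles and gaps, which balance only in the sum over all
  pieces.\<close>

theorem cover_bound:
  assumes "\<And>Z. Z \<in> cycs \<Longrightarrow> set Z \<noteq> UNIV"
  shows "9 * real (size Q) \<le> real CARD('a) + (\<Sum>v\<in>UNIV. phi v)"
proof -
  define h where "h R = {hd R, last R}" for R :: "'a list"
  have hs: "h R \<subseteq> set R" if "R \<in> paths" for R using pathin_valid[OF paths_in[OF that]] by (auto simp: h_def)
  have w1: "(\<Sum>f\<in>(\<Union>R\<in>paths. h R). worth f) = (\<Sum>R\<in>paths. \<Sum>f\<in>h R. worth f)"
  proof (rule sum.UNION_disjoint)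
    show "\<forall>R\<in>paths. \<forall>S\<in>paths. R \<noteq> S \<longrightarrow> h R \<inter> h S = {}" using paths_disjoint hs by blast
  qed (auto simp: h_def)
  have w2: "(\<Sum>f\<in>(\<Union>Z\<in>cycs. set Z). worth f) = (\<Sum>Z\<in>cycs. \<Sum>f\<in>set Z. worth f)"
    using cycs_disjoint by (intro sum.UNION_disjoint) auto
  have "(\<Union>R\<in>paths. h R) \<inter> (\<Union>Z\<in>cycs. set Z) = {}" using path_cyc paths_in cycs_in hs by blast
  then have "(\<Sum>R\<in>paths. \<Sum>f\<in>h R. worth f) + (\<Sum>Z\<in>cycs. \<Sum>f\<in>set Z. worth f)
      = (\<Sum>f\<in>(\<Union>R\<in>paths. h R) \<union> (\<Union>Z\<in>cycs. set Z). worth f)"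
    unfolding w1[symmetric] w2[symmetric] by (intro sum.union_disjoint[symmetric]) (auto simp: h_def)
  also have "\<dots> \<le> (\<Sum>f\<in>UNIV. worth f)" using worth_nonneg by (intro sum_mono2) auto
  finally have ww: "(\<Sum>R\<in>paths. \<Sum>f\<in>h R. worth f) + (\<Sum>Z\<in>cycs. \<Sum>f\<in>set Z. worth f) \<le> (\<Sum>f\<in>UNIV. worth f)" .
  have "(\<Sum>R\<in>paths. 9 + real (triangle_ends R) - real (card (end_triangles R)) - real (card (gaps R)))
    \<le> (\<Sum>R\<in>paths. (1 + real (card (unclaimed_edges R)) - real (card (claimed_edges R))) + (\<Sum>f\<in>h R. worth f))"
  proof (rule sum_mono)
    fix R assume R: "R \<in> paths"
    have "card (claimed_edges R) \<le> card (claimed_edges R - end_triangles R) + card (end_triangles R)"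
      using card_Un_le[of "claimed_edges R - end_triangles R" "end_triangles R"]
        card_mono[of "(claimed_edges R - end_triangles R) \<union> end_triangles R" "claimed_edges R"] by auto
    then show "9 + real (triangle_ends R) - real (card (end_triangles R)) - real (card (gaps R))
      \<le> (1 + real (card (unclaimed_edges R)) - real (card (claimed_edges R))) + (\<Sum>f\<in>h R. worth f)"
      using path_count[OF paths_in[OF R]] ends_worth[OF R] unfolding h_def by linarith
  qed
  then have p: "9 * real (card paths) + real (\<Sum>R\<in>paths. triangle_ends R) - real (\<Sum>R\<in>paths. card (end_triangles R))
      - real (\<Sum>R\<in>paths. card (gaps R))
    \<le> (\<Sum>R\<in>paths. 1 + real (card (unclaimed_edges R)) - real (card (claimed_edges R)))
      + (\<Sum>R\<in>paths. \<Sum>f\<in>h R. worth f)"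
    by (simp add: sum.distrib sum_subtractf)
  have "(\<Sum>Z\<in>cycs. 9 + real (card (gap_nodes Z))) \<le> (\<Sum>Z\<in>cycs. real (length Z) + (\<Sum>a\<in>set Z. worth a))"
    using piece_worth cycs_in assms by (intro sum_mono) blast
  then have c: "9 * real (card cycs) + real (\<Sum>Z\<in>cycs. card (gap_nodes Z))
     \<le> (\<Sum>Z\<in>cycs. real (length Z)) + (\<Sum>Z\<in>cycs. \<Sum>a\<in>set Z. worth a)"
    by (simp add: sum.distrib)
  have "real (size Q) = real (card paths) + real (card cycs)" using size_Q by simp
  moreover have "real (\<Sum>R\<in>paths. card (end_triangles R)) \<le> real (\<Sum>R\<in>paths. triangle_ends R)"
    "real (\<Sum>R\<in>paths. card (gaps R)) \<le> real (\<Sum>Z\<in>cycs. card (gap_nodes Z))"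
    using triangle_balance gap_balance by (simp_all only: of_nat_le_iff)
  ultimately show ?thesis using ledger ww p c by argo
qed

end

section \<open>Extreme points\<close>

lemma edges_iff: "{u, v} \<in> edges \<longleftrightarrow> u \<noteq> v"
  by (cases "u = v") (auto simp: edges_def)

lemma edgesE:
  assumes "e \<in> edges" obtains u v where "e = {u, v}" "u \<noteq> v"
  using assms unfolding edges_def by (auto simp: card_2_iff)

lemma cut_iff: "{u, v} \<in> cut {i} \<longleftrightarrow> u \<noteq> v \<and> (i = u \<or> i = v)"
proof -
  have "{u, v} \<inter> {i} = (if i = u \<or> i = v then {i} else {})" by auto
  then show ?thesis by (auto simp: cut_def edges_iff)
qed

lemma cut_single: "cut {i} = {e \<in> edges. i \<in> e}"
proof -
  have "e \<inter> {i} = (if i \<in> e then {i} else {})" for e by auto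
  then show ?thesis by (auto simp: cut_def)
qed

lemma sum_cut:
  fixes g :: "'v::finite set \<Rightarrow> 'b::comm_monoid_add"
  shows "(\<Sum>e\<in>cut S. g e) = (\<Sum>u\<in>S. \<Sum>v\<in>-S. g {u, v})"
proof -
  have bij: "bij_betw (\<lambda>(u, v). {u, v}) (S \<times> -S) (cut S)"
      unfolding bij_betw_def
    proof
      show "inj_on (\<lambda>(u, v). {u, v}) (S \<times> -S)"
        by (auto simp: inj_on_def doubleton_eq_iff)
      show "(\<lambda>(u, v). {u, v}) ` (S \<times> -S) = cut S"
      proof (intro equalityI subsetI)
        fix e assume "e \<in> (\<lambda>(u, v). {u, v}) ` (S \<times> -S)"
        then obtain u v where e: "e = {u, v}" "u \<in> S" "v \<notin> S" by auto
        then have "e \<inter> S = {u}" "u \<noteq> v" by auto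
        then show "e \<in> cut S" using e by (simp add: cut_def edges_iff)
      next
        fix e assume e: "e \<in> cut S"
        then obtain u v where uv: "e = {u, v}" "u \<noteq> v" using edgesE by (auto simp: cut_def)
        obtain z where "e \<inter> S = {z}" using e by (auto simp: cut_def card_1_singleton_iff)
        then have z: "x \<in> S \<longleftrightarrow> x = z" if "x \<in> e" for x using that by blast
        have "z \<in> e" using \<open>e \<inter> S = {z}\<close> by blast
        then obtain y where "e = {z, y}" "z \<noteq> y" using uv by auto
        then have "(z, y) \<in> S \<times> -S" "e = (case (z, y) of (u, v) \<Rightarrow> {u, v})" using z by auto
        then show "e \<in> (\<lambda>(u, v). {u, v}) ` (S \<times> -S)" by (rule rev_image_eqI)
      qed
    qed
  have "(\<Sum>u\<in>S. \<Sum>v\<in>-S. g {u, v}) = (\<Sum>p\<in>S \<times> -S. g (case p of (u, v) \<Rightarrow> {u, v}))"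
    by (simp add: sum.cartesian_product case_prod_unfold)
  also have "\<dots> = (\<Sum>e\<in>cut S. g e)" by (rule sum.reindex_bij_betw[OF bij])
  finally show ?thesis by simp
qed

lemma sum_cut_single:
  fixes g :: "'v::finite set \<Rightarrow> 'b::comm_monoid_add"
  shows "(\<Sum>e\<in>cut {i}. g e) = (\<Sum>v\<in>-{i}. g {i, v})"
  by (simp add: sum_cut)

lemma sum_edges:
  fixes g :: "'v::finite set \<Rightarrow> real"
  shows "(\<Sum>u\<in>UNIV. \<Sum>v\<in>-{u}. g {u, v}) = 2 * (\<Sum>e\<in>edges. g e)"
proof -
  have "(\<Sum>u\<in>UNIV. \<Sum>v\<in>-{u}. g {u, v}) = (\<Sum>u\<in>UNIV. \<Sum>e\<in>edges. if u \<in> e then g e else 0)"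
    unfolding sum_cut_single[symmetric] cut_single by (simp add: sum.inter_filter)
  also have "\<dots> = (\<Sum>e\<in>edges. \<Sum>u\<in>UNIV. if u \<in> e then g e else 0)" by (rule sum.swap)
  also have "\<dots> = (\<Sum>e\<in>edges. 2 * g e)"
    by (intro sum.cong refl) (auto simp: sum.If_cases edges_def)
  finally show ?thesis by (simp add: sum_distrib_left)
qed

text \<open>Small steps along \<open>y\<close> and \<open>-y\<close> stay in the polytope, so
  \<open>x\<close> would be the midpoint of a segment in it.\<close>

lemma extreme_zero:
  fixes x y :: "real ^ ('v::finite set)"
  assumes x: "F2M x" and supp: "\<And>e. y $ e \<noteq> 0 \<Longrightarrow> e \<in> edges \<and> 0 < x $ e \<and> x $ e < 1"
    and bal: "\<And>i. (\<Sum>e\<in>cut {i}. y $ e) = 0"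
  shows "y = 0"
proof (rule ccontr)
  assume "y \<noteq> 0"
  define A where "A = {e. y $ e \<noteq> 0}"
  define m where "m e = min (x $ e) (1 - x $ e) / \<bar>y $ e\<bar>" for e
  define d where "d = Min (insert 1 (m ` A))"
  have mpos: "m e > 0" if "e \<in> A" for e using supp[of e] that by (simp add: m_def A_def)
  then have d: "d > 0" by (simp add: d_def)
  have dm: "d * \<bar>y $ e\<bar> \<le> min (x $ e) (1 - x $ e)" if "e \<in> A" for e
  proof -
    have "d \<le> m e" using that by (simp add: d_def)
    then show ?thesis using that by (simp add: m_def A_def pos_le_divide_eq)
  qed
  have xP: "x \<in> f2m_polytope" using x by (simp add: F2M_def extreme_point_of_def)
  have mem: "x + t *\<^sub>R y \<in> f2m_polytope" if t: "\<bar>t\<bar> = d" for t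
  proof -
    have "0 \<le> x $ e + t * y $ e \<and> x $ e + t * y $ e \<le> 1" if e: "e \<in> edges" for e
    proof (cases "e \<in> A")
      case True
      then have "\<bar>t * y $ e\<bar> \<le> min (x $ e) (1 - x $ e)" using dm t by (simp add: abs_mult)
      then show ?thesis by (simp add: abs_le_iff)
    next
      case False
      then show ?thesis using xP e by (simp add: A_def f2m_polytope_def)
    qed
    moreover have "x $ e + t * y $ e = 0" if "e \<notin> edges" for e
      using xP supp[of e] that by (auto simp: f2m_polytope_def)
    moreover have "(\<Sum>e\<in>cut {i}. x $ e + t * y $ e) = 2" for i
      using xP bal[of i] by (simp add: sum.distrib f2m_polytope_def flip: sum_distrib_left)
    ultimately show ?thesis by (simp add: f2m_polytope_def)
  qed
  have "x \<in> open_segment (x + d *\<^sub>R y) (x + (- d) *\<^sub>R y)"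
  proof -
    have "x + d *\<^sub>R y \<noteq> x + (- d) *\<^sub>R y" using d \<open>y \<noteq> 0\<close> by (simp add: eq_neg_iff_add_eq_0 flip: scaleR_left.add)
    moreover have "midpoint (x + d *\<^sub>R y) (x + (- d) *\<^sub>R y) = x" by (simp add: midpoint_def scaleR_2[symmetric] algebra_simps)
    ultimately show ?thesis using midpoint_in_open_segment by metis
  qed
  moreover have "x + d *\<^sub>R y \<in> f2m_polytope" "x + (- d) *\<^sub>R y \<in> f2m_polytope" using mem[of d] mem[of "-d"] d by auto
  ultimately show False using x unfolding F2M_def extreme_point_of_def by blast
qed

context
  fixes x :: "real ^ ('v::finite set)"
  assumes x: "F2M x"
begin

definition fractional :: "'v set set" where
  "fractional = {e \<in> edges. 0 < x $ e \<and> x $ e < 1}"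

lemma x_polytope: "x \<in> f2m_polytope"
  using x by (simp add: F2M_def extreme_point_of_def)

lemma x_integral: "e \<notin> fractional \<Longrightarrow> x $ e = 0 \<or> x $ e = 1"
  using x_polytope by (auto simp: fractional_def f2m_polytope_def order_less_le)

definition fnode :: "'v \<Rightarrow> 'v set set" where
  "fnode i = {e \<in> fractional. i \<in> e}"

lemma fnode_sum: "\<exists>m::int. (\<Sum>e\<in>fnode i. x $ e) = of_int m"
proof -
  have "(\<Sum>e\<in>cut {i}. x $ e) = (\<Sum>e\<in>fnode i. x $ e) + (\<Sum>e\<in>cut {i} - fnode i. x $ e)"
    by (subst sum.subset_diff[of "fnode i"]) (auto simp: fnode_def fractional_def cut_single)
  moreover have "(\<Sum>e\<in>cut {i} - fnode i. x $ e) \<in> \<int>"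
  proof (rule Ints_sum)
    fix e assume "e \<in> cut {i} - fnode i"
    then have "e \<notin> fractional" by (auto simp: fnode_def cut_single)
    then show "x $ e \<in> \<int>" using x_integral by fastforce
  qed
  moreover have "(\<Sum>e\<in>cut {i}. x $ e) = 2" using x_polytope by (simp add: f2m_polytope_def)
  ultimately have "(\<Sum>e\<in>fnode i. x $ e) = 2 - (\<Sum>e\<in>cut {i} - fnode i. x $ e)"
    "(\<Sum>e\<in>cut {i} - fnode i. x $ e) \<in> \<int>" by simp_all
  then have "(\<Sum>e\<in>fnode i. x $ e) \<in> \<int>" by (metis Ints_diff Ints_numeral)
  then show ?thesis by (auto elim: Ints_cases)
qed

lemma fnode_not_one: "card (fnode i) \<noteq> 1"
proof
  assume "card (fnode i) = 1"
  then obtain e where e: "fnode i = {e}" by (auto simp: card_1_singleton_iff)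
  obtain m :: int where "x $ e = of_int m" using fnode_sum[of i] e by auto
  moreover have "0 < x $ e" "x $ e < 1" using e by (auto simp: fnode_def fractional_def)
  ultimately show False by auto
qed

text \<open>By \<open>extreme_zero\<close>, vectors supported on the fractional edges are determined
  by their degrees, and these vanish off the nodes of fractional edges. Comparing dimensions gives
  the bound.\<close>

lemma fractional_count: "card fractional \<le> card (\<Union>fractional)"
proof -
  let ?A = "{y :: real ^ 'v set. \<forall>e. e \<notin> fractional \<longrightarrow> y $ e = 0}"
  let ?B = "{z :: real ^ 'v. \<forall>i. i \<notin> \<Union>fractional \<longrightarrow> z $ i = 0}"
  define T where "T y = (\<chi> i. \<Sum>e\<in>cut {i}. y $ e)" for y :: "real ^ 'v set"
  have lin: "linear T"
    by (rule linearI) (auto simp: T_def vec_eq_iff sum.distrib sum_distrib_left)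
  have sub: "subspace ?A" by (auto simp: subspace_def)
  have inj: "inj_on T ?A"
  proof (subst linear_inj_on_iff_eq_0[OF lin sub], intro ballI impI)
    fix y assume y: "y \<in> ?A" "T y = 0"
    then show "y = 0"
      by (intro extreme_zero[OF x]) (auto simp: fractional_def T_def vec_eq_iff)
  qed
  have sp: "span ?A = ?A" using sub by (simp only: span_eq_iff)
  have "inj_on T (span ?A)" unfolding sp by (rule inj)
  then have "dim (T ` ?A) = dim ?A" by (rule dim_image_eq[OF lin])
  moreover have "T ` ?A \<subseteq> ?B"
  proof clarsimp
    fix y :: "real ^ 'v set" and i assume y: "\<forall>e. e \<notin> fractional \<longrightarrow> y $ e = 0" "\<forall>e\<in>fractional. i \<notin> e"
    have "y $ e = 0" if "e \<in> cut {i}" for e using that y by (auto simp: cut_single)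
    then show "T y $ i = 0" by (simp add: T_def)
  qed
  then have "dim (T ` ?A) \<le> dim ?B" by (rule dim_subset)
  moreover have "dim ?A = card fractional" "dim ?B = card (\<Union>fractional)"
    unfolding dim_vec_eq[symmetric] by (rule dim_substandard_cart)+
  ultimately show ?thesis by simp
qed

text \<open>Integrality of the degrees excludes a single fractional edge at a node, so each such
  node has at least two. Counting incidences, \<open>fractional_count\<close> leaves room for no
  more.\<close>

lemma fnode_card:
  assumes "i \<in> \<Union>fractional"
  shows "card (fnode i) = 2"
proof -
  have ge: "card (fnode j) \<ge> 2" if "j \<in> \<Union>fractional" for j
  proof -
    have "fnode j \<noteq> {}" using that by (auto simp: fnode_def)
    then have "card (fnode j) \<noteq> 0" by simp
    then show ?thesis using fnode_not_one[of j] by linarith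
  qed
  have "(\<Sum>j\<in>\<Union>fractional. card (fnode j)) = (\<Sum>j\<in>\<Union>fractional. \<Sum>e\<in>fractional. if j \<in> e then 1 else 0)"
    by (simp add: fnode_def sum.If_cases Int_def)
  also have "\<dots> = (\<Sum>e\<in>fractional. \<Sum>j\<in>\<Union>fractional. if j \<in> e then 1 else 0)" by (rule sum.swap)
  also have "\<dots> = (\<Sum>e\<in>fractional. 2)"
  proof (rule sum.cong)
    fix e assume e: "e \<in> fractional"
    then have "\<Union>fractional \<inter> e = e" by auto
    then have "(\<Sum>j\<in>\<Union>fractional. if j \<in> e then 1 else 0 :: nat) = card e" by (simp add: sum.If_cases)
    then show "(\<Sum>j\<in>\<Union>fractional. if j \<in> e then 1 else 0 :: nat) = 2" using e by (simp add: fractional_def edges_def)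
  qed simp
  finally have tot: "(\<Sum>j\<in>\<Union>fractional. card (fnode j)) = 2 * card fractional" by simp
  have "(\<Sum>j\<in>\<Union>fractional. card (fnode j)) = card (fnode i) + (\<Sum>j\<in>\<Union>fractional - {i}. card (fnode j))"
    using assms by (intro sum.remove) auto
  moreover have "(\<Sum>j\<in>\<Union>fractional - {i}. card (fnode j)) \<ge> (\<Sum>j\<in>\<Union>fractional - {i}. 2)"
    using ge by (intro sum_mono) auto
  moreover have "card (\<Union>fractional - {i}) = card (\<Union>fractional) - 1" "card (\<Union>fractional) > 0"
    using assms by (auto simp: card_gt_0_iff)
  ultimately show ?thesis using tot fractional_count ge[OF assms] by simp
qed

text \<open>The two fractional values at a node add up to an integer strictly between 0 and 2. So
  subtracting 1/2 on all fractional edges gives a direction with zero degrees.\<close>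

lemma fractional_half:
  assumes "e \<in> fractional"
  shows "x $ e = 1/2"
proof -
  define y where "y = (\<chi> e. if e \<in> fractional then x $ e - 1/2 else 0)"
  have "y = 0"
  proof (rule extreme_zero[OF x])
    show "e \<in> edges \<and> 0 < x $ e \<and> x $ e < 1" if "y $ e \<noteq> 0" for e
      using that by (auto simp: y_def fractional_def split: if_splits)
    show "(\<Sum>e\<in>cut {i}. y $ e) = 0" for i
    proof -
      have "(\<Sum>e\<in>cut {i}. y $ e) = (\<Sum>e\<in>fnode i. y $ e)"
        by (intro sum.mono_neutral_right) (auto simp: cut_single fnode_def fractional_def y_def)
      also have "\<dots> = 0"
      proof (cases "i \<in> \<Union>fractional")
        case False
        then have "fnode i = {}" by (auto simp: fnode_def)
        then show ?thesis by simp
      next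
        case True
        then obtain a b where ab: "fnode i = {a, b}" "a \<noteq> b" using fnode_card[OF True] by (auto simp: card_2_iff)
        then have f: "a \<in> fractional" "b \<in> fractional" by (auto simp: fnode_def)
        obtain m :: int where m: "x $ a + x $ b = of_int m" using fnode_sum[of i] ab by auto
        have "0 < x $ a" "x $ a < 1" "0 < x $ b" "x $ b < 1" using f by (auto simp: fractional_def)
        then have "0 < (of_int m :: real)" "(of_int m :: real) < 2" using m by linarith+
        then have "m = 1" by simp
        then show ?thesis using ab f m by (simp add: y_def)
      qed
      finally show ?thesis .
    qed
  qed
  then have "y $ e = 0" by simp
  then show ?thesis using assms by (simp add: y_def)
qed

text \<open>Alternating signs around an even cycle give a direction with zero degrees.\<close>

lemma no_half_quadrangle:
  assumes h: "x $ {a, b} = 1/2" "x $ {b, c} = 1/2" "x $ {c, d} = 1/2" "x $ {d, a} = 1/2" and ne: "a \<noteq> c" "b \<noteq> d"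
  shows False
proof -
  have "e \<in> edges" if "x $ e = 1/2" for e using x_polytope that by (force simp: f2m_polytope_def)
  then have ed: "{a, b} \<in> edges" "{b, c} \<in> edges" "{c, d} \<in> edges" "{d, a} \<in> edges" using h by blast+
  then have n: "a \<noteq> b" "b \<noteq> c" "c \<noteq> d" "d \<noteq> a" by (auto simp: edges_iff)
  define y :: "real ^ 'v set" where "y = axis {a, b} 1 + axis {c, d} 1 - axis {b, c} 1 - axis {d, a} 1"
  have y: "y $ e = (if e = {a, b} then 1 else 0) + (if e = {c, d} then 1 else 0)
      - (if e = {b, c} then 1 else 0) - (if e = {d, a} then 1 else 0)" for e
    by (simp add: y_def axis_def)
  have "y = 0"
  proof (rule extreme_zero[OF x])
    show "e \<in> edges \<and> 0 < x $ e \<and> x $ e < 1" if "y $ e \<noteq> 0" for e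
    proof -
      have "e = {a, b} \<or> e = {c, d} \<or> e = {b, c} \<or> e = {d, a}" using that unfolding y by (auto split: if_splits)
      then show ?thesis using ed h by auto
    qed
    show "(\<Sum>e\<in>cut {i}. y $ e) = 0" for i
      unfolding y by (simp add: sum.distrib sum_subtractf cut_iff n) (use ne n in auto)
  qed
  moreover have "y $ {a, b} = 1" unfolding y using ne n by (auto simp: doubleton_eq_iff)
  ultimately show False by simp
qed

lemma edge_weights: "x $ {u, u} = 0" "x $ e = 0 \<or> x $ e = 1/2 \<or> x $ e = 1"
  using x_polytope edges_iff[of u u] x_integral[of e] fractional_half[of e] by (auto simp: f2m_polytope_def)

lemma half_nbs: "card {v. x $ {u, v} = 1/2} = card (fnode u)"
proof (rule bij_betw_same_card)
  have half: "x $ e = 1/2 \<longleftrightarrow> e \<in> fractional" for e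
    using fractional_half[of e] x_integral[of e] by (cases "e \<in> fractional") auto
  show "bij_betw (\<lambda>v. {u, v}) {v. x $ {u, v} = 1/2} (fnode u)"
    unfolding bij_betw_def
  proof
    show "(\<lambda>v. {u, v}) ` {v. x $ {u, v} = 1/2} = fnode u"
    proof (intro equalityI subsetI)
      fix e assume e: "e \<in> fnode u"
      then obtain p q where "e = {p, q}" "p \<noteq> q" using edgesE by (auto simp: fnode_def fractional_def)
      then obtain v where "e = {u, v}" using e by (auto simp: fnode_def insert_commute)
      then show "e \<in> (\<lambda>v. {u, v}) ` {v. x $ {u, v} = 1/2}" using e half by (auto simp: fnode_def)
    next
      fix e assume "e \<in> (\<lambda>v. {u, v}) ` {v. x $ {u, v} = 1/2}"
      then obtain v where "e = {u, v}" "x $ e = 1/2" by blast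
      moreover from this have "e \<in> fractional" using half by blast
      ultimately show "e \<in> fnode u" by (simp add: fnode_def)
    qed
  qed (auto simp: inj_on_def doubleton_eq_iff)
qed

lemma full_sum: "(\<Sum>v\<in>UNIV. x $ {u, v}) = 2"
proof -
  have "(\<Sum>v\<in>UNIV. x $ {u, v}) = (\<Sum>v\<in>-{u}. x $ {u, v})"
    using edge_weights(1) by (intro sum.mono_neutral_right) auto
  then show ?thesis using x_polytope by (simp add: f2m_polytope_def flip: sum_cut_single)
qed

lemma half_graph_F2M:
  assumes "two_connected x"
  shows "half_graph (\<lambda>u v. x $ {u, v}) (\<lambda>u v. c {u, v} = 2)"
proof
  show "x $ {u, v} = x $ {v, u}" for u v by (simp add: insert_commute)
  show "card {v. x $ {u, v} = 1/2} = 0 \<or> card {v. x $ {u, v} = 1/2} = 2" for u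
  proof (cases "u \<in> \<Union>fractional")
    case False
    then have "fnode u = {}" by (auto simp: fnode_def)
    then show ?thesis unfolding half_nbs by simp
  next
    case True
    then show ?thesis unfolding half_nbs by (simp add: fnode_card)
  qed
  show "2 \<le> (\<Sum>u\<in>S. \<Sum>v\<in>-S. x $ {u, v})" if "S \<noteq> {}" "S \<noteq> UNIV" for S
    using assms that by (simp add: two_connected_def sum_cut)
  show "a = c \<or> b = d" if "x $ {a, b} = 1/2" "x $ {b, c} = 1/2" "x $ {c, d} = 1/2" "x $ {d, a} = 1/2" for a b c d
    using no_half_quadrangle[OF that] by blast
  show "(c {u, v} = 2) = (c {v, u} = 2)" for u v by (simp add: insert_commute)
qed (use edge_weights full_sum in auto)

end

section \<open>Tours from covers\<close>

fun path_sum :: "('a \<Rightarrow> 'a \<Rightarrow> nat) \<Rightarrow> 'a list \<Rightarrow> nat" where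
  "path_sum g (x # y # zs) = g x y + path_sum g (y # zs)"
| "path_sum g _ = 0"

lemma path_sum_nth: "path_sum g xs = (\<Sum>i<length xs - 1. g (xs ! i) (xs ! Suc i))"
proof (induction g xs rule: path_sum.induct)
  case (1 g x y zs)
  show ?case using 1 by (simp add: sum.lessThan_Suc_shift del: sum.lessThan_Suc)
qed auto

lemma path_sum_append:
  "xs \<noteq> [] \<Longrightarrow> ys \<noteq> [] \<Longrightarrow> path_sum g (xs @ ys) = path_sum g xs + g (last xs) (hd ys) + path_sum g ys"
proof (induction g xs rule: path_sum.induct)
  case ("2_2" g v)
  then show ?case by (cases ys) auto
qed auto

context half_graph
begin

definition break :: "'v \<Rightarrow> 'v \<Rightarrow> nat" where
  "break u v = (if adj u v then 0 else 1)"

lemma path_sum_valid: "successively adj xs \<Longrightarrow> path_sum break xs = 0"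
  by (induction xs rule: induct_list012) (auto simp: break_def)

text \<open>Breaks occur only between pieces. The added 1 keeps the sharp count, needed for the
  closing edge later, without truncated subtraction.\<close>

lemma string_pieces:
  assumes "\<forall>p\<in>#P. valid p"
  shows "\<exists>L. mset L = nodes P \<and> path_sum break L + (if L = [] then 0 else 1) \<le> size P"
  using assms
proof (induction P)
  case (add p P)
  then obtain L where L: "mset L = nodes P" "path_sum break L + (if L = [] then 0 else 1) \<le> size P" by auto
  have p: "snd p \<noteq> []" "path_sum break (snd p) = 0" using add.prems path_sum_valid by (auto simp: valid_def)
  have "path_sum break (snd p @ L) + 1 \<le> size (add_mset p P)"
  proof (cases "L = []")
    case False
    have "break (last (snd p)) (hd L) \<le> 1" by (simp add: break_def)
    then show ?thesis using L(2) False p path_sum_append[OF p(1) False, of break] by simp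
  qed (simp add: p)
  then show ?case using L(1) p by (intro exI[of _ "snd p @ L"]) simp
qed simp

lemma cyclic_order:
  assumes "cover P"
  shows "\<exists>L. distinct L \<and> set L = UNIV \<and> (\<Sum>i<length L. break (L ! i) (L ! (Suc i mod length L))) \<le> size P"
proof -
  obtain L where L: "mset L = mset_set UNIV" "path_sum break L + (if L = [] then 0 else 1) \<le> size P"
    using string_pieces[of P] assms by (auto simp: cover_def)
  have sL: "set L = UNIV" using arg_cong[OF L(1), of set_mset] by simp
  have "length L = CARD('v)" using arg_cong[OF L(1), of size] by simp
  then have dL: "distinct L" "set L = UNIV" using sL by (simp_all add: card_distinct)
  then have ne: "L \<noteq> []" by auto
  then obtain m where m: "length L = Suc m" by (cases L) auto
  have "(\<Sum>i<length L. break (L ! i) (L ! (Suc i mod length L)))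
     = (\<Sum>i<m. break (L ! i) (L ! Suc i)) + break (L ! m) (L ! 0)"
    by (simp add: m)
  also have "\<dots> \<le> path_sum break L + 1" by (simp add: path_sum_nth m break_def)
  finally show ?thesis using dL L(2) ne by auto
qed

lemma closed_order:
  assumes "valid (True, Z)" "i < length Z"
  shows "break (Z ! i) (Z ! (Suc i mod length Z)) = 0"
proof (cases "Suc i < length Z")
  case True
  then show ?thesis using assms successively_nth[of adj Z i] by (auto simp: valid_def break_def)
next
  case False
  then have "Suc i = length Z" using assms by simp
  moreover have "adj (last Z) (hd Z)" "Z \<noteq> []" using assms by (auto simp: valid_def)
  ultimately show ?thesis by (auto simp: break_def last_conv_nth hd_conv_nth dest: arg_cong[of _ _ "\<lambda>n. n - 1"])
qed

end

lemma tour_of_order: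
  fixes c :: "'v::finite set \<Rightarrow> real"
  assumes "CARD('v) \<ge> 3" "\<forall>e\<in>edges. c e \<in> {1, 2}" "distinct L" "set L = (UNIV :: 'v set)"
    and c: "\<And>u v. u \<noteq> v \<Longrightarrow> c {u, v} \<le> 1 + real (g u v)"
  shows "\<exists>T. tour T \<and> (\<Sum>e\<in>T. c e) \<le> real CARD('v) + real (\<Sum>i<length L. g (L ! i) (L ! (Suc i mod length L)))"
proof -
  let ?e = "\<lambda>i. {L ! i, L ! (Suc i mod length L)}"
  have len: "length L = CARD('v)" using assms(3,4) by (metis distinct_card)
  have ne: "L ! i \<noteq> L ! (Suc i mod length L)" if "i < length L" for i
  proof -
    have "i \<noteq> Suc i mod length L" using that len assms(1) by (auto simp: mod_Suc)
    moreover have "Suc i mod length L < length L" using that by (intro mod_less_divisor) linarith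
    ultimately show ?thesis using nth_eq_iff_index_eq[OF assms(3) that] by blast
  qed
  have T: "closed_walk_edges L = ?e ` {..<length L}" by (auto simp: closed_walk_edges_def)
  have "\<Union>(closed_walk_edges L) = UNIV"
  proof -
    have "v \<in> \<Union>(closed_walk_edges L)" for v
    proof -
      obtain i where "i < length L" "L ! i = v" using assms(4) by (metis UNIV_I in_set_conv_nth)
      then show ?thesis unfolding T by auto
    qed
    then show ?thesis by auto
  qed
  then have "tour (closed_walk_edges L)" unfolding tour_def is_cycle_def using assms(1,3) len by auto
  moreover have "(\<Sum>e\<in>closed_walk_edges L. c e) \<le> (\<Sum>i<length L. c (?e i))"
  proof -
    have "0 \<le> c (?e i)" if "i \<in> {..<length L}" for i
    proof -
      have "?e i \<in> edges" using ne that by (simp add: edges_iff)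
      then show ?thesis using assms(2) by force
    qed
    then show ?thesis unfolding T using sum_image_le[of "{..<length L}" c ?e] by simp
  qed
  moreover have "(\<Sum>i<length L. c (?e i)) \<le> (\<Sum>i<length L. 1 + real (g (L ! i) (L ! (Suc i mod length L))))"
    using ne c by (intro sum_mono) auto
  ultimately show ?thesis by (intro exI[of _ "closed_walk_edges L"]) (simp add: sum.distrib len)
qed

theorem theorem4:
  fixes c :: "'v::finite set \<Rightarrow> real" and x :: "real ^ ('v set)"
  assumes "CARD('v) \<ge> 3"
    and "\<forall>e\<in>edges. c e \<in> {1, 2}"
    and "F2M x"
    and "two_connected x"
    and "canonical c x"
  shows "\<exists>T. tour T \<and> (\<Sum>e\<in>T. c e) \<le> 10 / 9 * (\<Sum>e\<in>edges. c e * x $ e)"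
proof -
  interpret half_graph "\<lambda>u v. x $ {u, v}" "\<lambda>u v. c {u, v} = 2"
    using half_graph_F2M[OF assms(3,4)] .
  obtain Q where "optimal Q" using ex_optimal by blast
  then interpret optimal_cover "\<lambda>u v. x $ {u, v}" "\<lambda>u v. c {u, v} = 2" Q
    by unfold_locales
  have c12: "c {u, v} = 1 \<or> c {u, v} = 2" if "u \<noteq> v" for u v using assms(2) that by (auto simp flip: edges_iff)
  \<comment> \<open>Costs are 1 or 2, so \<open>c e - 1\<close> indicates cost 2, and
    \<open>phi\<close> becomes a sum over all edges at a node.\<close>
  have "(\<Sum>v\<in>UNIV. phi v) = (\<Sum>u\<in>UNIV. \<Sum>v\<in>-{u}. 5 * ((c {u, v} - 1) * x $ {u, v}))"
  proof (rule sum.cong)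
    fix u
    have "phi u = (\<Sum>v\<in>UNIV. if c {u, v} = 2 then 5 * x $ {u, v} else 0)"
      unfolding phi_def by (simp add: sum.If_cases)
    also have "\<dots> = (\<Sum>v\<in>-{u}. if c {u, v} = 2 then 5 * x $ {u, v} else 0)"
      using w_irrefl by (intro sum.mono_neutral_right) auto
    also have "\<dots> = (\<Sum>v\<in>-{u}. 5 * ((c {u, v} - 1) * x $ {u, v}))"
    proof (intro sum.cong refl)
      fix v assume "v \<in> -{u}"
      then have "c {u, v} = 1 \<or> c {u, v} = 2" using c12[of u v] by auto
      then show "(if c {u, v} = 2 then 5 * x $ {u, v} else 0) = 5 * ((c {u, v} - 1) * x $ {u, v})"
        by auto
    qed
    finally show "phi u = (\<Sum>v\<in>-{u}. 5 * ((c {u, v} - 1) * x $ {u, v}))" .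
  qed simp
  also have "\<dots> = 2 * (\<Sum>e\<in>edges. 5 * ((c e - 1) * x $ e))"
    by (rule sum_edges[of "\<lambda>e. 5 * ((c e - 1) * x $ e)"])
  also have "\<dots> = 10 * (\<Sum>e\<in>edges. (c e - 1) * x $ e)" by (simp flip: sum_distrib_left)
  finally have Phi: "(\<Sum>v\<in>UNIV. phi v) = 10 * (\<Sum>e\<in>edges. (c e - 1) * x $ e)" .
  have "(\<Sum>u\<in>(UNIV::'v set). \<Sum>v\<in>-{u}. x $ {u, v}) = (\<Sum>u\<in>(UNIV::'v set). 2)"
    using w_sum w_irrefl by (intro sum.cong) (auto simp: Compl_eq_Diff_UNIV sum_diff1)
  then have n: "(\<Sum>e\<in>edges. x $ e) = real CARD('v)" using sum_edges[of "($) x"] by simp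
  have lp: "(\<Sum>e\<in>edges. c e * x $ e) = real CARD('v) + (\<Sum>v\<in>UNIV. phi v) / 10"
    unfolding Phi n[symmetric] by (simp add: left_diff_distrib sum_subtractf diff_divide_distrib)
  have "c {u, v} \<le> 1 + real (break u v)" if "u \<noteq> v" for u v
    using c12[OF that] w_nonneg[of u v] by (auto simp: break_def adj_def)
  note tour = tour_of_order[OF assms(1,2) _ _ this]
  have "(\<Sum>v\<in>UNIV. phi v) \<ge> 0" using phi_nonneg by (intro sum_nonneg) auto
  show ?thesis
  proof (cases "\<exists>Z\<in>cycs. set Z = UNIV")
    case True
    then obtain Z where Z: "Z \<in> cycs" "set Z = UNIV" by blast
    obtain T where "tour T" "(\<Sum>e\<in>T. c e) \<le> real CARD('v) + real (\<Sum>i<length Z. break (Z ! i) (Z ! (Suc i mod length Z)))"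
      using tour[OF cycin_distinct[OF cycs_in[OF Z(1)]] Z(2)] by blast
    moreover have "(\<Sum>i<length Z. break (Z ! i) (Z ! (Suc i mod length Z))) = 0"
      using closed_order[OF cycin_valid[OF cycs_in[OF Z(1)]]] by simp
    ultimately show ?thesis using lp \<open>0 \<le> (\<Sum>v\<in>UNIV. phi v)\<close> by (intro exI[of _ T]) auto
  next
    case False
    obtain L where L: "distinct L" "set L = UNIV"
        "(\<Sum>i<length L. break (L ! i) (L ! (Suc i mod length L))) \<le> size Q"
      using cyclic_order[OF cover_Q] by blast
    obtain T where T: "tour T"
        "(\<Sum>e\<in>T. c e) \<le> real CARD('v) + real (\<Sum>i<length L. break (L ! i) (L ! (Suc i mod length L)))"
      using tour[OF L(1,2)] by blast
    have "9 * real (size Q) \<le> real CARD('v) + (\<Sum>v\<in>UNIV. phi v)" using cover_bound False by blast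
    moreover have "(\<Sum>e\<in>T. c e) \<le> real CARD('v) + real (size Q)"
      using T(2) L(3) by (meson add_left_mono of_nat_mono order_trans)
    ultimately show ?thesis using T(1) lp by (intro exI[of _ T]) simp
  qed
qed

end
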